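(* Let $R$ be a commutative ring, let $C$ be a semidualizing $R$-module, and let $M$ and $N$ be $R$-modules. There is an isomorphism $\operatorname{Ext}^i_{\mathcal{P}_C}(M,N)\cong\operatorname{Ext}^i_R(\operatorname{Hom}_R(C,M),\operatorname{Hom}_R(C,N))$ for all $i$. If $M$ and $N$ are in the Bass class $\mathcal{B}_C$ with respect to $C$, then $\operatorname{Ext}^i_{\mathcal{P}_C}(M,N)\cong\operatorname{Ext}^i_R(M,N)$ for all $i$.
   Context: $R$ is a commutative ring (not necessarily noetherian). An $R$-module $C$ is semidualizing if (a) $C$ admits a projective resolution by finitely generated projective modules, (b) the natural homothety map $R\to\operatorname{Hom}_R(C,C)$ is an isomorphism, and (c) $\operatorname{Ext}^i_R(C,C)=0$ for all $i\geq 1$. An augmented proper $\mathcal{P}_C$-projective resolution of $M$ is a complex $X^+=\cdots\to C\otimes_R P_1\to C\otimes_R P_0\to M\to 0$ with each $P_i$ projective such that $\operatorname{Hom}_R(C\otimes_R Q,X^+)$ is exact for every projective $R$-module $Q$ ($X^+$ itself need not be exact); the truncated complex $X=\cdots\to C\otimes_R P_1\to C\otimes_R P_0\to 0$ is a proper $\mathcal{P}_C$-projective resolution of $M$. Every $R$-module has one, unique up to homotopy equivalence, so $\operatorname{Ext}^i_{\mathcal{P}_C}(M,N)=\operatorname{H}^i(\operatorname{Hom}_R(X,N))$ is well defined. The Bass class $\mathcal{B}_C$ consists of all $R$-modules $M$ such that $\operatorname{Ext}_R^{i}(C,M)=0=\operatorname{Tor}^R_{i}(C,\operatorname{Hom}_R(C,M))$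 for all $i\ge1$ and the natural evaluation map $\nu_M\colon C\otimes_R\operatorname{Hom}_R(C,M)\to M$ is an isomorphism. *)

theory Defs
  imports "HOL-Algebra.Module" "HOL-Algebra.AbelCoset"
begin

section \<open>Homomorphisms, quotients and free modules\<close>

text \<open>
  The multiplicative fields of \<^typ>\<open>('a, 'b) module\<close> carry no meaning for modules (the locale
  \<^locale>\<open>module\<close> says nothing about them), so they are left undefined in the constructions
  below.
\<close>

definition mod_hom ::
  "[('a, _) ring_scheme, ('a, 'b, _) module_scheme, ('a, 'c, _) module_scheme] \<Rightarrow> ('b \<Rightarrow> 'c) set"
  where "mod_hom R M N =
    {f \<in> carrier M \<rightarrow>\<^sub>E carrier N.
      (\<forall>x\<in>carrier M. \<forall>y\<in>carrier M. f (x \<oplus>\<^bsub>M\<^esub> y) = f x \<oplus>\<^bsub>N\<^esub> f y) \<and>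
      (\<forall>a\<in>carrier R. \<forall>x\<in>carrier M. f (a \<odot>\<^bsub>M\<^esub> x) = a \<odot>\<^bsub>N\<^esub> f x)}"

definition hom_mod ::
  "[('a, _) ring_scheme, ('a, 'b, _) module_scheme, ('a, 'c, _) module_scheme]
    \<Rightarrow> ('a, 'b \<Rightarrow> 'c) module"
  where "hom_mod R M N =
    \<lparr>carrier = mod_hom R M N, mult = undefined, one = undefined,
     zero = (\<lambda>x\<in>carrier M. \<zero>\<^bsub>N\<^esub>),
     add = (\<lambda>f g. \<lambda>x\<in>carrier M. f x \<oplus>\<^bsub>N\<^esub> g x),
     smult = (\<lambda>a f. \<lambda>x\<in>carrier M. a \<odot>\<^bsub>N\<^esub> f x)\<rparr>"

definition is_mod_iso ::
  "[('a, _) ring_scheme, ('a, 'b, _) module_scheme, ('a, 'c, _) module_scheme, 'b \<Rightarrow> 'c] \<Rightarrow> bool"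
  where "is_mod_iso R M N f \<longleftrightarrow> f \<in> mod_hom R M N \<and> bij_betw f (carrier M) (carrier N)"

definition mod_isomorphic ::
  "[('a, _) ring_scheme, ('a, 'b, _) module_scheme, ('a, 'c, _) module_scheme] \<Rightarrow> bool"
  where "mod_isomorphic R M N \<longleftrightarrow> (\<exists>f. is_mod_iso R M N f)"

definition zero_mod :: "('a, 'b, _) module_scheme \<Rightarrow> bool"
  where "zero_mod M \<longleftrightarrow> carrier M = {\<zero>\<^bsub>M\<^esub>}"

definition regular_mod :: "('a, _) ring_scheme \<Rightarrow> ('a, 'a) module"
  where "regular_mod R =
    \<lparr>carrier = carrier R, mult = undefined, one = undefined,
     zero = \<zero>\<^bsub>R\<^esub>, add = (\<oplus>\<^bsub>R\<^esub>), smult = (\<otimes>\<^bsub>R\<^esub>)\<rparr>"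

definition quot_mod :: "[('a, 'b, _) module_scheme, 'b set] \<Rightarrow> ('a, 'b set) module"
  where "quot_mod M H =
    \<lparr>carrier = a_rcosets\<^bsub>M\<^esub> H, mult = undefined, one = undefined,
     zero = H, add = (<+>\<^bsub>M\<^esub>),
     smult = (\<lambda>a K. \<Union>x\<in>K. H +>\<^bsub>M\<^esub> (a \<odot>\<^bsub>M\<^esub> x))\<rparr>"

definition submod_span :: "[('a, _) ring_scheme, ('a, 'b, _) module_scheme, 'b set] \<Rightarrow> 'b set"
  where "submod_span R M A = \<Inter>{H. submodule H R M \<and> A \<subseteq> H}"

definition fin_gen :: "[('a, _) ring_scheme, ('a, 'b, _) module_scheme] \<Rightarrow> bool"
  where "fin_gen R M \<longleftrightarrow> (\<exists>A. finite A \<and> A \<subseteq> carrier M \<and> submod_span R M A = carrier M)"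

definition free_mod :: "[('a, _) ring_scheme, 's set] \<Rightarrow> ('a, 's \<Rightarrow> 'a) module"
  where "free_mod R S =
    \<lparr>carrier = {f. (\<forall>s. f s \<in> carrier R) \<and> (\<forall>s. s \<notin> S \<longrightarrow> f s = \<zero>\<^bsub>R\<^esub>) \<and> finite {s. f s \<noteq> \<zero>\<^bsub>R\<^esub>}},
     mult = undefined, one = undefined,
     zero = (\<lambda>s. \<zero>\<^bsub>R\<^esub>), add = (\<lambda>f g s. f s \<oplus>\<^bsub>R\<^esub> g s), smult = (\<lambda>a f s. a \<otimes>\<^bsub>R\<^esub> f s)\<rparr>"

definition free_gen :: "[('a, _) ring_scheme, 's] \<Rightarrow> 's \<Rightarrow> 'a"
  where "free_gen R s = (\<lambda>t. if t = s then \<one>\<^bsub>R\<^esub> else \<zero>\<^bsub>R\<^esub>)"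

text \<open>
  Projective modules are the direct summands of free modules. It is no restriction to take the
  basis inside the type of the module itself, since a projective module is a direct summand of the
  free module on its own underlying set.
\<close>

definition projective :: "[('a, _) ring_scheme, ('a, 'p, _) module_scheme] \<Rightarrow> bool"
  where "projective R P \<longleftrightarrow> module R P \<and>
    (\<exists>(S :: 'p set) s r. s \<in> mod_hom R P (free_mod R S) \<and> r \<in> mod_hom R (free_mod R S) P \<and>
       (\<forall>x\<in>carrier P. r (s x) = x))"


section \<open>Tensor products\<close>

definition tensor_rels ::
  "[('a, _) ring_scheme, ('a, 'b, _) module_scheme, ('a, 'c, _) module_scheme]
    \<Rightarrow> ('b \<times> 'c \<Rightarrow> 'a) set"
  where "tensor_rels R A B =
    (let F = free_mod R (carrier A \<times> carrier B); e = (\<lambda>x y. free_gen R (x, y)) in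
      {e (x \<oplus>\<^bsub>A\<^esub> x') y \<ominus>\<^bsub>F\<^esub> (e x y \<oplus>\<^bsub>F\<^esub> e x' y) | x x' y.
         x \<in> carrier A \<and> x' \<in> carrier A \<and> y \<in> carrier B} \<union>
      {e x (y \<oplus>\<^bsub>B\<^esub> y') \<ominus>\<^bsub>F\<^esub> (e x y \<oplus>\<^bsub>F\<^esub> e x y') | x y y'.
         x \<in> carrier A \<and> y \<in> carrier B \<and> y' \<in> carrier B} \<union>
      {e (a \<odot>\<^bsub>A\<^esub> x) y \<ominus>\<^bsub>F\<^esub> (a \<odot>\<^bsub>F\<^esub> e x y) | a x y.
         a \<in> carrier R \<and> x \<in> carrier A \<and> y \<in> carrier B} \<union>
      {e x (a \<odot>\<^bsub>B\<^esub> y) \<ominus>\<^bsub>F\<^esub> (a \<odot>\<^bsub>F\<^esub> e x y) | a x y.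
         a \<in> carrier R \<and> x \<in> carrier A \<and> y \<in> carrier B})"

definition tensor_ker ::
  "[('a, _) ring_scheme, ('a, 'b, _) module_scheme, ('a, 'c, _) module_scheme]
    \<Rightarrow> ('b \<times> 'c \<Rightarrow> 'a) set"
  where "tensor_ker R A B =
    submod_span R (free_mod R (carrier A \<times> carrier B)) (tensor_rels R A B)"

definition tensor_mod ::
  "[('a, _) ring_scheme, ('a, 'b, _) module_scheme, ('a, 'c, _) module_scheme]
    \<Rightarrow> ('a, ('b \<times> 'c \<Rightarrow> 'a) set) module"
  where "tensor_mod R A B = quot_mod (free_mod R (carrier A \<times> carrier B)) (tensor_ker R A B)"

definition pure_tensor ::
  "[('a, _) ring_scheme, ('a, 'b, _) module_scheme, ('a, 'c, _) module_scheme, 'b, 'c]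
    \<Rightarrow> ('b \<times> 'c \<Rightarrow> 'a) set"
  where "pure_tensor R A B x y =
    tensor_ker R A B +>\<^bsub>free_mod R (carrier A \<times> carrier B)\<^esub> free_gen R (x, y)"

text \<open>
  The linear map on \<open>A \<otimes> B\<close> induced by a bilinear map \<open>\<beta>\<close>: a representative \<open>t\<close> of a class is sent
  to \<open>\<Sum> t (x, y) \<cdot> \<beta> x y\<close>, which does not depend on the representative.
\<close>

definition tensor_lift ::
  "[('a, _) ring_scheme, ('a, 'b, _) module_scheme, ('a, 'c, _) module_scheme,
    ('a, 'd, _) module_scheme, 'b \<Rightarrow> 'c \<Rightarrow> 'd] \<Rightarrow> ('b \<times> 'c \<Rightarrow> 'a) set \<Rightarrow> 'd"
  where "tensor_lift R A B L \<beta> =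
    (\<lambda>K\<in>carrier (tensor_mod R A B).
      the_elem ((\<lambda>t. \<Oplus>\<^bsub>L\<^esub>p\<in>{p. t p \<noteq> \<zero>\<^bsub>R\<^esub>}. t p \<odot>\<^bsub>L\<^esub> \<beta> (fst p) (snd p)) ` K))"

definition tensor_map ::
  "[('a, _) ring_scheme, ('a, 'c, _) module_scheme, ('a, 'p, _) module_scheme,
    ('a, 'q, _) module_scheme, 'p \<Rightarrow> 'q] \<Rightarrow> ('c \<times> 'p \<Rightarrow> 'a) set \<Rightarrow> ('c \<times> 'q \<Rightarrow> 'a) set"
  where "tensor_map R C P Q f =
    tensor_lift R C P (tensor_mod R C Q) (\<lambda>c p. pure_tensor R C Q c (f p))"


section \<open>Complexes and resolutions\<close>

text \<open>
  An augmented chain complex \<open>\<dots> \<rightarrow> X\<^sub>1 \<rightarrow> X\<^sub>0 \<rightarrow> M \<rightarrow> 0\<close> is given by modules \<open>X n\<close>, differentials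
  \<open>d n\<close> from \<open>X (n + 1)\<close> to \<open>X n\<close> and an augmentation \<open>e\<close> from \<open>X 0\<close> to \<open>M\<close>.
\<close>

definition aug_complex ::
  "[('a, _) ring_scheme, nat \<Rightarrow> ('a, 'x, _) module_scheme, nat \<Rightarrow> 'x \<Rightarrow> 'x,
    ('a, 'b, _) module_scheme, 'x \<Rightarrow> 'b] \<Rightarrow> bool"
  where "aug_complex R X d M e \<longleftrightarrow>
    (\<forall>n. d n \<in> mod_hom R (X (Suc n)) (X n)) \<and> e \<in> mod_hom R (X 0) M \<and>
    (\<forall>n. \<forall>x\<in>carrier (X (Suc (Suc n))). d n (d (Suc n) x) = \<zero>\<^bsub>X n\<^esub>) \<and>
    (\<forall>x\<in>carrier (X (Suc 0)). e (d 0 x) = \<zero>\<^bsub>M\<^esub>)"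

definition aug_exact ::
  "[nat \<Rightarrow> ('a, 'x, _) module_scheme, nat \<Rightarrow> 'x \<Rightarrow> 'x, ('a, 'b, _) module_scheme, 'x \<Rightarrow> 'b] \<Rightarrow> bool"
  where "aug_exact X d M e \<longleftrightarrow>
    e ` carrier (X 0) = carrier M \<and>
    {x \<in> carrier (X 0). e x = \<zero>\<^bsub>M\<^esub>} = d 0 ` carrier (X (Suc 0)) \<and>
    (\<forall>n. {x \<in> carrier (X (Suc n)). d n x = \<zero>\<^bsub>X n\<^esub>} = d (Suc n) ` carrier (X (Suc (Suc n))))"

definition homology ::
  "[nat \<Rightarrow> ('a, 'x, 'm) module_scheme, nat \<Rightarrow> 'x \<Rightarrow> 'x, nat] \<Rightarrow> ('a, 'x set) module"
  where "homology X d i =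
    quot_mod
      ((X i)\<lparr>carrier :=
         (case i of 0 \<Rightarrow> carrier (X 0) | Suc j \<Rightarrow> {x \<in> carrier (X i). d j x = \<zero>\<^bsub>X j\<^esub>})\<rparr>)
      (d i ` carrier (X (Suc i)))"

text \<open>For cochain complexes, \<open>d n\<close> goes from \<open>K n\<close> to \<open>K (n + 1)\<close>.\<close>

definition cohomology ::
  "[nat \<Rightarrow> ('a, 'x, 'm) module_scheme, nat \<Rightarrow> 'x \<Rightarrow> 'x, nat] \<Rightarrow> ('a, 'x set) module"
  where "cohomology K d i =
    quot_mod
      ((K i)\<lparr>carrier := {x \<in> carrier (K i). d i x = \<zero>\<^bsub>K (Suc i)\<^esub>}\<rparr>)
      (case i of 0 \<Rightarrow> {\<zero>\<^bsub>K 0\<^esub>} | Suc j \<Rightarrow> d j ` carrier (K j))"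

definition hom_cohomology ::
  "[('a, _) ring_scheme, nat \<Rightarrow> ('a, 'x, _) module_scheme, nat \<Rightarrow> 'x \<Rightarrow> 'x,
    ('a, 'b, _) module_scheme, nat] \<Rightarrow> ('a, ('x \<Rightarrow> 'b) set) module"
  where "hom_cohomology R X d N i =
    cohomology (\<lambda>n. hom_mod R (X n) N) (\<lambda>n f. compose (carrier (X (Suc n))) f (d n)) i"

definition projective_resolution ::
  "[('a, _) ring_scheme, ('a, 'b, _) module_scheme,
    nat \<Rightarrow> ('a, 'p) module, nat \<Rightarrow> 'p \<Rightarrow> 'p, 'p \<Rightarrow> 'b] \<Rightarrow> bool"
  where "projective_resolution R M P d e \<longleftrightarrow>
    (\<forall>n. projective R (P n)) \<and> aug_complex R P d M e \<and> aug_exact P d M e"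

text \<open>
  An augmented proper \<open>\<P>\<^sub>C\<close>-projective resolution of \<open>M\<close>; only the complexes \<open>Hom(C \<otimes> Q, X\<^sup>+)\<close> are
  required to be exact. The test modules \<open>Q\<close> range over the projective modules that live in
  \<^typ>\<open>'s \<Rightarrow> 'a\<close>. This type always contains an isomorphic copy of \<open>R\<close>, and exactness for \<open>Q = R\<close>
  yields exactness for all free modules and their direct summands, of whatever size.
\<close>

definition proper_PC_resolution ::
  "[('a, _) ring_scheme, ('a, 'c, _) module_scheme, ('a, 'b, _) module_scheme,
    nat \<Rightarrow> ('a, 's \<Rightarrow> 'a) module,
    nat \<Rightarrow> ('c \<times> ('s \<Rightarrow> 'a) \<Rightarrow> 'a) set \<Rightarrow> ('c \<times> ('s \<Rightarrow> 'a) \<Rightarrow> 'a) set,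
    ('c \<times> ('s \<Rightarrow> 'a) \<Rightarrow> 'a) set \<Rightarrow> 'b] \<Rightarrow> bool"
  where "proper_PC_resolution R C M P d e \<longleftrightarrow>
    (\<forall>n. projective R (P n)) \<and>
    aug_complex R (\<lambda>n. tensor_mod R C (P n)) d M e \<and>
    (\<forall>Q :: ('a, 's \<Rightarrow> 'a) module. projective R Q \<longrightarrow>
      (let T = tensor_mod R C Q in
       aug_exact
         (\<lambda>n. hom_mod R T (tensor_mod R C (P n)))
         (\<lambda>n f. compose (carrier T) (d n) f)
         (hom_mod R T M)
         (\<lambda>f. compose (carrier T) e f)))"


section \<open>Existence of projective resolutions\<close>

text \<open>
  Resolutions of a module with elements in \<^typ>\<open>'b\<close> are chosen among modules with elements in
  \<open>('a, 'b) res\<close>. The free modules on sets of words over \<^typ>\<open>'a + 'b\<close> live in this type; there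
  are infinitely many words and at least as many words as there are ring and module elements, so
  that these free modules suffice to resolve every such module (\<open>ex_projective_resolution\<close>).
  Finitely generated projective modules have isomorphic copies in this type as well.
\<close>

type_synonym ('a, 'b) res = "('a + 'b) list \<Rightarrow> 'a"

lemma mod_homD:
  assumes "f \<in> mod_hom R M N"
  shows "\<And>x. x \<in> carrier M \<Longrightarrow> f x \<in> carrier N"
    and "\<And>x y. x \<in> carrier M \<Longrightarrow> y \<in> carrier M \<Longrightarrow> f (x \<oplus>\<^bsub>M\<^esub> y) = f x \<oplus>\<^bsub>N\<^esub> f y"
    and "\<And>a x. a \<in> carrier R \<Longrightarrow> x \<in> carrier M \<Longrightarrow> f (a \<odot>\<^bsub>M\<^esub> x) = a \<odot>\<^bsub>N\<^esub> f x"
  using assms by (auto simp: mod_hom_def)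

lemma mod_hom_zero:
  assumes "module R M" "module R N" "f \<in> mod_hom R M N"
  shows "f \<zero>\<^bsub>M\<^esub> = \<zero>\<^bsub>N\<^esub>"
proof -
  interpret M: module R M by fact
  interpret N: module R N by fact
  have "f (\<zero>\<^bsub>R\<^esub> \<odot>\<^bsub>M\<^esub> \<zero>\<^bsub>M\<^esub>) = \<zero>\<^bsub>R\<^esub> \<odot>\<^bsub>N\<^esub> f \<zero>\<^bsub>M\<^esub>"
    by (rule mod_homD(3)[OF assms(3)]) simp_all
  then show ?thesis
    using mod_homD(1)[OF assms(3)] by simp
qed

lemma mod_hom_finsum:
  assumes "module R M" "module R N" "f \<in> mod_hom R M N" "finite A" "g \<in> A \<rightarrow> carrier M"
  shows "f (\<Oplus>\<^bsub>M\<^esub>s\<in>A. g s) = (\<Oplus>\<^bsub>N\<^esub>s\<in>A. f (g s))"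
proof -
  interpret M: module R M by fact
  interpret N: module R N by fact
  show ?thesis
    using assms(4,5)
  proof (induction A rule: finite_induct)
    case empty
    then show ?case by (simp add: mod_hom_zero[OF assms(1-3)])
  next
    case (insert x A)
    then have g: "g x \<in> carrier M" "g \<in> A \<rightarrow> carrier M" by auto
    then have "(\<lambda>s. f (g s)) \<in> A \<rightarrow> carrier N" "f (g x) \<in> carrier N"
      by (auto simp: Pi_iff intro!: mod_homD(1)[OF assms(3)])
    moreover have "(\<Oplus>\<^bsub>M\<^esub>s\<in>A. g s) \<in> carrier M" using g by (simp add: M.finsum_closed)
    ultimately show ?case
      using insert g mod_homD(2)[OF assms(3)] by (simp add: o_def)
  qed
qed

lemma free_mod_simps:
  "\<zero>\<^bsub>free_mod R S\<^esub> = (\<lambda>s. \<zero>\<^bsub>R\<^esub>)"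
  "f \<oplus>\<^bsub>free_mod R S\<^esub> g = (\<lambda>s. f s \<oplus>\<^bsub>R\<^esub> g s)"
  "a \<odot>\<^bsub>free_mod R S\<^esub> f = (\<lambda>s. a \<otimes>\<^bsub>R\<^esub> f s)"
  by (simp_all add: free_mod_def)

lemma module_free_mod:
  assumes "cring R"
  shows "module R (free_mod R S)"
proof -
  interpret cring R by fact
  have *: "finite {s. h s \<noteq> \<zero>\<^bsub>R\<^esub>}"
    if "finite {s. f s \<noteq> \<zero>\<^bsub>R\<^esub>}" "finite {s. g s \<noteq> \<zero>\<^bsub>R\<^esub>}"
      "\<And>s. f s = \<zero>\<^bsub>R\<^esub> \<Longrightarrow> g s = \<zero>\<^bsub>R\<^esub> \<Longrightarrow> h s = \<zero>\<^bsub>R\<^esub>" for f g h :: "'s \<Rightarrow> 'a"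
    by (rule finite_subset[OF _ finite_UnI[OF that(1,2)]]) (use that(3) in blast)
  show ?thesis
  proof (rule moduleI[OF assms])
    show "abelian_group (free_mod R S)"
    proof (rule abelian_groupI)
      fix f assume f: "f \<in> carrier (free_mod R S)"
      then have "(\<lambda>s. \<ominus>\<^bsub>R\<^esub> f s) \<in> carrier (free_mod R S)"
        using *[of f f] by (auto simp: free_mod_def)
      moreover have "(\<lambda>s. \<ominus>\<^bsub>R\<^esub> f s) \<oplus>\<^bsub>free_mod R S\<^esub> f = \<zero>\<^bsub>free_mod R S\<^esub>"
        using f by (auto simp: free_mod_def l_neg)
      ultimately show "\<exists>g\<in>carrier (free_mod R S). g \<oplus>\<^bsub>free_mod R S\<^esub> f = \<zero>\<^bsub>free_mod R S\<^esub>"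
        by blast
    next
      fix f g assume "f \<in> carrier (free_mod R S)" "g \<in> carrier (free_mod R S)"
      then show "f \<oplus>\<^bsub>free_mod R S\<^esub> g \<in> carrier (free_mod R S)"
        using *[of f g] by (auto simp: free_mod_def)
    qed (auto simp: free_mod_def a_ac)
  next
    fix a f assume "a \<in> carrier R" "f \<in> carrier (free_mod R S)"
    then show "a \<odot>\<^bsub>free_mod R S\<^esub> f \<in> carrier (free_mod R S)"
      using *[of f f] by (auto simp: free_mod_def)
  qed (auto simp: free_mod_def l_distr r_distr m_assoc)
qed

lemma free_gen_closed:
  assumes "cring R" "s \<in> S"
  shows "free_gen R s \<in> carrier (free_mod R S)"
proof -
  interpret cring R by fact
  show ?thesis using assms(2) by (auto simp: free_mod_def free_gen_def)
qed

definition free_lift ::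
  "[('a, _) ring_scheme, 's set, ('a, 'b, _) module_scheme, 's \<Rightarrow> 'b] \<Rightarrow> ('s \<Rightarrow> 'a) \<Rightarrow> 'b"
  where "free_lift R S M g =
    (\<lambda>f\<in>carrier (free_mod R S). \<Oplus>\<^bsub>M\<^esub>s\<in>{s. f s \<noteq> \<zero>\<^bsub>R\<^esub>}. f s \<odot>\<^bsub>M\<^esub> g s)"

lemma free_lift_superset:
  assumes "module R M" "g \<in> S \<rightarrow> carrier M" "f \<in> carrier (free_mod R S)"
    and "finite A" "{s. f s \<noteq> \<zero>\<^bsub>R\<^esub>} \<subseteq> A" "A \<subseteq> S"
  shows "free_lift R S M g f = (\<Oplus>\<^bsub>M\<^esub>s\<in>A. f s \<odot>\<^bsub>M\<^esub> g s)"
proof -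
  interpret M: module R M by fact
  have fg: "f s \<in> carrier R" "s \<in> A \<Longrightarrow> g s \<in> carrier M" for s
    using assms by (auto simp: free_mod_def)
  have "(\<Oplus>\<^bsub>M\<^esub>s\<in>{s. f s \<noteq> \<zero>\<^bsub>R\<^esub>}. f s \<odot>\<^bsub>M\<^esub> g s) = (\<Oplus>\<^bsub>M\<^esub>s\<in>A. f s \<odot>\<^bsub>M\<^esub> g s)"
    by (rule M.add.finprod_mono_neutral_cong_left) (use assms fg in auto)
  then show ?thesis using assms(3) by (simp add: free_lift_def)
qed

lemma free_lift_hom:
  fixes S :: "'s set"
  assumes "module R M" "g \<in> S \<rightarrow> carrier M"
  shows "free_lift R S M g \<in> mod_hom R (free_mod R S) M"
proof -
  interpret M: module R M by fact
  let ?F = "free_mod R S"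
  interpret F: module R ?F by (rule module_free_mod[OF M.R.is_cring])
  note sup = free_lift_superset[OF assms]
  have supp: "finite {s. f s \<noteq> \<zero>\<^bsub>R\<^esub>}" "{s. f s \<noteq> \<zero>\<^bsub>R\<^esub>} \<subseteq> S" "f s \<in> carrier R"
    if "f \<in> carrier ?F" for f s
    using that by (auto simp: free_mod_def)
  have g: "g s \<in> carrier M" if "s \<in> S" for s using that assms(2) by auto
  have "free_lift R S M g f \<in> carrier M" if "f \<in> carrier ?F" for f
    using supp[OF that] g that
    by (subst sup[OF that, of "{s. f s \<noteq> \<zero>\<^bsub>R\<^esub>}"]) (auto intro!: M.finsum_closed)
  moreover have "free_lift R S M g (f \<oplus>\<^bsub>?F\<^esub> f') = free_lift R S M g f \<oplus>\<^bsub>M\<^esub> free_lift R S M g f'"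
    if "f \<in> carrier ?F" "f' \<in> carrier ?F" for f f'
  proof -
    let ?A = "{s. f s \<noteq> \<zero>\<^bsub>R\<^esub>} \<union> {s. f' s \<noteq> \<zero>\<^bsub>R\<^esub>}"
    have A: "finite ?A" "?A \<subseteq> S" using supp that by blast+
    have "free_lift R S M g (f \<oplus>\<^bsub>?F\<^esub> f') = (\<Oplus>\<^bsub>M\<^esub>s\<in>?A. (f \<oplus>\<^bsub>?F\<^esub> f') s \<odot>\<^bsub>M\<^esub> g s)"
      by (rule sup[OF F.a_closed[OF that] A(1) _ A(2)]) (auto simp: free_mod_simps)
    also have "\<dots> = (\<Oplus>\<^bsub>M\<^esub>s\<in>?A. f s \<odot>\<^bsub>M\<^esub> g s \<oplus>\<^bsub>M\<^esub> f' s \<odot>\<^bsub>M\<^esub> g s)"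
    proof (rule M.add.finprod_cong')
      show "(f \<oplus>\<^bsub>?F\<^esub> f') s \<odot>\<^bsub>M\<^esub> g s = f s \<odot>\<^bsub>M\<^esub> g s \<oplus>\<^bsub>M\<^esub> f' s \<odot>\<^bsub>M\<^esub> g s" if "s \<in> ?A" for s
      proof -
        have "s \<in> S" using A that by blast
        with supp(3)[OF \<open>f \<in> carrier ?F\<close>] supp(3)[OF \<open>f' \<in> carrier ?F\<close>] g show ?thesis
          by (simp add: free_mod_def M.smult_l_distr)
      qed
    qed (use A g supp(3) that in auto)
    also have "\<dots> = (\<Oplus>\<^bsub>M\<^esub>s\<in>?A. f s \<odot>\<^bsub>M\<^esub> g s) \<oplus>\<^bsub>M\<^esub> (\<Oplus>\<^bsub>M\<^esub>s\<in>?A. f' s \<odot>\<^bsub>M\<^esub> g s)"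
      by (rule M.finsum_addf) (use A g supp(3) that in auto)
    also have "\<dots> = free_lift R S M g f \<oplus>\<^bsub>M\<^esub> free_lift R S M g f'"
      using sup[OF that(1) A(1) _ A(2)] sup[OF that(2) A(1) _ A(2)] by auto
    finally show ?thesis .
  qed
  moreover have "free_lift R S M g (a \<odot>\<^bsub>?F\<^esub> f) = a \<odot>\<^bsub>M\<^esub> free_lift R S M g f"
    if "a \<in> carrier R" "f \<in> carrier ?F" for a f
  proof -
    let ?A = "{s. f s \<noteq> \<zero>\<^bsub>R\<^esub>}"
    have A: "finite ?A" "?A \<subseteq> S" using supp[OF that(2)] by blast+
    have "free_lift R S M g (a \<odot>\<^bsub>?F\<^esub> f) = (\<Oplus>\<^bsub>M\<^esub>s\<in>?A. (a \<odot>\<^bsub>?F\<^esub> f) s \<odot>\<^bsub>M\<^esub> g s)"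
      by (rule sup[OF F.smult_closed[OF that] A(1) _ A(2)]) (use that in \<open>auto simp: free_mod_simps\<close>)
    also have "\<dots> = (\<Oplus>\<^bsub>M\<^esub>s\<in>?A. a \<odot>\<^bsub>M\<^esub> (f s \<odot>\<^bsub>M\<^esub> g s))"
    proof (rule M.add.finprod_cong')
      show "(a \<odot>\<^bsub>?F\<^esub> f) s \<odot>\<^bsub>M\<^esub> g s = a \<odot>\<^bsub>M\<^esub> (f s \<odot>\<^bsub>M\<^esub> g s)" if "s \<in> ?A" for s
      proof -
        have "s \<in> S" using A that by blast
        with supp(3)[OF \<open>f \<in> carrier ?F\<close>] g \<open>a \<in> carrier R\<close> show ?thesis
          by (simp add: free_mod_def M.smult_assoc1)
      qed
    qed (use A g supp(3) that in auto)
    also have "\<dots> = a \<odot>\<^bsub>M\<^esub> (\<Oplus>\<^bsub>M\<^esub>s\<in>?A. f s \<odot>\<^bsub>M\<^esub> g s)"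
      by (rule M.finsum_smult_ldistr[symmetric]) (use A g supp(3) that in auto)
    also have "\<dots> = a \<odot>\<^bsub>M\<^esub> free_lift R S M g f"
      using sup[OF that(2) A(1) _ A(2)] by auto
    finally show ?thesis .
  qed
  ultimately show ?thesis
    by (auto simp: mod_hom_def free_lift_def)
qed

lemma free_lift_gen:
  assumes "module R M" "g \<in> S \<rightarrow> carrier M" "s \<in> S"
  shows "free_lift R S M g (free_gen R s) = g s"
proof -
  interpret M: module R M by fact
  have "free_lift R S M g (free_gen R s) = (\<Oplus>\<^bsub>M\<^esub>t\<in>{s}. free_gen R s t \<odot>\<^bsub>M\<^esub> g t)"
    by (rule free_lift_superset[OF assms(1,2) free_gen_closed[OF M.R.is_cring assms(3)]])
      (use assms(3) in \<open>auto simp: free_gen_def\<close>)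
  then show ?thesis using assms(2,3) by (simp add: free_gen_def Pi_iff)
qed

lemma hom_free_lift:
  assumes "module R M" "module R N" "h \<in> mod_hom R M N" "g \<in> S \<rightarrow> carrier M"
    and f: "f \<in> carrier (free_mod R S)"
  shows "h (free_lift R S M g f) = free_lift R S N (h \<circ> g) f"
proof -
  interpret M: module R M by fact
  interpret N: module R N by fact
  note h = mod_homD[OF assms(3)]
  let ?A = "{s. f s \<noteq> \<zero>\<^bsub>R\<^esub>}"
  have A: "finite ?A" "?A \<subseteq> S" "f s \<in> carrier R" for s using f by (auto simp: free_mod_def)
  have fg: "f s \<odot>\<^bsub>M\<^esub> g s \<in> carrier M" "g s \<in> carrier M" if "s \<in> ?A" for s
    using A that assms(4) by (auto simp del: mem_Collect_eq)
  have "h (\<Oplus>\<^bsub>M\<^esub>s\<in>?A. f s \<odot>\<^bsub>M\<^esub> g s) = (\<Oplus>\<^bsub>N\<^esub>s\<in>?A. h (f s \<odot>\<^bsub>M\<^esub> g s))"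
    by (rule mod_hom_finsum[OF assms(1-3) A(1)]) (use fg in auto)
  also have "\<dots> = (\<Oplus>\<^bsub>N\<^esub>s\<in>?A. f s \<odot>\<^bsub>N\<^esub> h (g s))"
    by (rule N.add.finprod_cong') (use fg A h in auto)
  finally show ?thesis using f by (simp add: free_lift_def)
qed

lemma free_lift_self:
  assumes "cring R" "f \<in> carrier (free_mod R S)"
  shows "free_lift R S (free_mod R S) (free_gen R) f = f"
proof
  fix t
  interpret cring R by fact
  let ?F = "free_mod R S"
  let ?A = "{s. f s \<noteq> \<zero>\<^bsub>R\<^esub>}"
  interpret F: module R ?F by (rule module_free_mod[OF assms(1)])
  have A: "finite ?A" "?A \<subseteq> S" "f s \<in> carrier R" for s
    using assms(2) by (auto simp: free_mod_def)
  have eval: "(\<Oplus>\<^bsub>?F\<^esub>s\<in>B. c s) t = (\<Oplus>\<^bsub>R\<^esub>s\<in>B. c s t)"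
    if "finite B" "c \<in> B \<rightarrow> carrier ?F" for B and c :: "_ \<Rightarrow> _ \<Rightarrow> 'a"
    using that
  proof (induction B rule: finite_induct)
    case empty
    then show ?case by (simp add: free_mod_simps)
  next
    case (insert x B)
    then have c: "c \<in> B \<rightarrow> carrier ?F" "c x \<in> carrier ?F" by auto
    then have "(\<lambda>s. c s t) \<in> B \<rightarrow> carrier R" "c x t \<in> carrier R" by (auto simp: free_mod_def)
    moreover have "(u \<oplus>\<^bsub>?F\<^esub> v) t = u t \<oplus>\<^bsub>R\<^esub> v t" for u v by (simp add: free_mod_def)
    ultimately show ?case
      using insert c by (simp add: F.finsum_insert)
  qed
  have "free_lift R S ?F (free_gen R) f t = (\<Oplus>\<^bsub>?F\<^esub>s\<in>?A. f s \<odot>\<^bsub>?F\<^esub> free_gen R s) t"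
    using assms(2) by (simp add: free_lift_def)
  also have "\<dots> = (\<Oplus>\<^bsub>R\<^esub>s\<in>?A. (f s \<odot>\<^bsub>?F\<^esub> free_gen R s) t)"
    by (rule eval[OF A(1)])
      (auto intro!: F.smult_closed free_gen_closed[OF assms(1)] A(3) subsetD[OF A(2)])
  also have "\<dots> = (\<Oplus>\<^bsub>R\<^esub>s\<in>?A. if t = s then f s else \<zero>\<^bsub>R\<^esub>)"
    by (rule add.finprod_cong') (use A in \<open>auto simp: free_mod_def free_gen_def\<close>)
  also have "\<dots> = f t"
  proof (cases "t \<in> ?A")
    case True
    then show ?thesis
      using add.finprod_singleton[of t ?A f] A by auto
  next
    case False
    then have "(\<Oplus>\<^bsub>R\<^esub>s\<in>?A. if t = s then f s else \<zero>\<^bsub>R\<^esub>) = \<zero>\<^bsub>R\<^esub>"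
      by (intro add.finprod_one_eqI) auto
    with False show ?thesis by simp
  qed
  finally show "free_lift R S ?F (free_gen R) f t = f t" .
qed

lemma projective_free_mod:
  fixes S :: "'s set"
  assumes "cring R"
  shows "projective R (free_mod R S)"
proof -
  let ?F = "free_mod R S"
  let ?G = "free_mod R (carrier ?F)"
  have F: "module R ?F" and G: "module R ?G" by (rule module_free_mod[OF assms])+
  have gen: "free_gen R \<in> S \<rightarrow> carrier ?F" "free_gen R \<circ> free_gen R \<in> S \<rightarrow> carrier ?G"
    by (auto intro!: free_gen_closed[OF assms])
  let ?s = "free_lift R S ?G (free_gen R \<circ> free_gen R)"
  let ?r = "free_lift R (carrier ?F) ?F (\<lambda>f. f)"
  have s: "?s \<in> mod_hom R ?F ?G" by (rule free_lift_hom[OF G gen(2)])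
  have r: "?r \<in> mod_hom R ?G ?F" by (rule free_lift_hom[OF F]) auto
  have "?r (?s f) = f" if f: "f \<in> carrier ?F" for f
  proof -
    have "?r (?s f) = free_lift R S ?F (?r \<circ> (free_gen R \<circ> free_gen R)) f"
      by (rule hom_free_lift[OF G F r gen(2) f])
    also have "\<dots> = free_lift R S ?F (free_gen R) f"
    proof -
      interpret F: module R ?F by fact
      have supp: "f s \<in> carrier R" "f s \<noteq> \<zero>\<^bsub>R\<^esub> \<Longrightarrow> s \<in> S" for s
        using f by (auto simp: free_mod_def)
      have "(\<Oplus>\<^bsub>?F\<^esub>s\<in>{s. f s \<noteq> \<zero>\<^bsub>R\<^esub>}. f s \<odot>\<^bsub>?F\<^esub> (?r \<circ> (free_gen R \<circ> free_gen R)) s) =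
          (\<Oplus>\<^bsub>?F\<^esub>s\<in>{s. f s \<noteq> \<zero>\<^bsub>R\<^esub>}. f s \<odot>\<^bsub>?F\<^esub> free_gen R s)"
      proof (rule F.add.finprod_cong')
        fix s assume "s \<in> {s. f s \<noteq> \<zero>\<^bsub>R\<^esub>}"
        then have "s \<in> S" using f by (auto simp: free_mod_def)
        then have "?r (free_gen R (free_gen R s)) = free_gen R s"
          using free_lift_gen[OF F, of "\<lambda>f. f" "carrier ?F"] gen(1) by auto
        then show "f s \<odot>\<^bsub>?F\<^esub> (?r \<circ> (free_gen R \<circ> free_gen R)) s = f s \<odot>\<^bsub>?F\<^esub> free_gen R s"
          by simp
      qed (auto intro!: F.smult_closed free_gen_closed[OF assms] supp)
      then show ?thesis using f by (simp add: free_lift_def)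
    qed
    also have "\<dots> = f" by (rule free_lift_self[OF assms f])
    finally show ?thesis .
  qed
  then show ?thesis
    unfolding projective_def using F s r by blast
qed

lemma inj_list_infinite:
  assumes "infinite (UNIV :: 'x set)"
  obtains enc :: "'x list \<Rightarrow> 'x" where "inj enc"
proof -
  obtain p :: "'x \<times> 'x \<Rightarrow> 'x" where "bij_betw p (UNIV \<times> UNIV) UNIV"
    using card_of_Times_same_infinite[OF assms] card_of_ordIso by blast
  then have p: "inj p"
    by (simp add: bij_betw_def)
  obtain \<nu> :: "nat \<Rightarrow> 'x" where \<nu>: "inj \<nu>"
    using infinite_countable_subset[OF assms] by blast
  define fo where "fo xs = foldr (\<lambda>x y. p (x, y)) xs undefined" for xs
  have fo: "fo (x # xs) = p (x, fo xs)" for x xs by (simp add: fo_def)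
  have "xs = ys" if "length xs = length ys" "fo xs = fo ys" for xs ys
    using that
  proof (induction rule: list_induct2)
    case (Cons x xs y ys)
    then show ?case using injD[OF p] by (auto simp: fo)
  qed simp
  then have "inj (\<lambda>xs. p (\<nu> (length xs), fo xs))"
    by (intro injI) (auto dest!: injD[OF p] injD[OF \<nu>])
  then show thesis by (rule that)
qed

lemma inj_free_mod_words:
  fixes R :: "('a, 'r) ring_scheme"
  obtains k :: "('a, 'b) res \<Rightarrow> ('a + 'b) list"
  where "inj_on k (carrier (free_mod R (UNIV :: ('a + 'b) list set)))"
proof -
  obtain enc :: "('a + 'b) list list \<Rightarrow> ('a + 'b) list" where enc: "inj enc"
    by (rule inj_list_infinite[OF infinite_UNIV_listI])
  define sl where "sl f = (SOME ws. set ws = {w. f w \<noteq> \<zero>\<^bsub>R\<^esub>})" for f :: "('a, 'b) res"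
  define k where "k f = enc (concat (map (\<lambda>w. [w, [Inl (f w)]]) (sl f)))" for f
  have sl: "set (sl f) = {w. f w \<noteq> \<zero>\<^bsub>R\<^esub>}" if "f \<in> carrier (free_mod R UNIV)" for f
    unfolding sl_def by (rule someI_ex, rule finite_list) (use that in \<open>simp add: free_mod_def\<close>)
  have pairs: "map (\<lambda>w. (w, f w)) ws = map (\<lambda>w. (w, g w)) vs"
    if "concat (map (\<lambda>w. [w, [Inl (f w) :: 'a + 'b]]) ws) = concat (map (\<lambda>w. [w, [Inl (g w)]]) vs)"
    for f g :: "('a, 'b) res" and ws vs
    using that
  proof (induction ws arbitrary: vs)
    case Nil
    then show ?case by (cases vs) auto
  next
    case (Cons w ws)
    then show ?case by (cases vs) auto
  qed
  have "f = g"
    if f: "f \<in> carrier (free_mod R UNIV)" and g: "g \<in> carrier (free_mod R UNIV)" and "k f = k g"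
    for f g
  proof -
    have "map (\<lambda>w. (w, f w)) (sl f) = map (\<lambda>w. (w, g w)) (sl g)"
      by (rule pairs[OF injD[OF enc]]) (use \<open>k f = k g\<close> in \<open>simp add: k_def\<close>)
    from arg_cong[OF this, of set]
    have img: "(\<lambda>w. (w, f w)) ` {w. f w \<noteq> \<zero>\<^bsub>R\<^esub>} = (\<lambda>w. (w, g w)) ` {w. g w \<noteq> \<zero>\<^bsub>R\<^esub>}"
      by (simp add: sl[OF f] sl[OF g])
    show ?thesis
    proof
      fix w
      have "(w, f w) \<in> (\<lambda>w. (w, g w)) ` {w. g w \<noteq> \<zero>\<^bsub>R\<^esub>}" if "f w \<noteq> \<zero>\<^bsub>R\<^esub>"
        unfolding img[symmetric] using that by blast
      moreover have "(w, g w) \<in> (\<lambda>w. (w, f w)) ` {w. f w \<noteq> \<zero>\<^bsub>R\<^esub>}" if "g w \<noteq> \<zero>\<^bsub>R\<^esub>"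
        unfolding img using that by blast
      ultimately show "f w = g w"
        by (cases "f w = \<zero>\<^bsub>R\<^esub>"; cases "g w = \<zero>\<^bsub>R\<^esub>") auto
    qed
  qed
  then show thesis by (intro that[of k] inj_onI)
qed

lemma ex_free_cover:
  fixes k :: "'x \<Rightarrow> 's"
  assumes "module R M" "inj_on k K" "K \<subseteq> carrier M" "K \<noteq> {}"
  obtains g :: "'s \<Rightarrow> 'x" where "g ` UNIV = K"
    "free_lift R UNIV M g \<in> mod_hom R (free_mod R UNIV) M"
    "K \<subseteq> free_lift R UNIV M g ` carrier (free_mod R UNIV)"
proof -
  interpret M: module R M by fact
  obtain x0 where x0: "x0 \<in> K" using assms(4) by blast
  define g where "g s = (if s \<in> k ` K then inv_into K k s else x0)" for s
  have "x \<in> range g" if "x \<in> K" for x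
    by (rule image_eqI[of _ _ "k x"]) (use that assms(2) in \<open>auto simp: g_def\<close>)
  then have g: "g ` UNIV = K"
    using x0 by (auto simp: g_def inv_into_into)
  then have gc: "g \<in> UNIV \<rightarrow> carrier M" using assms(3) by auto
  have "K \<subseteq> free_lift R UNIV M g ` carrier (free_mod R UNIV)"
  proof
    fix x assume "x \<in> K"
    then obtain s where "x = g s" using g by blast
    then have "x = free_lift R UNIV M g (free_gen R s)"
      using free_lift_gen[OF assms(1) gc] by simp
    then show "x \<in> free_lift R UNIV M g ` carrier (free_mod R UNIV)"
      by (rule image_eqI[OF _ free_gen_closed[OF M.R.is_cring UNIV_I]])
  qed
  with g free_lift_hom[OF assms(1) gc] show thesis by (rule that)
qed

lemma ex_projective_resolution:
  fixes R :: "('a, 'r) ring_scheme" and M :: "('a, 'b, 'm) module_scheme"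
  assumes "module R M"
  shows "\<exists>(P :: nat \<Rightarrow> ('a, ('a, 'b) res) module) d e. projective_resolution R M P d e"
proof -
  interpret M: module R M by fact
  let ?F = "free_mod R (UNIV :: ('a + 'b) list set)"
  have F: "module R ?F" by (rule module_free_mod[OF M.R.is_cring])
  interpret F: module R ?F by (rule F)
  obtain k :: "('a, 'b) res \<Rightarrow> ('a + 'b) list" where k: "inj_on k (carrier ?F)"
    by (rule inj_free_mod_words)
  have step: "\<exists>d. d \<in> mod_hom R ?F ?F \<and> d ` carrier ?F = {x \<in> carrier ?F. h x = \<zero>\<^bsub>L\<^esub>}"
    if L: "module R L" and h: "h \<in> mod_hom R ?F L"
    for L :: "('a, 'l, 'z) module_scheme" and h
  proof -
    interpret L: module R L by (rule L)
    let ?K = "{x \<in> carrier ?F. h x = \<zero>\<^bsub>L\<^esub>}"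
    have "\<zero>\<^bsub>?F\<^esub> \<in> ?K" using mod_hom_zero[OF F L h] by simp
    then have ne: "?K \<noteq> {}" by blast
    have K: "inj_on k ?K" "?K \<subseteq> carrier ?F" by (auto intro: inj_on_subset[OF k])
    obtain g :: "('a + 'b) list \<Rightarrow> ('a, 'b) res" where g: "g ` UNIV = ?K"
      and hom: "free_lift R UNIV ?F g \<in> mod_hom R ?F ?F"
      and sub: "?K \<subseteq> free_lift R UNIV ?F g ` carrier ?F"
      by (rule ex_free_cover[OF F K ne])
    have "h (free_lift R UNIV ?F g f) = \<zero>\<^bsub>L\<^esub>" if f: "f \<in> carrier ?F" for f
    proof -
      have "h (free_lift R UNIV ?F g f) = free_lift R UNIV L (h \<circ> g) f"
        by (rule hom_free_lift[OF F L h _ f]) (use g in blast)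
      also have "\<dots> = (\<Oplus>\<^bsub>L\<^esub>s\<in>{s. f s \<noteq> \<zero>\<^bsub>R\<^esub>}. f s \<odot>\<^bsub>L\<^esub> h (g s))"
        using f by (simp add: free_lift_def)
      also have "\<dots> = \<zero>\<^bsub>L\<^esub>"
      proof (rule L.add.finprod_one_eqI)
        fix s
        have "h (g s) = \<zero>\<^bsub>L\<^esub>" using g by blast
        moreover have "f s \<in> carrier R" using f by (simp add: free_mod_def)
        ultimately show "f s \<odot>\<^bsub>L\<^esub> h (g s) = \<zero>\<^bsub>L\<^esub>" by simp
      qed
      finally show ?thesis .
    qed
    then have "free_lift R UNIV ?F g ` carrier ?F = ?K"
      using sub mod_homD(1)[OF hom] by blast
    with hom show ?thesis by blast
  qed
  obtain e where e: "e \<in> mod_hom R ?F M" "e ` carrier ?F = carrier M"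
  proof -
    have inj: "inj_on (\<lambda>x. [Inr x] :: ('a + 'b) list) (carrier M)" by (auto intro: inj_onI)
    have ne: "carrier M \<noteq> {}" using M.zero_closed by blast
    obtain g :: "('a + 'b) list \<Rightarrow> 'b" where "g ` UNIV = carrier M"
      and g: "free_lift R UNIV M g \<in> mod_hom R ?F M"
        "carrier M \<subseteq> free_lift R UNIV M g ` carrier ?F"
      by (rule ex_free_cover[OF assms inj order_refl ne])
    then have "free_lift R UNIV M g ` carrier ?F = carrier M"
      using mod_homD(1)[OF g(1)] by blast
    with g(1) show thesis by (rule that)
  qed
  obtain d0 where d0: "d0 \<in> mod_hom R ?F ?F" "d0 ` carrier ?F = {x \<in> carrier ?F. e x = \<zero>\<^bsub>M\<^esub>}"
    using step[OF assms e(1)] by blast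
  define nxt where "nxt h = (SOME d. d \<in> mod_hom R ?F ?F \<and>
    d ` carrier ?F = {x \<in> carrier ?F. h x = \<zero>\<^bsub>?F\<^esub>})" for h :: "('a, 'b) res \<Rightarrow> ('a, 'b) res"
  define d where "d = rec_nat d0 (\<lambda>_. nxt)"
  have nxt: "nxt h \<in> mod_hom R ?F ?F \<and> nxt h ` carrier ?F = {x \<in> carrier ?F. h x = \<zero>\<^bsub>?F\<^esub>}"
    if "h \<in> mod_hom R ?F ?F" for h
    unfolding nxt_def by (rule someI_ex[OF step[OF F that]])
  have d_hom: "d n \<in> mod_hom R ?F ?F" for n
    by (induction n) (use d0 nxt in \<open>auto simp: d_def\<close>)
  have d_Suc: "d (Suc n) ` carrier ?F = {x \<in> carrier ?F. d n x = \<zero>\<^bsub>?F\<^esub>}" for n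
    using nxt[OF d_hom[of n]] by (simp add: d_def)
  have d_0: "d 0 ` carrier ?F = {x \<in> carrier ?F. e x = \<zero>\<^bsub>M\<^esub>}"
    using d0 by (simp add: d_def)
  have "d n (d (Suc n) x) = \<zero>\<^bsub>?F\<^esub>" if "x \<in> carrier ?F" for n x
    using d_Suc[of n] that by blast
  then have "projective_resolution R M (\<lambda>_. ?F) d e"
    unfolding projective_resolution_def aug_complex_def aug_exact_def
    using projective_free_mod[OF M.R.is_cring, of "UNIV :: ('a + 'b) list set"] d_hom e d_Suc d_0
    by auto
  then show ?thesis by blast
qed


section \<open>Derived functors\<close>

definition Ext ::
  "[('a, _) ring_scheme, ('a, 'b, _) module_scheme, ('a, 'd, _) module_scheme, nat]
    \<Rightarrow> ('a, (('a, 'b) res \<Rightarrow> 'd) set) module"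
  where "Ext R M N i =
    (let (P, d, e) = (SOME (P, d, e). projective_resolution R M P d e)
     in hom_cohomology R P d N i)"

text \<open>\<open>Tor\<^sub>i(C, -)\<close> is the \<open>i\<close>-th left derived functor of \<open>C \<otimes> -\<close>.\<close>

definition Tor ::
  "[('a, _) ring_scheme, ('a, 'c, _) module_scheme, ('a, 'b, _) module_scheme, nat]
    \<Rightarrow> ('a, ('c \<times> ('a, 'b) res \<Rightarrow> 'a) set set) module"
  where "Tor R C M i =
    (let (P, d, e) =
       (SOME (P, d, e). projective_resolution R M (P :: nat \<Rightarrow> ('a, ('a, 'b) res) module) d e)
     in homology (\<lambda>n. tensor_mod R C (P n))
          (\<lambda>n. tensor_map R C (P (Suc n)) (P n) (d n)) i)"

text \<open>
  The modules \<open>P n\<close> live in the type in which \<open>Hom(C, M)\<close> has a projective resolution \<open>P\<close>.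
  For semidualizing \<open>C\<close>, the complex \<open>C \<otimes> P\<close>, augmented by
  \<open>C \<otimes> P 0 \<rightarrow> C \<otimes> Hom(C, M) \<rightarrow> M\<close>, is a proper \<open>\<P>\<^sub>C\<close>-projective resolution of \<open>M\<close>.
\<close>

definition Ext_PC ::
  "[('a, _) ring_scheme, ('a, 'c, _) module_scheme, ('a, 'b, _) module_scheme,
    ('a, 'd, _) module_scheme, nat]
    \<Rightarrow> ('a, (('c \<times> ('a, 'c \<Rightarrow> 'b) res \<Rightarrow> 'a) set \<Rightarrow> 'd) set) module"
  where "Ext_PC R C M N i =
    (let (P, d, e) = (SOME (P, d, e). proper_PC_resolution R C M P d e)
     in hom_cohomology R (\<lambda>n. tensor_mod R C (P n)) d N i)"


section \<open>Semidualizing modules and the Bass class\<close>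

definition homothety :: "[('a, _) ring_scheme, ('a, 'c, _) module_scheme] \<Rightarrow> 'a \<Rightarrow> 'c \<Rightarrow> 'c"
  where "homothety R C = (\<lambda>a\<in>carrier R. \<lambda>x\<in>carrier C. a \<odot>\<^bsub>C\<^esub> x)"

definition semidualizing :: "[('a, _) ring_scheme, ('a, 'c, _) module_scheme] \<Rightarrow> bool"
  where "semidualizing R C \<longleftrightarrow> module R C \<and>
    (\<exists>(P :: nat \<Rightarrow> ('a, ('a, 'c) res) module) d e.
       projective_resolution R C P d e \<and> (\<forall>n. fin_gen R (P n))) \<and>
    is_mod_iso R (regular_mod R) (hom_mod R C C) (homothety R C) \<and>
    (\<forall>i\<ge>1. zero_mod (Ext R C C i))"

definition evaluation ::
  "[('a, _) ring_scheme, ('a, 'c, _) module_scheme, ('a, 'b, _) module_scheme]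
    \<Rightarrow> ('c \<times> ('c \<Rightarrow> 'b) \<Rightarrow> 'a) set \<Rightarrow> 'b"
  where "evaluation R C M = tensor_lift R C (hom_mod R C M) M (\<lambda>c f. f c)"

definition Bass_class ::
  "[('a, _) ring_scheme, ('a, 'c, _) module_scheme, ('a, 'b, _) module_scheme] \<Rightarrow> bool"
  where "Bass_class R C M \<longleftrightarrow> module R M \<and>
    (\<forall>i\<ge>1. zero_mod (Ext R C M i) \<and> zero_mod (Tor R C (hom_mod R C M) i)) \<and>
    is_mod_iso R (tensor_mod R C (hom_mod R C M)) M (evaluation R C M)"

end

theory Submission
  imports Defs
begin

text \<open>
  Since \<open>C\<close> is finitely generated and \<open>Hom(C, C) = R\<close>, every map \<open>C \<rightarrow> C \<otimes> P\<close> with \<open>P\<close> projective has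
  the form \<open>c \<mapsto> c \<otimes> p\<close> for a unique \<open>p\<close>. So \<open>C \<otimes> -\<close> is fully faithful on projective modules, and the
  proper resolutions \<open>C \<otimes> P\<close> of \<open>M\<close> correspond to the projective resolutions \<open>P\<close> of \<open>Hom(C, M)\<close>. The
  first isomorphism is then the adjunction \<open>Hom(C \<otimes> P, N) \<cong> Hom(P, Hom(C, N))\<close>.

  If \<open>M\<close> is in the Bass class, the vanishing of Tor and the evaluation isomorphism make
  \<open>C \<otimes> P \<rightarrow> M\<close> exact. If \<open>N\<close> is in the Bass class, then \<open>Ext(C, N)\<close> vanishes in positive degrees, and
  hence so does \<open>Ext(C \<otimes> P, N)\<close>, because \<open>C \<otimes> P\<close> is a direct summand of a direct sum of copies of
  \<open>C\<close>. Thus \<open>C \<otimes> P\<close> is a resolution of \<open>M\<close> by \<open>Hom(-, N)\<close>-acyclic modules, and it computes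
  \<open>Ext(M, N)\<close> by dimension shifting.
\<close>

section \<open>Homomorphisms and quotients\<close>

text \<open>\<open>Ext\<close>, \<open>Tor\<close> and \<open>Ext_PC\<close> each use one resolution
  picked by choice in a fixed type, while the argument has to work with whichever resolution is at
  hand. For Ext, the comparison theorem is therefore proved between resolutions in unrelated types.
  For \<open>Ext_PC\<close>, the chosen proper resolution is analysed itself: full faithfulness
  turns its differentials into maps between the projective modules, so that it is C \<otimes> P for
  a projective resolution P of Hom(C, M), and the adjunction applies to it directly.

  Finite generation of C has one precise task. A map from C to a direct sum of copies of C has
  scalar coordinates because Hom(C, C) = R, but these scalars form an element of a free module only
  if almost all of them vanish. Looking at finitely many generators of C ensures this.

  Properness gives exactness only after applying Hom(C \<otimes> Q, -). For Q = R this is exactness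
  of P over Hom(C, M); the complex C \<otimes> P over M can still fail to be exact, and closing this
  gap is where the Bass class of M enters.\<close>

lemma (in abelian_group) minus_zero:
  "x \<in> carrier G \<Longrightarrow> x \<ominus> \<zero> = x"
  using minus_equality[of \<zero> \<zero>] by (simp add: a_minus_def)

lemma (in abelian_group) minus_eq_zero_iff:
  "x \<in> carrier G \<Longrightarrow> y \<in> carrier G \<Longrightarrow> x \<ominus> y = \<zero> \<longleftrightarrow> x = y"
  using minus_equality[of x "\<ominus> y"] by (auto simp: a_minus_def r_neg)

text \<open>Members of \<open>mod_hom\<close> are extensional, so a formula becomes a homomorphism
  only after restriction to the carrier. In return, homomorphisms that agree on the carrier are
  equal as functions, which \<open>mod_hom_ext\<close> exploits.\<close>

lemma mod_homI:
  assumes "module R M"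
    and "\<And>x. x \<in> carrier M \<Longrightarrow> f x \<in> carrier N"
    and "\<And>x y. x \<in> carrier M \<Longrightarrow> y \<in> carrier M \<Longrightarrow> f (x \<oplus>\<^bsub>M\<^esub> y) = f x \<oplus>\<^bsub>N\<^esub> f y"
    and "\<And>a x. a \<in> carrier R \<Longrightarrow> x \<in> carrier M \<Longrightarrow> f (a \<odot>\<^bsub>M\<^esub> x) = a \<odot>\<^bsub>N\<^esub> f x"
  shows "(\<lambda>x\<in>carrier M. f x) \<in> mod_hom R M N"
proof -
  interpret M: module R M by fact
  show ?thesis using assms(2-) by (auto simp: mod_hom_def)
qed

lemma mod_hom_ext:
  assumes "f \<in> mod_hom R M N" "g \<in> mod_hom R M N" "\<And>x. x \<in> carrier M \<Longrightarrow> f x = g x"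
  shows "f = g"
  using assms by (intro PiE_ext[of f "carrier M" "\<lambda>_. carrier N" g]) (auto simp: mod_hom_def)

lemma mod_hom_extensional:
  assumes "f \<in> mod_hom R M N"
  shows "(\<lambda>x\<in>carrier M. f x) = f"
  using assms by (auto simp: mod_hom_def PiE_def extensional_restrict)

lemma mod_hom_compose:
  assumes "module R M" "f \<in> mod_hom R M N" "g \<in> mod_hom R N L"
  shows "compose (carrier M) g f \<in> mod_hom R M L"
  unfolding compose_def
  by (rule mod_homI[OF assms(1)]) (simp_all add: mod_homD[OF assms(2)] mod_homD[OF assms(3)])

lemma mod_hom_id:
  assumes "module R M"
  shows "(\<lambda>x\<in>carrier M. x) \<in> mod_hom R M M"
  by (rule mod_homI[OF assms]) auto

lemma mod_hom_a_inv:
  assumes "module R M" "module R N" "f \<in> mod_hom R M N" "x \<in> carrier M"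
  shows "f (\<ominus>\<^bsub>M\<^esub> x) = \<ominus>\<^bsub>N\<^esub> f x"
proof -
  interpret M: module R M by fact
  interpret N: module R N by fact
  note h = mod_homD[OF assms(3)]
  have "f (\<ominus>\<^bsub>M\<^esub> x) \<oplus>\<^bsub>N\<^esub> f x = \<zero>\<^bsub>N\<^esub>"
    using h(2)[of "\<ominus>\<^bsub>M\<^esub> x" x] assms(4) mod_hom_zero[OF assms(1-3)] by (simp add: M.l_neg)
  then show ?thesis
    using h(1) assms(4) by (metis M.a_inv_closed N.minus_equality)
qed

lemma mod_hom_diff:
  assumes "module R M" "module R N" "f \<in> mod_hom R M N" "x \<in> carrier M" "y \<in> carrier M"
  shows "f (x \<ominus>\<^bsub>M\<^esub> y) = f x \<ominus>\<^bsub>N\<^esub> f y"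
proof -
  interpret M: module R M by fact
  show ?thesis
    using assms(4,5)
    by (simp add: a_minus_def mod_homD[OF assms(3)] mod_hom_a_inv[OF assms(1-3)])
qed

lemma mod_hom_const_zero:
  assumes "module R M" "module R N"
  shows "(\<lambda>x\<in>carrier M. \<zero>\<^bsub>N\<^esub>) \<in> mod_hom R M N"
proof -
  interpret N: module R N by fact
  show ?thesis by (rule mod_homI[OF assms(1)]) auto
qed

lemma mod_hom_add:
  assumes "module R M" "module R N" "f \<in> mod_hom R M N" "g \<in> mod_hom R M N"
  shows "(\<lambda>x\<in>carrier M. f x \<oplus>\<^bsub>N\<^esub> g x) \<in> mod_hom R M N"
proof -
  interpret N: module R N by fact
  show ?thesis
    by (rule mod_homI[OF assms(1)])
      (simp_all add: mod_homD[OF assms(3)] mod_homD[OF assms(4)] N.a_ac N.smult_r_distr)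
qed

lemma mod_hom_smult:
  assumes "module R M" "module R N" "a \<in> carrier R" "f \<in> mod_hom R M N"
  shows "(\<lambda>x\<in>carrier M. a \<odot>\<^bsub>N\<^esub> f x) \<in> mod_hom R M N"
proof -
  interpret N: module R N by fact
  \<comment> \<open>Commutativity of R is what makes a scalar multiple of a linear map
    linear.\<close>
  have "a \<odot>\<^bsub>N\<^esub> (b \<odot>\<^bsub>N\<^esub> y) = b \<odot>\<^bsub>N\<^esub> (a \<odot>\<^bsub>N\<^esub> y)" if "b \<in> carrier R" "y \<in> carrier N" for b y
    using that assms(3) by (metis N.smult_assoc1 N.R.m_comm)
  then show ?thesis
    by (intro mod_homI[OF assms(1)])
      (simp_all add: mod_homD[OF assms(4)] assms(3) N.smult_r_distr)
qed

lemma mod_hom_uminus: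
  assumes "module R M" "module R N" "f \<in> mod_hom R M N"
  shows "(\<lambda>x\<in>carrier M. \<ominus>\<^bsub>N\<^esub> f x) \<in> mod_hom R M N"
proof -
  interpret N: module R N by fact
  show ?thesis
    by (rule mod_homI[OF assms(1)])
      (simp_all add: mod_homD[OF assms(3)] N.minus_add N.smult_r_minus)
qed

lemma mod_hom_minus:
  assumes "module R M" "module R N" "f \<in> mod_hom R M N" "g \<in> mod_hom R M N"
  shows "(\<lambda>x\<in>carrier M. f x \<ominus>\<^bsub>N\<^esub> g x) \<in> mod_hom R M N"
proof -
  have "(\<lambda>x\<in>carrier M. f x \<ominus>\<^bsub>N\<^esub> g x) = (\<lambda>x\<in>carrier M. f x \<oplus>\<^bsub>N\<^esub> (\<lambda>x\<in>carrier M. \<ominus>\<^bsub>N\<^esub> g x) x)"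
    by (auto simp: a_minus_def)
  then show ?thesis
    using mod_hom_add[OF assms(1-3) mod_hom_uminus[OF assms(1,2,4)]] by simp
qed

lemma hom_mod_simps:
  "carrier (hom_mod R M N) = mod_hom R M N"
  "\<zero>\<^bsub>hom_mod R M N\<^esub> = (\<lambda>x\<in>carrier M. \<zero>\<^bsub>N\<^esub>)"
  "f \<oplus>\<^bsub>hom_mod R M N\<^esub> g = (\<lambda>x\<in>carrier M. f x \<oplus>\<^bsub>N\<^esub> g x)"
  "a \<odot>\<^bsub>hom_mod R M N\<^esub> f = (\<lambda>x\<in>carrier M. a \<odot>\<^bsub>N\<^esub> f x)"
  by (simp_all add: hom_mod_def)

lemma module_hom_mod:
  assumes "module R M" "module R N"
  shows "module R (hom_mod R M N)"
proof -
  interpret M: module R M by fact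
  interpret N: module R N by fact
  note closed = mod_hom_add[OF assms] mod_hom_smult[OF assms] mod_hom_const_zero[OF assms]
  note D = mod_homD(1)
  show ?thesis
  proof (rule moduleI[OF M.R.is_cring])
    show "abelian_group (hom_mod R M N)"
    proof (rule abelian_groupI)
      fix f assume f: "f \<in> carrier (hom_mod R M N)"
      let ?g = "\<lambda>x\<in>carrier M. \<ominus>\<^bsub>N\<^esub> f x"
      have "?g \<in> mod_hom R M N" using f mod_hom_uminus[OF assms] by (simp add: hom_mod_simps)
      moreover have "?g \<oplus>\<^bsub>hom_mod R M N\<^esub> f = \<zero>\<^bsub>hom_mod R M N\<^esub>"
        using f by (auto simp: hom_mod_simps N.l_neg D intro!: restrict_ext)
      ultimately show "\<exists>g\<in>carrier (hom_mod R M N). g \<oplus>\<^bsub>hom_mod R M N\<^esub> f = \<zero>\<^bsub>hom_mod R M N\<^esub>"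
        unfolding hom_mod_simps(1) by blast
    next
      fix f assume f: "f \<in> carrier (hom_mod R M N)"
      then have "(\<lambda>x\<in>carrier M. f x) = f"
        using mod_hom_extensional by (simp add: hom_mod_simps)
      moreover have "\<zero>\<^bsub>hom_mod R M N\<^esub> \<oplus>\<^bsub>hom_mod R M N\<^esub> f = (\<lambda>x\<in>carrier M. f x)"
        using f by (auto simp: hom_mod_simps D intro!: restrict_ext)
      ultimately show "\<zero>\<^bsub>hom_mod R M N\<^esub> \<oplus>\<^bsub>hom_mod R M N\<^esub> f = f" by simp
    qed (auto simp: hom_mod_simps closed N.a_ac D intro!: restrict_ext)
  next
    fix f assume f: "f \<in> carrier (hom_mod R M N)"
    have "\<one>\<^bsub>R\<^esub> \<odot>\<^bsub>hom_mod R M N\<^esub> f = (\<lambda>x\<in>carrier M. f x)"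
      using f by (auto simp: hom_mod_simps D intro!: restrict_ext)
    then show "\<one>\<^bsub>R\<^esub> \<odot>\<^bsub>hom_mod R M N\<^esub> f = f"
      using f mod_hom_extensional by (simp add: hom_mod_simps)
  qed (auto simp: hom_mod_simps closed D N.smult_l_distr N.smult_r_distr N.smult_assoc1
      intro!: restrict_ext)
qed

lemma mod_isomorphic_trans:
  assumes "module R L" "mod_isomorphic R L M" "mod_isomorphic R M N"
  shows "mod_isomorphic R L N"
proof -
  obtain f g where f: "f \<in> mod_hom R L M" "bij_betw f (carrier L) (carrier M)"
    and g: "g \<in> mod_hom R M N" "bij_betw g (carrier M) (carrier N)"
    using assms(2,3) by (auto simp: mod_isomorphic_def is_mod_iso_def)
  have "bij_betw (compose (carrier L) g f) (carrier L) (carrier N)"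
    using bij_betw_trans[OF f(2) g(2)]
    by (rule bij_betw_cong[THEN iffD1, rotated]) (simp add: compose_def)
  then show ?thesis
    using mod_hom_compose[OF assms(1) f(1) g(1)]
    by (auto simp: mod_isomorphic_def is_mod_iso_def)
qed

lemma mod_hom_inv:
  assumes "module R M" "module R N" "f \<in> mod_hom R M N" "bij_betw f (carrier M) (carrier N)"
  obtains g where "g \<in> mod_hom R N M" "bij_betw g (carrier N) (carrier M)"
    "\<And>x. x \<in> carrier M \<Longrightarrow> g (f x) = x" "\<And>y. y \<in> carrier N \<Longrightarrow> f (g y) = y"
proof
  interpret M: module R M by fact
  interpret N: module R N by fact
  let ?i = "inv_into (carrier M) f"
  let ?g = "\<lambda>y\<in>carrier N. ?i y"
  have i: "?i y \<in> carrier M" "f (?i y) = y" if "y \<in> carrier N" for y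
    using that assms(4) by (metis bij_betw_def inv_into_into, metis bij_betw_inv_into_right)
  have l: "?i (f x) = x" if "x \<in> carrier M" for x
    using that assms(4) by (simp add: bij_betw_def)
  note h = mod_homD[OF assms(3)]
  show "?g \<in> mod_hom R N M"
  proof (rule mod_homI[OF assms(2)])
    show "?i (x \<oplus>\<^bsub>N\<^esub> y) = ?i x \<oplus>\<^bsub>M\<^esub> ?i y" if "x \<in> carrier N" "y \<in> carrier N" for x y
      using that h(2)[of "?i x" "?i y"] l[of "?i x \<oplus>\<^bsub>M\<^esub> ?i y"] i by simp
    show "?i (a \<odot>\<^bsub>N\<^esub> x) = a \<odot>\<^bsub>M\<^esub> ?i x" if "a \<in> carrier R" "x \<in> carrier N" for a x
      using that h(3)[of a "?i x"] l[of "a \<odot>\<^bsub>M\<^esub> ?i x"] i by simp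
  qed (rule i)
  show "bij_betw ?g (carrier N) (carrier M)"
    using bij_betw_inv_into[OF assms(4)]
    by (rule bij_betw_cong[THEN iffD1, rotated]) simp
  show "?g (f x) = x" if "x \<in> carrier M" for x using l h that by simp
  show "f (?g y) = y" if "y \<in> carrier N" for y using i that by simp
qed

lemma mod_isomorphic_sym:
  assumes "module R M" "module R N" "mod_isomorphic R M N"
  shows "mod_isomorphic R N M"
proof -
  obtain f where "f \<in> mod_hom R M N" "bij_betw f (carrier M) (carrier N)"
    using assms(3) by (auto simp: mod_isomorphic_def is_mod_iso_def)
  from mod_hom_inv[OF assms(1,2) this] show ?thesis
    by (metis mod_isomorphic_def is_mod_iso_def)
qed

lemma submodule_kernel:
  assumes "module R M" "module R N" "f \<in> mod_hom R M N"
  shows "submodule {x \<in> carrier M. f x = \<zero>\<^bsub>N\<^esub>} R M"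
proof -
  interpret M: module R M by fact
  interpret N: module R N by fact
  show ?thesis
    by (rule M.submoduleI)
      (auto simp: mod_homD[OF assms(3)] mod_hom_zero[OF assms] mod_hom_a_inv[OF assms])
qed

lemma submodule_image:
  assumes "module R M" "module R N" "f \<in> mod_hom R M N"
  shows "submodule (f ` carrier M) R N"
proof -
  interpret M: module R M by fact
  interpret N: module R N by fact
  note h = mod_homD[OF assms(3)]
  show ?thesis
  proof (rule N.submoduleI)
    show "f ` carrier M \<subseteq> carrier N" using h by auto
    show "\<zero>\<^bsub>N\<^esub> \<in> f ` carrier M"
      using mod_hom_zero[OF assms] by (auto intro!: image_eqI[of _ f "\<zero>\<^bsub>M\<^esub>"])
    show "\<ominus>\<^bsub>N\<^esub> a \<in> f ` carrier M" if a: "a \<in> f ` carrier M" for a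
      using a mod_hom_a_inv[OF assms, symmetric] by auto
    show "a \<oplus>\<^bsub>N\<^esub> b \<in> f ` carrier M" if ab: "a \<in> f ` carrier M" "b \<in> f ` carrier M" for a b
      using ab by (auto simp: h(2)[symmetric])
    show "a \<odot>\<^bsub>N\<^esub> b \<in> f ` carrier M" if ab: "a \<in> carrier R" "b \<in> f ` carrier M" for a b
      using ab by (auto simp: h(3)[symmetric])
  qed
qed

lemma submodule_zero:
  assumes "module R M"
  shows "submodule {\<zero>\<^bsub>M\<^esub>} R M"
proof -
  interpret M: module R M by fact
  show ?thesis by (rule M.submoduleI) auto
qed

section \<open>Quotient modules and maps between them\<close>

lemma quot_mod_simps:
  "\<zero>\<^bsub>quot_mod M H\<^esub> = H"
  "K \<oplus>\<^bsub>quot_mod M H\<^esub> L = K <+>\<^bsub>M\<^esub> L"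
  "a \<odot>\<^bsub>quot_mod M H\<^esub> K = (\<Union>x\<in>K. H +>\<^bsub>M\<^esub> (a \<odot>\<^bsub>M\<^esub> x))"
  by (simp_all add: quot_mod_def)

lemma quot_mod_carrier:
  "carrier (quot_mod M H) = (\<lambda>x. H +>\<^bsub>M\<^esub> x) ` carrier M"
  by (auto simp: quot_mod_def A_RCOSETS_def')

context
  fixes R :: "('a, 'r) ring_scheme" and M :: "('a, 'b, 'm) module_scheme" and H
  assumes M: "module R M" and H: "submodule H R M"
begin

interpretation M: module R M by (rule M)

lemma abelian_subgroup_submodule: "abelian_subgroup H M"
  by (intro abelian_subgroupI3 additive_subgroupI submodule.axioms(1)[OF H] M.abelian_group_axioms)

interpretation H: abelian_subgroup H M by (rule abelian_subgroup_submodule)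

lemma coset_eq_iff:
  assumes "x \<in> carrier M" "y \<in> carrier M"
  shows "H +>\<^bsub>M\<^esub> x = H +>\<^bsub>M\<^esub> y \<longleftrightarrow> x \<ominus>\<^bsub>M\<^esub> y \<in> H"
proof
  assume "H +>\<^bsub>M\<^esub> x = H +>\<^bsub>M\<^esub> y"
  then have "x \<in> H +>\<^bsub>M\<^esub> y" using H.a_rcos_self[OF assms(1)] by simp
  then obtain h where "h \<in> H" "x = h \<oplus>\<^bsub>M\<^esub> y" by (auto simp: a_r_coset_def')
  moreover from this have "h \<in> carrier M" using H.a_subset by auto
  ultimately show "x \<ominus>\<^bsub>M\<^esub> y \<in> H"
    using assms by (simp add: a_minus_def M.a_assoc M.r_neg)
next
  assume "x \<ominus>\<^bsub>M\<^esub> y \<in> H"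
  then have "(x \<ominus>\<^bsub>M\<^esub> y) \<oplus>\<^bsub>M\<^esub> y \<in> H +>\<^bsub>M\<^esub> y"
    by (intro M.a_rcosI H.a_subset assms)
  then have "x \<in> H +>\<^bsub>M\<^esub> y"
    using assms by (simp add: a_minus_def M.a_assoc M.l_neg)
  then show "H +>\<^bsub>M\<^esub> x = H +>\<^bsub>M\<^esub> y"
    using M.a_repr_independence[OF _ assms(2) submodule.axioms(1)[OF H]] by blast
qed

lemma coset_zero_iff:
  assumes "x \<in> carrier M"
  shows "H +>\<^bsub>M\<^esub> x = H \<longleftrightarrow> x \<in> H"
  using coset_eq_iff[OF assms M.zero_closed] assms H.a_subset
  by (simp add: M.minus_zero)

lemma quot_mod_add:
  assumes "x \<in> carrier M" "y \<in> carrier M"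
  shows "(H +>\<^bsub>M\<^esub> x) \<oplus>\<^bsub>quot_mod M H\<^esub> (H +>\<^bsub>M\<^esub> y) = H +>\<^bsub>M\<^esub> (x \<oplus>\<^bsub>M\<^esub> y)"
  using H.a_rcos_sum[OF assms] by (simp add: quot_mod_simps)

text \<open>In \<open>quot_mod\<close> a scalar a acts on a coset through the union of the cosets of
  a y over all its elements y. These cosets coincide because the submodule absorbs scalars, so the
  union collapses to one of them.\<close>

lemma quot_mod_smult:
  assumes "a \<in> carrier R" "x \<in> carrier M"
  shows "a \<odot>\<^bsub>quot_mod M H\<^esub> (H +>\<^bsub>M\<^esub> x) = H +>\<^bsub>M\<^esub> (a \<odot>\<^bsub>M\<^esub> x)"
proof -
  have "H +>\<^bsub>M\<^esub> (a \<odot>\<^bsub>M\<^esub> y) = H +>\<^bsub>M\<^esub> (a \<odot>\<^bsub>M\<^esub> x)" if y: "y \<in> H +>\<^bsub>M\<^esub> x" for y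
  proof -
    have yc: "y \<in> carrier M"
      using y M.a_r_coset_subset_G[OF H.a_subset assms(2)] by auto
    have "H +>\<^bsub>M\<^esub> y = H +>\<^bsub>M\<^esub> x"
      using M.a_repr_independence[OF y assms(2) submodule.axioms(1)[OF H]] by simp
    then have "a \<odot>\<^bsub>M\<^esub> (y \<ominus>\<^bsub>M\<^esub> x) \<in> H"
      using coset_eq_iff[OF yc assms(2)] submodule.smult_closed[OF H assms(1)] by simp
    then have "a \<odot>\<^bsub>M\<^esub> y \<ominus>\<^bsub>M\<^esub> a \<odot>\<^bsub>M\<^esub> x \<in> H"
      using assms yc by (simp add: a_minus_def M.smult_r_distr M.smult_r_minus)
    then show ?thesis
      using coset_eq_iff assms yc by simp
  qed
  moreover have "x \<in> H +>\<^bsub>M\<^esub> x" by (rule H.a_rcos_self[OF assms(2)])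
  ultimately have "(\<Union>y\<in>H +>\<^bsub>M\<^esub> x. H +>\<^bsub>M\<^esub> (a \<odot>\<^bsub>M\<^esub> y)) = H +>\<^bsub>M\<^esub> (a \<odot>\<^bsub>M\<^esub> x)"
    by (metis (no_types, lifting) SUP_eq_const empty_iff)
  then show ?thesis by (simp only: quot_mod_simps)
qed

lemma quot_mod_cases:
  assumes "K \<in> carrier (quot_mod M H)"
  obtains x where "x \<in> carrier M" "K = H +>\<^bsub>M\<^esub> x"
  using assms by (auto simp: quot_mod_carrier)

lemma quot_mod_closed:
  assumes "x \<in> carrier M"
  shows "H +>\<^bsub>M\<^esub> x \<in> carrier (quot_mod M H)"
  using assms by (simp add: quot_mod_carrier)

lemma quot_mod_zero: "\<zero>\<^bsub>quot_mod M H\<^esub> = H +>\<^bsub>M\<^esub> \<zero>\<^bsub>M\<^esub>"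
  using H.a_subset by (simp add: quot_mod_simps)

lemma module_quot_mod: "module R (quot_mod M H)"
proof -
  note q = quot_mod_add quot_mod_smult quot_mod_closed
  show ?thesis
  proof (rule moduleI[OF M.R.is_cring])
    show "abelian_group (quot_mod M H)"
    proof (rule abelian_groupI)
      fix K assume "K \<in> carrier (quot_mod M H)"
      then obtain x where x: "x \<in> carrier M" "K = H +>\<^bsub>M\<^esub> x" by (rule quot_mod_cases)
      have "(H +>\<^bsub>M\<^esub> (\<ominus>\<^bsub>M\<^esub> x)) \<oplus>\<^bsub>quot_mod M H\<^esub> K = \<zero>\<^bsub>quot_mod M H\<^esub>"
        unfolding quot_mod_zero x(2) using x(1) by (simp only: quot_mod_add M.a_inv_closed M.l_neg)
      moreover have "H +>\<^bsub>M\<^esub> (\<ominus>\<^bsub>M\<^esub> x) \<in> carrier (quot_mod M H)" using x by (simp add: q)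
      ultimately show "\<exists>L\<in>carrier (quot_mod M H). L \<oplus>\<^bsub>quot_mod M H\<^esub> K = \<zero>\<^bsub>quot_mod M H\<^esub>"
        by blast
      show "\<zero>\<^bsub>quot_mod M H\<^esub> \<oplus>\<^bsub>quot_mod M H\<^esub> K = K"
        unfolding quot_mod_zero x(2) using x(1) by (simp only: quot_mod_add M.zero_closed M.l_zero)
    next
      show "\<zero>\<^bsub>quot_mod M H\<^esub> \<in> carrier (quot_mod M H)"
        unfolding quot_mod_zero by (rule quot_mod_closed) simp
    qed (auto elim!: quot_mod_cases simp: q M.a_ac)
  next
    fix a K assume a: "a \<in> carrier R" and "K \<in> carrier (quot_mod M H)"
    then obtain x where x: "x \<in> carrier M" "K = H +>\<^bsub>M\<^esub> x" by (blast elim: quot_mod_cases)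
    show "a \<odot>\<^bsub>quot_mod M H\<^esub> K \<in> carrier (quot_mod M H)"
      unfolding x(2) using a x(1) by (simp only: q M.smult_closed)
    show "(a \<oplus>\<^bsub>R\<^esub> b) \<odot>\<^bsub>quot_mod M H\<^esub> K = a \<odot>\<^bsub>quot_mod M H\<^esub> K \<oplus>\<^bsub>quot_mod M H\<^esub> b \<odot>\<^bsub>quot_mod M H\<^esub> K"
      if "b \<in> carrier R" for b
      unfolding x(2) using a that x(1) by (simp only: q M.smult_closed M.smult_l_distr M.R.add.m_closed)
    show "(a \<otimes>\<^bsub>R\<^esub> b) \<odot>\<^bsub>quot_mod M H\<^esub> K = a \<odot>\<^bsub>quot_mod M H\<^esub> (b \<odot>\<^bsub>quot_mod M H\<^esub> K)"
      if "b \<in> carrier R" for b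
      unfolding x(2) using a that x(1) by (simp only: q M.smult_closed M.smult_assoc1 M.R.m_closed)
    fix L assume "L \<in> carrier (quot_mod M H)"
    then obtain y where y: "y \<in> carrier M" "L = H +>\<^bsub>M\<^esub> y" by (rule quot_mod_cases)
    show "a \<odot>\<^bsub>quot_mod M H\<^esub> (K \<oplus>\<^bsub>quot_mod M H\<^esub> L) = a \<odot>\<^bsub>quot_mod M H\<^esub> K \<oplus>\<^bsub>quot_mod M H\<^esub> a \<odot>\<^bsub>quot_mod M H\<^esub> L"
      unfolding x(2) y(2) using a x(1) y(1)
      by (simp only: q M.smult_closed M.smult_r_distr M.add.m_closed)
  next
    fix K assume "K \<in> carrier (quot_mod M H)"
    then obtain x where x: "x \<in> carrier M" "K = H +>\<^bsub>M\<^esub> x" by (rule quot_mod_cases)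
    show "\<one>\<^bsub>R\<^esub> \<odot>\<^bsub>quot_mod M H\<^esub> K = K"
      unfolding x(2) using x(1) by (simp only: q M.smult_one M.R.one_closed)
  qed
qed

lemma quot_proj_hom: "(\<lambda>x\<in>carrier M. H +>\<^bsub>M\<^esub> x) \<in> mod_hom R M (quot_mod M H)"
  by (rule mod_homI[OF M]) (simp_all add: quot_mod_closed quot_mod_add quot_mod_smult)

lemma quot_mod_zero_iff: "zero_mod (quot_mod M H) \<longleftrightarrow> carrier M \<subseteq> H"
proof -
  have im: "f ` A = {c} \<longleftrightarrow> (\<forall>x\<in>A. f x = c)" if "A \<noteq> {}" for f :: "'b \<Rightarrow> 'b set" and A c
  proof
    assume "f ` A = {c}"
    then show "\<forall>x\<in>A. f x = c" by (metis imageI singletonD)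
  next
    assume "\<forall>x\<in>A. f x = c"
    then have "f ` A = (\<lambda>_. c) ` A" by (intro image_cong) auto
    then show "f ` A = {c}" using that by (simp add: image_constant_conv)
  qed
  have "carrier M \<noteq> {}" using M.zero_closed by auto
  then have "zero_mod (quot_mod M H) \<longleftrightarrow> (\<forall>x\<in>carrier M. H +>\<^bsub>M\<^esub> x = H)"
    using im[of "carrier M" "a_r_coset M H" H] by (simp only: zero_mod_def quot_mod_carrier quot_mod_simps(1)) simp
  also have "\<dots> \<longleftrightarrow> (\<forall>x\<in>carrier M. x \<in> H)"
    by (rule ball_cong[OF refl coset_zero_iff])
  finally show ?thesis by (simp only: subset_iff Ball_def)
qed

text \<open>The value on a coset is taken at a chosen representative. Two representatives differ by
  an element of H, which f kills.\<close>

lemma quot_lift_ex: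
  assumes "module R N" "f \<in> mod_hom R M N" "\<And>x. x \<in> H \<Longrightarrow> f x = \<zero>\<^bsub>N\<^esub>"
  shows "\<exists>g \<in> mod_hom R (quot_mod M H) N. \<forall>x\<in>carrier M. g (H +>\<^bsub>M\<^esub> x) = f x"
proof
  interpret N: module R N by fact
  define r where "r K = (SOME x. x \<in> carrier M \<and> K = H +>\<^bsub>M\<^esub> x)" for K
  let ?g = "\<lambda>K. f (r K)"
  have r: "r (H +>\<^bsub>M\<^esub> x) \<in> carrier M \<and> H +>\<^bsub>M\<^esub> x = H +>\<^bsub>M\<^esub> r (H +>\<^bsub>M\<^esub> x)" if "x \<in> carrier M" for x
    unfolding r_def by (rule someI_ex) (use that in blast)
  have g: "?g (H +>\<^bsub>M\<^esub> x) = f x" if x: "x \<in> carrier M" for x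
  proof -
    note rx = r[OF x, THEN conjunct1] r[OF x, THEN conjunct2]
    have "f (r (H +>\<^bsub>M\<^esub> x) \<ominus>\<^bsub>M\<^esub> x) = \<zero>\<^bsub>N\<^esub>"
      by (rule assms(3)) (use coset_eq_iff[OF rx(1) x] rx(2) in simp)
    then show ?thesis
      using mod_hom_diff[OF M assms(1,2) rx(1) x] mod_homD(1)[OF assms(2)] x rx(1)
      by (metis N.minus_eq_zero_iff)
  qed
  show "\<forall>x\<in>carrier M. (\<lambda>K\<in>carrier (quot_mod M H). ?g K) (H +>\<^bsub>M\<^esub> x) = f x"
    using g by (simp add: quot_mod_closed)
  show "(\<lambda>K\<in>carrier (quot_mod M H). ?g K) \<in> mod_hom R (quot_mod M H) N"
    by (rule mod_homI[OF module_quot_mod]; elim quot_mod_cases)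
      (simp_all add: g quot_mod_add quot_mod_smult mod_homD[OF assms(2)])
qed

end

text \<open>The criterion behind every comparison of cohomology. The map descends because B goes
  into B', it is injective on classes because nothing else does, and surjectivity is asked only
  modulo B'.\<close>

lemma quot_mod_isomorphicI:
  assumes "module R Z" "submodule B R Z" "module R Z'" "submodule B' R Z'"
    and f: "f \<in> mod_hom R Z Z'"
    and inj: "\<And>z. z \<in> carrier Z \<Longrightarrow> f z \<in> B' \<longleftrightarrow> z \<in> B"
    and surj: "\<And>y. y \<in> carrier Z' \<Longrightarrow> \<exists>z\<in>carrier Z. y \<ominus>\<^bsub>Z'\<^esub> f z \<in> B'"
  shows "mod_isomorphic R (quot_mod Z B) (quot_mod Z' B')"
proof -
  interpret Z: module R Z by fact
  interpret Z': module R Z' by fact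
  have sub: "B \<subseteq> carrier Z" by (rule Z.submoduleE[OF assms(2)])
  let ?p = "\<lambda>x\<in>carrier Z'. B' +>\<^bsub>Z'\<^esub> x"
  note fh = mod_homD[OF f]
  have pf: "compose (carrier Z) ?p f \<in> mod_hom R Z (quot_mod Z' B')"
    by (rule mod_hom_compose[OF assms(1) f quot_proj_hom[OF assms(3,4)]])
  have ker: "compose (carrier Z) ?p f x = \<zero>\<^bsub>quot_mod Z' B'\<^esub>" if x: "x \<in> B" for x
  proof -
    have xc: "x \<in> carrier Z" using sub x by auto
    then show ?thesis
      using x inj[OF xc] coset_zero_iff[OF assms(3,4)] fh by (simp add: compose_eq quot_mod_simps)
  qed
  obtain g where g: "g \<in> mod_hom R (quot_mod Z B) (quot_mod Z' B')"
    "\<And>x. x \<in> carrier Z \<Longrightarrow> g (B +>\<^bsub>Z\<^esub> x) = compose (carrier Z) ?p f x"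
    using quot_lift_ex[OF assms(1,2) module_quot_mod[OF assms(3,4)] pf ker] by blast
  have g': "g (B +>\<^bsub>Z\<^esub> x) = B' +>\<^bsub>Z'\<^esub> f x" if "x \<in> carrier Z" for x
    using g(2) that fh by (simp add: compose_eq)
  have "inj_on g (carrier (quot_mod Z B))"
  proof (rule inj_onI)
    fix K L assume "K \<in> carrier (quot_mod Z B)" "L \<in> carrier (quot_mod Z B)" "g K = g L"
    then obtain x y where xy: "x \<in> carrier Z" "y \<in> carrier Z" "K = B +>\<^bsub>Z\<^esub> x" "L = B +>\<^bsub>Z\<^esub> y"
      "B' +>\<^bsub>Z'\<^esub> f x = B' +>\<^bsub>Z'\<^esub> f y"
      by (auto simp: quot_mod_carrier g')
    then have "f (x \<ominus>\<^bsub>Z\<^esub> y) \<in> B'"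
      using coset_eq_iff[OF assms(3,4)] fh mod_hom_diff[OF assms(1,3) f] by simp
    then show "K = L"
      using inj[of "x \<ominus>\<^bsub>Z\<^esub> y"] xy coset_eq_iff[OF assms(1,2)] by simp
  qed
  moreover have "g ` carrier (quot_mod Z B) = carrier (quot_mod Z' B')"
  proof
    show "carrier (quot_mod Z' B') \<subseteq> g ` carrier (quot_mod Z B)"
    proof
      fix K assume "K \<in> carrier (quot_mod Z' B')"
      then obtain y where y: "y \<in> carrier Z'" "K = B' +>\<^bsub>Z'\<^esub> y" by (auto simp: quot_mod_carrier)
      from surj[OF y(1)] obtain z where z: "z \<in> carrier Z" "y \<ominus>\<^bsub>Z'\<^esub> f z \<in> B'" by auto
      then have "K = g (B +>\<^bsub>Z\<^esub> z)"
        using coset_eq_iff[OF assms(3,4) y(1)] fh y by (simp add: g')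
      then show "K \<in> g ` carrier (quot_mod Z B)" using z by (simp add: quot_mod_carrier)
    qed
  qed (use mod_homD(1)[OF g(1)] in auto)
  ultimately show ?thesis
    using g(1) by (auto simp: mod_isomorphic_def is_mod_iso_def bij_betw_def)
qed

section \<open>Tensor products\<close>

lemma submodule_submod_span:
  assumes "module R M" "A \<subseteq> carrier M"
  shows "submodule (submod_span R M A) R M"
proof -
  interpret M: module R M by fact
  note E = M.submoduleE
  have sub: "submod_span R M A \<subseteq> carrier M"
    using M.carrier_is_submodule assms(2) unfolding submod_span_def by blast
  have z: "\<zero>\<^bsub>M\<^esub> \<in> H" if "submodule H R M" for H
    using subgroup.one_closed[OF submodule.axioms(1)[OF that]] by simp
  show ?thesis
  proof (rule M.submoduleI[OF sub])
    show "\<zero>\<^bsub>M\<^esub> \<in> submod_span R M A" using z by (auto simp: submod_span_def)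
  qed (auto simp: submod_span_def E)
qed

lemma submod_span_incl: "A \<subseteq> submod_span R M A"
  by (auto simp: submod_span_def)

lemma submod_span_least: "submodule H R M \<Longrightarrow> A \<subseteq> H \<Longrightarrow> submod_span R M A \<subseteq> H"
  by (auto simp: submod_span_def)

text \<open>Every element of a free module is a \<open>free_lift\<close> of the generators, and
  homomorphisms commute with \<open>free_lift\<close>, so the values on generators determine the
  rest.\<close>

lemma free_mod_hom_ext:
  assumes "module R N" "f \<in> mod_hom R (free_mod R S) N" "g \<in> mod_hom R (free_mod R S) N"
    and "\<And>s. s \<in> S \<Longrightarrow> f (free_gen R s) = g (free_gen R s)"
  shows "f = g"
proof (rule mod_hom_ext[OF assms(2,3)])
  interpret N: module R N by fact
  have F: "module R (free_mod R S)" by (rule module_free_mod[OF N.R.is_cring])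
  have gen: "free_gen R \<in> S \<rightarrow> carrier (free_mod R S)"
    using free_gen_closed[OF N.R.is_cring] by auto
  fix t assume t: "t \<in> carrier (free_mod R S)"
  have h: "h t = free_lift R S N (h \<circ> free_gen R) t" if "h \<in> mod_hom R (free_mod R S) N" for h
    using hom_free_lift[OF F assms(1) that gen t] free_lift_self[OF N.R.is_cring t] by simp
  have hg: "(h \<circ> free_gen R) \<in> S \<rightarrow> carrier N" if "h \<in> mod_hom R (free_mod R S) N" for h
    using mod_homD(1)[OF that] gen by (auto simp: Pi_iff)
  have tS: "finite {s. t s \<noteq> \<zero>\<^bsub>R\<^esub>}" "{s. t s \<noteq> \<zero>\<^bsub>R\<^esub>} \<subseteq> S" "t s \<in> carrier R" for s
    using t by (auto simp: free_mod_def)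
  have "free_lift R S N (f \<circ> free_gen R) t = free_lift R S N (g \<circ> free_gen R) t"
    unfolding free_lift_superset[OF assms(1) hg[OF assms(2)] t tS(1) order_refl tS(2)]
      free_lift_superset[OF assms(1) hg[OF assms(3)] t tS(1) order_refl tS(2)]
    using hg[OF assms(3)] tS assms(4)
    by (intro N.add.finprod_cong') (auto simp: Pi_iff simp del: mem_Collect_eq)
  then show "f t = g t" using h[OF assms(2)] h[OF assms(3)] by simp
qed

definition bilinear ::
  "[('a, _) ring_scheme, ('a, 'b, _) module_scheme, ('a, 'c, _) module_scheme,
    ('a, 'd, _) module_scheme, 'b \<Rightarrow> 'c \<Rightarrow> 'd] \<Rightarrow> bool"
  where "bilinear R A B L \<beta> \<longleftrightarrow>
    (\<forall>x\<in>carrier A. \<forall>y\<in>carrier B. \<beta> x y \<in> carrier L) \<and>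
    (\<forall>x\<in>carrier A. \<forall>x'\<in>carrier A. \<forall>y\<in>carrier B. \<beta> (x \<oplus>\<^bsub>A\<^esub> x') y = \<beta> x y \<oplus>\<^bsub>L\<^esub> \<beta> x' y) \<and>
    (\<forall>x\<in>carrier A. \<forall>y\<in>carrier B. \<forall>y'\<in>carrier B. \<beta> x (y \<oplus>\<^bsub>B\<^esub> y') = \<beta> x y \<oplus>\<^bsub>L\<^esub> \<beta> x y') \<and>
    (\<forall>a\<in>carrier R. \<forall>x\<in>carrier A. \<forall>y\<in>carrier B. \<beta> (a \<odot>\<^bsub>A\<^esub> x) y = a \<odot>\<^bsub>L\<^esub> \<beta> x y) \<and>
    (\<forall>a\<in>carrier R. \<forall>x\<in>carrier A. \<forall>y\<in>carrier B. \<beta> x (a \<odot>\<^bsub>B\<^esub> y) = a \<odot>\<^bsub>L\<^esub> \<beta> x y)"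

lemma tensor_rels_cases:
  assumes "r \<in> tensor_rels R A B"
  obtains (left_add) x x' y where "x \<in> carrier A" "x' \<in> carrier A" "y \<in> carrier B"
    "r = free_gen R (x \<oplus>\<^bsub>A\<^esub> x', y) \<ominus>\<^bsub>free_mod R (carrier A \<times> carrier B)\<^esub>
       (free_gen R (x, y) \<oplus>\<^bsub>free_mod R (carrier A \<times> carrier B)\<^esub> free_gen R (x', y))"
  | (right_add) x y y' where "x \<in> carrier A" "y \<in> carrier B" "y' \<in> carrier B"
    "r = free_gen R (x, y \<oplus>\<^bsub>B\<^esub> y') \<ominus>\<^bsub>free_mod R (carrier A \<times> carrier B)\<^esub>
       (free_gen R (x, y) \<oplus>\<^bsub>free_mod R (carrier A \<times> carrier B)\<^esub> free_gen R (x, y'))"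
  | (left_smult) a x y where "a \<in> carrier R" "x \<in> carrier A" "y \<in> carrier B"
    "r = free_gen R (a \<odot>\<^bsub>A\<^esub> x, y) \<ominus>\<^bsub>free_mod R (carrier A \<times> carrier B)\<^esub>
       (a \<odot>\<^bsub>free_mod R (carrier A \<times> carrier B)\<^esub> free_gen R (x, y))"
  | (right_smult) a x y where "a \<in> carrier R" "x \<in> carrier A" "y \<in> carrier B"
    "r = free_gen R (x, a \<odot>\<^bsub>B\<^esub> y) \<ominus>\<^bsub>free_mod R (carrier A \<times> carrier B)\<^esub>
       (a \<odot>\<^bsub>free_mod R (carrier A \<times> carrier B)\<^esub> free_gen R (x, y))"
  using assms unfolding tensor_rels_def Let_def by blast

context
  fixes R :: "('a, 'r) ring_scheme" and A :: "('a, 'b, 'm) module_scheme"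
    and B :: "('a, 'c, 'n) module_scheme"
  assumes A: "module R A" and B: "module R B"
begin

interpretation A: module R A by (rule A)
interpretation B: module R B by (rule B)

abbreviation (input) "FT \<equiv> free_mod R (carrier A \<times> carrier B)"

lemma module_FT: "module R FT"
  by (rule module_free_mod[OF A.R.is_cring])

interpretation FT: module R FT by (rule module_FT)

lemma gen_FT: "x \<in> carrier A \<Longrightarrow> y \<in> carrier B \<Longrightarrow> free_gen R (x, y) \<in> carrier FT"
  by (rule free_gen_closed[OF A.R.is_cring]) simp

lemma tensor_rels_closed: "tensor_rels R A B \<subseteq> carrier FT"
proof
  fix r assume "r \<in> tensor_rels R A B"
  then show "r \<in> carrier FT"
    by (cases rule: tensor_rels_cases) (simp_all add: gen_FT)
qed

lemma submodule_tensor_ker: "submodule (tensor_ker R A B) R FT"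
  unfolding tensor_ker_def by (rule submodule_submod_span[OF module_FT tensor_rels_closed])

lemma module_tensor_mod: "module R (tensor_mod R A B)"
  unfolding tensor_mod_def by (rule module_quot_mod[OF module_FT submodule_tensor_ker])

interpretation T: module R "tensor_mod R A B" by (rule module_tensor_mod)

lemma pure_tensor_closed:
  "x \<in> carrier A \<Longrightarrow> y \<in> carrier B \<Longrightarrow> pure_tensor R A B x y \<in> carrier (tensor_mod R A B)"
  unfolding pure_tensor_def tensor_mod_def
  by (rule quot_mod_closed[OF module_FT submodule_tensor_ker gen_FT])

text \<open>Each law holds because the difference of its two sides is one of the generating
  relations and hence has trivial coset.\<close>

lemma bilinear_pure_tensor: "bilinear R A B (tensor_mod R A B) (pure_tensor R A B)"
proof -
  let ?e = "\<lambda>x y. free_gen R (x, y)"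
  note add = quot_mod_add[OF module_FT submodule_tensor_ker, folded tensor_mod_def]
  note smult = quot_mod_smult[OF module_FT submodule_tensor_ker, folded tensor_mod_def]
  note eqI = coset_eq_iff[OF module_FT submodule_tensor_ker, THEN iffD2]
  have incl: "tensor_rels R A B \<subseteq> tensor_ker R A B"
    unfolding tensor_ker_def by (rule submod_span_incl)
  show ?thesis
    unfolding bilinear_def
  proof (intro conjI ballI)
    fix x x' y assume "x \<in> carrier A" "x' \<in> carrier A" "y \<in> carrier B"
    then show "pure_tensor R A B (x \<oplus>\<^bsub>A\<^esub> x') y =
        pure_tensor R A B x y \<oplus>\<^bsub>tensor_mod R A B\<^esub> pure_tensor R A B x' y"
      unfolding pure_tensor_def
      by (simp add: add gen_FT, intro eqI subsetD[OF incl], simp_all add: gen_FT)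
        (unfold tensor_rels_def Let_def, blast)
  next
    fix x y y' assume "x \<in> carrier A" "y \<in> carrier B" "y' \<in> carrier B"
    then show "pure_tensor R A B x (y \<oplus>\<^bsub>B\<^esub> y') =
        pure_tensor R A B x y \<oplus>\<^bsub>tensor_mod R A B\<^esub> pure_tensor R A B x y'"
      unfolding pure_tensor_def
      by (simp add: add gen_FT, intro eqI subsetD[OF incl], simp_all add: gen_FT)
        (unfold tensor_rels_def Let_def, blast)
  next
    fix a x y assume "a \<in> carrier R" "x \<in> carrier A" "y \<in> carrier B"
    then show "pure_tensor R A B (a \<odot>\<^bsub>A\<^esub> x) y = a \<odot>\<^bsub>tensor_mod R A B\<^esub> pure_tensor R A B x y"
      unfolding pure_tensor_def
      by (simp add: smult gen_FT, intro eqI subsetD[OF incl], simp_all add: gen_FT)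
        (unfold tensor_rels_def Let_def, blast)
  next
    fix a x y assume "a \<in> carrier R" "x \<in> carrier A" "y \<in> carrier B"
    then show "pure_tensor R A B x (a \<odot>\<^bsub>B\<^esub> y) = a \<odot>\<^bsub>tensor_mod R A B\<^esub> pure_tensor R A B x y"
      unfolding pure_tensor_def
      by (simp add: smult gen_FT, intro eqI subsetD[OF incl], simp_all add: gen_FT)
        (unfold tensor_rels_def Let_def, blast)
  qed (rule pure_tensor_closed)
qed

lemmas pure_tensor_bilinear =
  bilinear_pure_tensor[unfolded bilinear_def, THEN conjunct2, THEN conjunct1, rule_format]
  bilinear_pure_tensor[unfolded bilinear_def, THEN conjunct2, THEN conjunct2, THEN conjunct1, rule_format]
  bilinear_pure_tensor[unfolded bilinear_def, THEN conjunct2, THEN conjunct2, THEN conjunct2,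
    THEN conjunct1, rule_format]
  bilinear_pure_tensor[unfolded bilinear_def, THEN conjunct2, THEN conjunct2, THEN conjunct2,
    THEN conjunct2, rule_format]

text \<open>Pulled back to the free module on pairs, both maps are determined by the generators,
  whose classes are the pure tensors. Later identities between maps out of a tensor product are
  checked this way.\<close>

lemma tensor_mod_hom_ext:
  assumes "module R N" "f \<in> mod_hom R (tensor_mod R A B) N" "g \<in> mod_hom R (tensor_mod R A B) N"
    and eq: "\<And>x y. x \<in> carrier A \<Longrightarrow> y \<in> carrier B \<Longrightarrow>
      f (pure_tensor R A B x y) = g (pure_tensor R A B x y)"
  shows "f = g"
proof (rule mod_hom_ext[OF assms(2,3)])
  let ?p = "\<lambda>t\<in>carrier FT. tensor_ker R A B +>\<^bsub>FT\<^esub> t"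
  note p = quot_proj_hom[OF module_FT submodule_tensor_ker, folded tensor_mod_def]
  have "compose (carrier FT) f ?p = compose (carrier FT) g ?p"
    by (rule free_mod_hom_ext[OF assms(1) mod_hom_compose[OF module_FT p assms(2)]
          mod_hom_compose[OF module_FT p assms(3)]])
      (auto simp: compose_eq gen_FT eq[unfolded pure_tensor_def])
  then have *: "compose (carrier FT) f ?p t = compose (carrier FT) g ?p t" for t by simp
  fix K assume "K \<in> carrier (tensor_mod R A B)"
  then obtain t where "t \<in> carrier FT" "K = tensor_ker R A B +>\<^bsub>FT\<^esub> t"
    unfolding tensor_mod_def by (rule quot_mod_cases[OF module_FT submodule_tensor_ker])
  then show "f K = g K" using *[of t] by (simp add: compose_eq)
qed

context
  fixes L :: "('a, 'd, 'k) module_scheme" and \<beta> :: "'b \<Rightarrow> 'c \<Rightarrow> 'd"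
  assumes L: "module R L" and \<beta>: "bilinear R A B L \<beta>"
begin

interpretation L: module R L by (rule L)

lemma tensor_lift_hom_pure:
  "tensor_lift R A B L \<beta> \<in> mod_hom R (tensor_mod R A B) L \<and>
    (\<forall>x\<in>carrier A. \<forall>y\<in>carrier B. tensor_lift R A B L \<beta> (pure_tensor R A B x y) = \<beta> x y)"
proof -
  let ?S = "carrier A \<times> carrier B" and ?b = "\<lambda>p. \<beta> (fst p) (snd p)"
  let ?f = "free_lift R ?S L ?b"
  have b: "?b \<in> ?S \<rightarrow> carrier L" using \<beta> by (auto simp: bilinear_def)
  note f = free_lift_hom[OF L b]
  note fD = mod_homD[OF f] mod_hom_diff[OF module_FT L f]
  have gen: "?f (free_gen R (x, y)) = \<beta> x y" if "x \<in> carrier A" "y \<in> carrier B" for x y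
    using free_lift_gen[OF L b, of "(x, y)"] that by simp
  have \<beta>c: "x \<in> carrier A \<Longrightarrow> y \<in> carrier B \<Longrightarrow> \<beta> x y \<in> carrier L" for x y
    using \<beta> by (auto simp: bilinear_def)
  \<comment> \<open>Bilinearity of \<beta> says exactly that its linear extension kills the
    generating relations. The kernel is a submodule, so it contains their span as well.\<close>
  have "tensor_rels R A B \<subseteq> {t \<in> carrier FT. ?f t = \<zero>\<^bsub>L\<^esub>}"
  proof
    fix r assume r: "r \<in> tensor_rels R A B"
    then have "?f r = \<zero>\<^bsub>L\<^esub>"
      by (cases rule: tensor_rels_cases)
        (use \<beta>[unfolded bilinear_def] in \<open>simp_all add: fD gen gen_FT \<beta>c L.minus_eq_zero_iff\<close>)
    then show "r \<in> {t \<in> carrier FT. ?f t = \<zero>\<^bsub>L\<^esub>}" using r tensor_rels_closed by auto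
  qed
  then have ker: "\<And>t. t \<in> tensor_ker R A B \<Longrightarrow> ?f t = \<zero>\<^bsub>L\<^esub>"
    unfolding tensor_ker_def
    using submod_span_least[OF submodule_kernel[OF module_FT L f]] by blast
  obtain g where g: "g \<in> mod_hom R (tensor_mod R A B) L"
    "\<And>t. t \<in> carrier FT \<Longrightarrow> g (tensor_ker R A B +>\<^bsub>FT\<^esub> t) = ?f t"
    using quot_lift_ex[OF module_FT submodule_tensor_ker L f ker, folded tensor_mod_def] by blast
  \<comment> \<open>This matches the concrete \<open>the_elem\<close> in \<open>tensor_lift\<close>
    with the abstract induced map g: every representative of the class K yields the same sum, so the
    image of K is the singleton of g K.\<close>
  have val: "tensor_lift R A B L \<beta> K = g K" if K: "K \<in> carrier (tensor_mod R A B)" for K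
  proof -
    obtain t where t: "t \<in> carrier FT" "K = tensor_ker R A B +>\<^bsub>FT\<^esub> t"
      using K unfolding tensor_mod_def by (rule quot_mod_cases[OF module_FT submodule_tensor_ker])
    have Kc: "K \<subseteq> carrier FT"
      using t FT.a_r_coset_subset_G[OF FT.submoduleE(1)[OF submodule_tensor_ker]] by simp
    have s: "(\<Oplus>\<^bsub>L\<^esub>p\<in>{p. s p \<noteq> \<zero>\<^bsub>R\<^esub>}. s p \<odot>\<^bsub>L\<^esub> ?b p) = g K" if "s \<in> K" for s
    proof -
      have "K = tensor_ker R A B +>\<^bsub>FT\<^esub> s"
        using FT.a_repr_independence[OF _ t(1) submodule.axioms(1)[OF submodule_tensor_ker]] t that
        by simp
      then show ?thesis using g(2)[of s] Kc that by (auto simp: free_lift_def)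
    qed
    have "t \<in> K"
      unfolding t(2)
      by (rule abelian_subgroup.a_rcos_self[OF abelian_subgroup_submodule[OF module_FT submodule_tensor_ker] t(1)])
    then have "(\<lambda>s. \<Oplus>\<^bsub>L\<^esub>p\<in>{p. s p \<noteq> \<zero>\<^bsub>R\<^esub>}. s p \<odot>\<^bsub>L\<^esub> ?b p) ` K = {g K}"
      using s by (simp cong: image_cong add: image_constant)
    then show ?thesis using K by (simp add: tensor_lift_def)
  qed
  have "tensor_lift R A B L \<beta> = (\<lambda>K\<in>carrier (tensor_mod R A B). g K)"
    using val by (intro extensionalityI[of _ "carrier (tensor_mod R A B)"]) (auto simp: tensor_lift_def)
  then have "tensor_lift R A B L \<beta> = g" using mod_hom_extensional[OF g(1)] by simp
  moreover have "g (pure_tensor R A B x y) = \<beta> x y" if "x \<in> carrier A" "y \<in> carrier B" for x y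
    unfolding pure_tensor_def using that g(2)[OF gen_FT] gen by simp
  ultimately show ?thesis using g(1) by simp
qed

end

end

lemma tensor_map_hom_pure:
  assumes "module R C" "module R P" "module R Q" "f \<in> mod_hom R P Q"
  shows tensor_map_hom: "tensor_map R C P Q f \<in> mod_hom R (tensor_mod R C P) (tensor_mod R C Q)"
    and tensor_map_pure: "\<And>c p. c \<in> carrier C \<Longrightarrow> p \<in> carrier P \<Longrightarrow>
      tensor_map R C P Q f (pure_tensor R C P c p) = pure_tensor R C Q c (f p)"
proof -
  have "bilinear R C P (tensor_mod R C Q) (\<lambda>c p. pure_tensor R C Q c (f p))"
    using bilinear_pure_tensor[OF assms(1,3)] by (simp add: bilinear_def mod_homD[OF assms(4)])
  from tensor_lift_hom_pure[OF assms(1,2) module_tensor_mod[OF assms(1,3)] this]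
  show "tensor_map R C P Q f \<in> mod_hom R (tensor_mod R C P) (tensor_mod R C Q)"
    "\<And>c p. c \<in> carrier C \<Longrightarrow> p \<in> carrier P \<Longrightarrow>
      tensor_map R C P Q f (pure_tensor R C P c p) = pure_tensor R C Q c (f p)"
    by (simp_all add: tensor_map_def)
qed

section \<open>The adjunction between the tensor product and Hom\<close>

definition tensor_curry ::
  "[('a, _) ring_scheme, ('a, 'c, _) module_scheme, ('a, 'p, _) module_scheme,
    ('c \<times> 'p \<Rightarrow> 'a) set \<Rightarrow> 'n] \<Rightarrow> 'p \<Rightarrow> 'c \<Rightarrow> 'n"
  where "tensor_curry R C P f = (\<lambda>p\<in>carrier P. \<lambda>c\<in>carrier C. f (pure_tensor R C P c p))"

context
  fixes R :: "('a, 'r) ring_scheme" and C :: "('a, 'c, 'm) module_scheme"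
    and P :: "('a, 'p, 'k) module_scheme" and N :: "('a, 'n, 'l) module_scheme"
  assumes C: "module R C" and P: "module R P" and N: "module R N"
begin

interpretation C: module R C by (rule C)
interpretation P: module R P by (rule P)
interpretation N: module R N by (rule N)

lemma tensor_curry_closed:
  assumes "f \<in> mod_hom R (tensor_mod R C P) N"
  shows "tensor_curry R C P f \<in> mod_hom R P (hom_mod R C N)"
  unfolding tensor_curry_def
proof (rule mod_homI[OF P])
  note [simp] = pure_tensor_bilinear[OF C P] pure_tensor_closed[OF C P] mod_homD[OF assms]
  fix p assume p: "p \<in> carrier P"
  then show "(\<lambda>c\<in>carrier C. f (pure_tensor R C P c p)) \<in> carrier (hom_mod R C N)"
    unfolding hom_mod_simps by (intro mod_homI[OF C]) simp_all
  show "(\<lambda>c\<in>carrier C. f (pure_tensor R C P c (p \<oplus>\<^bsub>P\<^esub> q))) =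
      (\<lambda>c\<in>carrier C. f (pure_tensor R C P c p)) \<oplus>\<^bsub>hom_mod R C N\<^esub> (\<lambda>c\<in>carrier C. f (pure_tensor R C P c q))"
    if "q \<in> carrier P" for q
    unfolding hom_mod_simps using p that by (auto intro!: restrict_ext)
  show "(\<lambda>c\<in>carrier C. f (pure_tensor R C P c (a \<odot>\<^bsub>P\<^esub> p))) =
      a \<odot>\<^bsub>hom_mod R C N\<^esub> (\<lambda>c\<in>carrier C. f (pure_tensor R C P c p))"
    if "a \<in> carrier R" for a
    unfolding hom_mod_simps using p that by (auto intro!: restrict_ext)
qed

lemma tensor_curry_apply:
  "p \<in> carrier P \<Longrightarrow> c \<in> carrier C \<Longrightarrow> tensor_curry R C P f p c = f (pure_tensor R C P c p)"
  by (simp add: tensor_curry_def)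

lemma bilinear_uncurry:
  assumes "g \<in> mod_hom R P (hom_mod R C N)"
  shows "bilinear R C P N (\<lambda>c p. g p c)"
proof -
  have g: "g p \<in> mod_hom R C N" if "p \<in> carrier P" for p
    using mod_homD(1)[OF assms that] by (simp add: hom_mod_simps)
  show ?thesis
    unfolding bilinear_def
    by (auto simp: mod_homD[OF g] mod_homD(2,3)[OF assms] hom_mod_simps)
qed

text \<open>Uncurrying is a right inverse of \<open>tensor_curry\<close>. Together with
  \<open>tensor_curry_inj\<close> it makes the adjunction a bijection of Hom sets.\<close>

lemma tensor_uncurry:
  assumes "g \<in> mod_hom R P (hom_mod R C N)"
  shows "tensor_lift R C P N (\<lambda>c p. g p c) \<in> mod_hom R (tensor_mod R C P) N"
    and "tensor_curry R C P (tensor_lift R C P N (\<lambda>c p. g p c)) = g"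
proof -
  note l = tensor_lift_hom_pure[OF C P N bilinear_uncurry[OF assms]]
  then show h: "tensor_lift R C P N (\<lambda>c p. g p c) \<in> mod_hom R (tensor_mod R C P) N" by simp
  show "tensor_curry R C P (tensor_lift R C P N (\<lambda>c p. g p c)) = g"
  proof (rule mod_hom_ext[OF tensor_curry_closed[OF h] assms])
    fix p assume p: "p \<in> carrier P"
    then have "g p \<in> mod_hom R C N"
      using mod_homD(1)[OF assms] by (simp add: hom_mod_simps)
    then have "(\<lambda>c\<in>carrier C. g p c) = g p" by (rule mod_hom_extensional)
    then show "tensor_curry R C P (tensor_lift R C P N (\<lambda>c p. g p c)) p = g p"
      using p l by (simp add: tensor_curry_def cong: restrict_cong)
  qed
qed

lemma tensor_curry_inj:
  assumes "f \<in> mod_hom R (tensor_mod R C P) N" "g \<in> mod_hom R (tensor_mod R C P) N"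
    and "tensor_curry R C P f = tensor_curry R C P g"
  shows "f = g"
  by (rule tensor_mod_hom_ext[OF C P N assms(1,2)])
    (use assms(3) tensor_curry_apply[of _ _ f] tensor_curry_apply[of _ _ g] in simp)

end

section \<open>Projective modules and the comparison theorem\<close>

lemma projective_module: "projective R P \<Longrightarrow> module R P"
  by (simp add: projective_def)

text \<open>Because \<open>sub\<close> only places the image of h inside the image of g, lifts
  through a differential follow directly from exactness, without passing to the submodule of cycles.
  The lift is built on the free module from preimages of the images of its generators and then
  composed with s.\<close>

lemma projective_lift:
  fixes P :: "('a, 'p, 'k) module_scheme"
  assumes "projective R P" "module R A" "module R B"
    and g: "g \<in> mod_hom R A B" and h: "h \<in> mod_hom R P B"
    and sub: "\<And>p. p \<in> carrier P \<Longrightarrow> h p \<in> g ` carrier A"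
  shows "\<exists>k \<in> mod_hom R P A. \<forall>p\<in>carrier P. g (k p) = h p"
proof -
  obtain S :: "'p set" and s r where s: "s \<in> mod_hom R P (free_mod R S)" and r: "r \<in> mod_hom R (free_mod R S) P"
    and rs: "\<And>p. p \<in> carrier P \<Longrightarrow> r (s p) = p"
    using assms(1) unfolding projective_def by blast
  interpret A: module R A by fact
  let ?F = "free_mod R S"
  have F: "module R ?F" by (rule module_free_mod[OF A.R.is_cring])
  have gen: "free_gen R t \<in> carrier ?F" if "t \<in> S" for t
    by (rule free_gen_closed[OF A.R.is_cring that])
  have "\<exists>a\<in>carrier A. g a = h (r (free_gen R t))" if "t \<in> S" for t
    using sub[OF mod_homD(1)[OF r gen[OF that]]] by auto
  then obtain a where a: "\<And>t. t \<in> S \<Longrightarrow> a t \<in> carrier A" "\<And>t. t \<in> S \<Longrightarrow> g (a t) = h (r (free_gen R t))"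
    by metis
  have aS: "a \<in> S \<rightarrow> carrier A" using a by auto
  let ?l = "free_lift R S A a"
  have l: "?l \<in> mod_hom R ?F A" by (rule free_lift_hom[OF assms(2) aS])
  have eq: "compose (carrier ?F) g ?l = compose (carrier ?F) h r"
    by (rule free_mod_hom_ext[OF assms(3) mod_hom_compose[OF F l g] mod_hom_compose[OF F r h]])
      (simp add: compose_eq gen a free_lift_gen[OF assms(2) aS])
  have "g (?l (s p)) = h p" if "p \<in> carrier P" for p
    using fun_cong[OF eq, of "s p"] mod_homD(1)[OF s that] rs[OF that] by (simp add: compose_eq)
  then show ?thesis
    by (intro bexI[OF _ mod_hom_compose[OF projective_module[OF assms(1)] s l]]) (simp add: compose_eq)
qed

lemma free_cover:
  assumes "module R P"
  shows "free_lift R (carrier P) P (\<lambda>x. x) \<in> mod_hom R (free_mod R (carrier P)) P"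
    and "free_lift R (carrier P) P (\<lambda>x. x) ` carrier (free_mod R (carrier P)) = carrier P"
proof -
  interpret P: module R P by fact
  show h: "free_lift R (carrier P) P (\<lambda>x. x) \<in> mod_hom R (free_mod R (carrier P)) P"
    by (rule free_lift_hom[OF assms]) simp
  show "free_lift R (carrier P) P (\<lambda>x. x) ` carrier (free_mod R (carrier P)) = carrier P"
  proof
    show "carrier P \<subseteq> free_lift R (carrier P) P (\<lambda>x. x) ` carrier (free_mod R (carrier P))"
    proof
      fix p assume p: "p \<in> carrier P"
      show "p \<in> free_lift R (carrier P) P (\<lambda>x. x) ` carrier (free_mod R (carrier P))"
        using free_lift_gen[OF assms, of "\<lambda>x. x", OF _ p]
        by (intro image_eqI[of _ _ "free_gen R p"] free_gen_closed[OF P.R.is_cring p]) simp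
    qed
  qed (use mod_homD(1)[OF h] in auto)
qed

text \<open>The definition admits only bases inside the type of P. The carrier of P is such a basis,
  so splitting the canonical cover always fits the type.\<close>

lemma projectiveI:
  assumes "module R P" "s \<in> mod_hom R P (free_mod R (carrier P))"
    and "\<And>p. p \<in> carrier P \<Longrightarrow> free_lift R (carrier P) P (\<lambda>x. x) (s p) = p"
  shows "projective R P"
  unfolding projective_def using assms free_cover(1)[OF assms(1)] by blast

section \<open>Lifting maps and homotopies along resolutions\<close>

definition chain_complex ::
  "[('a, _) ring_scheme, nat \<Rightarrow> ('a, 'x, _) module_scheme, nat \<Rightarrow> 'x \<Rightarrow> 'x] \<Rightarrow> bool"
  where "chain_complex R X d \<longleftrightarrow> (\<forall>n. module R (X n)) \<and> (\<forall>n. d n \<in> mod_hom R (X (Suc n)) (X n)) \<and>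
    (\<forall>n. \<forall>x\<in>carrier (X (Suc (Suc n))). d n (d (Suc n) x) = \<zero>\<^bsub>X n\<^esub>)"

lemma chain_complexD:
  assumes "chain_complex R X d"
  shows "module R (X n)" "d n \<in> mod_hom R (X (Suc n)) (X n)"
    "x \<in> carrier (X (Suc (Suc n))) \<Longrightarrow> d n (d (Suc n) x) = \<zero>\<^bsub>X n\<^esub>"
  using assms by (auto simp: chain_complex_def)

definition resolution ::
  "[('a, _) ring_scheme, nat \<Rightarrow> ('a, 'x, _) module_scheme, nat \<Rightarrow> 'x \<Rightarrow> 'x,
    ('a, 'b, _) module_scheme, 'x \<Rightarrow> 'b] \<Rightarrow> bool"
  where "resolution R X d M e \<longleftrightarrow> (\<forall>n. module R (X n)) \<and> module R M \<and>
    aug_complex R X d M e \<and> aug_exact X d M e"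

lemma resolutionD:
  assumes "resolution R X d M e"
  shows "chain_complex R X d" "module R (X n)" "module R M" "d n \<in> mod_hom R (X (Suc n)) (X n)"
    "e \<in> mod_hom R (X 0) M"
    "x \<in> carrier (X (Suc (Suc n))) \<Longrightarrow> d n (d (Suc n) x) = \<zero>\<^bsub>X n\<^esub>"
    "y \<in> carrier (X (Suc 0)) \<Longrightarrow> e (d 0 y) = \<zero>\<^bsub>M\<^esub>"
    "e ` carrier (X 0) = carrier M"
    "u \<in> carrier (X 0) \<Longrightarrow> e u = \<zero>\<^bsub>M\<^esub> \<Longrightarrow> u \<in> d 0 ` carrier (X (Suc 0))"
    "v \<in> carrier (X (Suc n)) \<Longrightarrow> d n v = \<zero>\<^bsub>X n\<^esub> \<Longrightarrow> v \<in> d (Suc n) ` carrier (X (Suc (Suc n)))"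
proof -
  note D = assms[unfolded resolution_def aug_complex_def aug_exact_def]
  show "chain_complex R X d" "module R (X n)" "module R M" "d n \<in> mod_hom R (X (Suc n)) (X n)"
    "e \<in> mod_hom R (X 0) M"
    "x \<in> carrier (X (Suc (Suc n))) \<Longrightarrow> d n (d (Suc n) x) = \<zero>\<^bsub>X n\<^esub>"
    "y \<in> carrier (X (Suc 0)) \<Longrightarrow> e (d 0 y) = \<zero>\<^bsub>M\<^esub>"
    "e ` carrier (X 0) = carrier M"
    using D by (simp_all add: chain_complex_def)
  have "{x \<in> carrier (X 0). e x = \<zero>\<^bsub>M\<^esub>} = d 0 ` carrier (X (Suc 0))"
    "{x \<in> carrier (X (Suc n)). d n x = \<zero>\<^bsub>X n\<^esub>} = d (Suc n) ` carrier (X (Suc (Suc n)))"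
    using D by simp_all
  then show "u \<in> carrier (X 0) \<Longrightarrow> e u = \<zero>\<^bsub>M\<^esub> \<Longrightarrow> u \<in> d 0 ` carrier (X (Suc 0))"
    "v \<in> carrier (X (Suc n)) \<Longrightarrow> d n v = \<zero>\<^bsub>X n\<^esub> \<Longrightarrow> v \<in> d (Suc n) ` carrier (X (Suc (Suc n)))"
    by blast+
qed

lemma projective_resolutionD:
  assumes "projective_resolution R M P d e" "module R M"
  shows "resolution R P d M e" "projective R (P n)"
  using assms projective_module unfolding resolution_def projective_resolution_def by blast+

definition chain_map ::
  "[('a, _) ring_scheme, nat \<Rightarrow> ('a, 'x, _) module_scheme, nat \<Rightarrow> 'x \<Rightarrow> 'x,
    nat \<Rightarrow> ('a, 'y, _) module_scheme, nat \<Rightarrow> 'y \<Rightarrow> 'y, nat \<Rightarrow> 'x \<Rightarrow> 'y] \<Rightarrow> bool"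
  where "chain_map R X d Y d' \<phi> \<longleftrightarrow> (\<forall>n. \<phi> n \<in> mod_hom R (X n) (Y n)) \<and>
    (\<forall>n. \<forall>x\<in>carrier (X (Suc n)). d' n (\<phi> (Suc n) x) = \<phi> n (d n x))"

text \<open>The comparison theorem: projectivity of the source lifts each map, and exactness of the
  target guarantees that the next map can be lifted. The two complexes and the two modules may live
  in different types.\<close>

lemma chain_map_lift:
  assumes P: "\<And>n. projective R (P n)" "aug_complex R P d M e" "module R M"
    and Y: "resolution R Y d' M' e'" and f: "f \<in> mod_hom R M M'"
  shows "\<exists>\<phi>. chain_map R P d Y d' \<phi> \<and> (\<forall>p\<in>carrier (P 0). e' (\<phi> 0 p) = f (e p))"
proof -
  note YD = resolutionD[OF Y]
  have Pm: "module R (P n)" for n by (rule projective_module[OF P(1)])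
  have d: "d n \<in> mod_hom R (P (Suc n)) (P n)" "e \<in> mod_hom R (P 0) M" for n
    using P(2) by (auto simp: aug_complex_def)
  have dd: "x \<in> carrier (P (Suc (Suc n))) \<Longrightarrow> d n (d (Suc n) x) = \<zero>\<^bsub>P n\<^esub>"
    "y \<in> carrier (P (Suc 0)) \<Longrightarrow> e (d 0 y) = \<zero>\<^bsub>M\<^esub>" for n x y
    using P(2) by (auto simp: aug_complex_def)
  \<comment> \<open>The invariant \<open>I\<close> keeps the image of k after d n inside the image
    of d' n, which is what the lift in degree n + 1 asks for; its clause for n = 0 carries the
    augmentation. \<open>J\<close> is the commuting square.\<close>
  define I where "I n k \<longleftrightarrow> k \<in> mod_hom R (P n) (Y n) \<and>
    (\<forall>p\<in>carrier (P (Suc n)). k (d n p) \<in> d' n ` carrier (Y (Suc n))) \<and>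
    (n = 0 \<longrightarrow> (\<forall>p\<in>carrier (P 0). e' (k p) = f (e p)))" for n k
  define J where "J n k k' \<longleftrightarrow> (\<forall>p\<in>carrier (P (Suc n)). d' n (k' p) = k (d n p))" for n k k'
  have "\<exists>\<phi>. \<forall>n. I n (\<phi> n) \<and> J n (\<phi> n) (\<phi> (Suc n))"
  proof (rule dependent_nat_choice)
    obtain k where k: "k \<in> mod_hom R (P 0) (Y 0)"
      "\<forall>p\<in>carrier (P 0). e' (k p) = compose (carrier (P 0)) f e p"
      using projective_lift[OF P(1) YD(2,3) YD(5) mod_hom_compose[OF Pm d(2) f]]
        mod_homD(1)[OF f] mod_homD(1)[OF d(2)] YD(8) by (auto simp: compose_eq)
    have "k (d 0 p) \<in> d' 0 ` carrier (Y (Suc 0))" if p: "p \<in> carrier (P (Suc 0))" for p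
    proof (rule YD(9))
      show "k (d 0 p) \<in> carrier (Y 0)" using mod_homD(1)[OF k(1)] mod_homD(1)[OF d(1)] p by simp
      show "e' (k (d 0 p)) = \<zero>\<^bsub>M'\<^esub>"
        using k(2) mod_homD(1)[OF d(1) p] dd(2)[OF p] mod_hom_zero[OF P(3) YD(3) f]
        by (simp add: compose_eq)
    qed
    then show "\<exists>k. I 0 k" using k by (auto simp: I_def compose_eq)
  next
    fix k n assume "I n k"
    then have k: "k \<in> mod_hom R (P n) (Y n)"
      "\<And>p. p\<in>carrier (P (Suc n)) \<Longrightarrow> k (d n p) \<in> d' n ` carrier (Y (Suc n))"
      by (auto simp: I_def)
    obtain k' where k': "k' \<in> mod_hom R (P (Suc n)) (Y (Suc n))"
      "\<forall>p\<in>carrier (P (Suc n)). d' n (k' p) = compose (carrier (P (Suc n))) k (d n) p"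
      using projective_lift[OF P(1) YD(2,2) YD(4) mod_hom_compose[OF Pm d(1) k(1)]] k(2)
      by (auto simp: compose_eq)
    have "k' (d (Suc n) p) \<in> d' (Suc n) ` carrier (Y (Suc (Suc n)))"
      if p: "p \<in> carrier (P (Suc (Suc n)))" for p
    proof (rule YD(10))
      show "k' (d (Suc n) p) \<in> carrier (Y (Suc n))"
        using mod_homD(1)[OF k'(1)] mod_homD(1)[OF d(1)] p by simp
      show "d' n (k' (d (Suc n) p)) = \<zero>\<^bsub>Y n\<^esub>"
        using k'(2) mod_homD(1)[OF d(1) p] dd(1)[OF p] mod_hom_zero[OF Pm YD(2) k(1)]
        by (simp add: compose_eq)
    qed
    then show "\<exists>k'. I (Suc n) k' \<and> J n k k'"
      using k' by (auto simp: I_def J_def compose_eq)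
  qed
  then obtain \<phi> where "\<And>n. I n (\<phi> n)" "\<And>n. J n (\<phi> n) (\<phi> (Suc n))" by blast
  then show ?thesis by (intro exI[of _ \<phi>]) (simp add: chain_map_def I_def J_def)
qed

lemma null_homotopy:
  assumes P: "\<And>n. projective R (P n)" "chain_complex R P d"
    and Y: "resolution R Y d' M' e'"
    and \<psi>: "chain_map R P d Y d' \<psi>" "\<And>p. p \<in> carrier (P 0) \<Longrightarrow> e' (\<psi> 0 p) = \<zero>\<^bsub>M'\<^esub>"
  shows "\<exists>h. (\<forall>n. h n \<in> mod_hom R (P n) (Y (Suc n))) \<and>
    (\<forall>p\<in>carrier (P 0). \<psi> 0 p = d' 0 (h 0 p)) \<and>
    (\<forall>n. \<forall>p\<in>carrier (P (Suc n)). \<psi> (Suc n) p = d' (Suc n) (h (Suc n) p) \<oplus>\<^bsub>Y (Suc n)\<^esub> h n (d n p))"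
proof -
  note YD = resolutionD[OF Y] and PD = chain_complexD[OF P(2)]
  have \<psi>h: "\<psi> n \<in> mod_hom R (P n) (Y n)"
    and \<psi>d: "p \<in> carrier (P (Suc n)) \<Longrightarrow> d' n (\<psi> (Suc n) p) = \<psi> n (d n p)" for n p
    using \<psi>(1) by (auto simp: chain_map_def)
  \<comment> \<open>\<open>I\<close> says that \<psi> - k d in degree n + 1 is a cycle, hence a
    boundary by exactness. Lifting it through the differential gives the next term of the homotopy,
    as recorded by \<open>J\<close>.\<close>
  define I where "I n k \<longleftrightarrow> k \<in> mod_hom R (P n) (Y (Suc n)) \<and>
    (\<forall>p\<in>carrier (P (Suc n)). d' n (\<psi> (Suc n) p) = d' n (k (d n p))) \<and>
    (n = 0 \<longrightarrow> (\<forall>p\<in>carrier (P 0). \<psi> 0 p = d' 0 (k p)))" for n k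
  define J where "J n k k' \<longleftrightarrow>
    (\<forall>p\<in>carrier (P (Suc n)). \<psi> (Suc n) p = d' (Suc n) (k' p) \<oplus>\<^bsub>Y (Suc n)\<^esub> k (d n p))" for n k k'
  have "\<exists>h. \<forall>n. I n (h n) \<and> J n (h n) (h (Suc n))"
  proof (rule dependent_nat_choice)
    have im: "\<psi> 0 p \<in> d' 0 ` carrier (Y (Suc 0))" if "p \<in> carrier (P 0)" for p
      using YD(9)[OF mod_homD(1)[OF \<psi>h that]] \<psi>(2)[OF that] by simp
    obtain k where k: "k \<in> mod_hom R (P 0) (Y (Suc 0))" "\<forall>p\<in>carrier (P 0). d' 0 (k p) = \<psi> 0 p"
      using projective_lift[OF P(1) YD(2,2) YD(4) \<psi>h im] by blast
    then show "\<exists>k. I 0 k"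
      using \<psi>d mod_homD(1)[OF PD(2)] by (auto simp: I_def)
  next
    fix k n assume "I n k"
    then have k: "k \<in> mod_hom R (P n) (Y (Suc n))"
      "\<And>p. p\<in>carrier (P (Suc n)) \<Longrightarrow> d' n (\<psi> (Suc n) p) = d' n (k (d n p))"
      by (auto simp: I_def)
    interpret Y: module R "Y (Suc n)" by (rule YD(2))
    interpret Y0: module R "Y n" by (rule YD(2))
    let ?t = "\<lambda>p\<in>carrier (P (Suc n)). \<psi> (Suc n) p \<ominus>\<^bsub>Y (Suc n)\<^esub> compose (carrier (P (Suc n))) k (d n) p"
    have t: "?t \<in> mod_hom R (P (Suc n)) (Y (Suc n))"
      by (rule mod_hom_minus[OF PD(1) YD(2) \<psi>h mod_hom_compose[OF PD(1,2) k(1)]])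
    have c: "\<psi> (Suc n) p \<in> carrier (Y (Suc n))" "k (d n p) \<in> carrier (Y (Suc n))"
      if "p \<in> carrier (P (Suc n))" for p
      using mod_homD(1)[OF \<psi>h that] mod_homD(1)[OF k(1)] mod_homD(1)[OF PD(2) that] by auto
    have im: "?t p \<in> d' (Suc n) ` carrier (Y (Suc (Suc n)))" if p: "p \<in> carrier (P (Suc n))" for p
    proof (rule YD(10)[OF mod_homD(1)[OF t p]])
      have "d' n (\<psi> (Suc n) p \<ominus>\<^bsub>Y (Suc n)\<^esub> k (d n p)) = \<zero>\<^bsub>Y n\<^esub>"
        using c[OF p] k(2)[OF p] mod_homD(1)[OF YD(4)]
        by (simp add: mod_hom_diff[OF YD(2,2) YD(4)] Y0.minus_eq_zero_iff)
      then show "d' n (?t p) = \<zero>\<^bsub>Y n\<^esub>" using p by (simp add: compose_eq)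
    qed
    obtain k' where k': "k' \<in> mod_hom R (P (Suc n)) (Y (Suc (Suc n)))"
      "\<forall>p\<in>carrier (P (Suc n)). d' (Suc n) (k' p) = ?t p"
      using projective_lift[OF P(1) YD(2,2) YD(4) t im] by blast
    have eq: "\<psi> (Suc n) p = d' (Suc n) (k' p) \<oplus>\<^bsub>Y (Suc n)\<^esub> k (d n p)" if p: "p \<in> carrier (P (Suc n))" for p
      using k'(2) p c[OF p] by (simp add: compose_eq a_minus_def Y.a_assoc Y.l_neg)
    have "d' (Suc n) (\<psi> (Suc (Suc n)) p) = d' (Suc n) (k' (d (Suc n) p))"
      if p: "p \<in> carrier (P (Suc (Suc n)))" for p
    proof -
      have dp: "d (Suc n) p \<in> carrier (P (Suc n))" by (rule mod_homD(1)[OF PD(2) p])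
      have "\<psi> (Suc n) (d (Suc n) p) = d' (Suc n) (k' (d (Suc n) p))"
        using eq[OF dp] PD(3)[OF p] mod_hom_zero[OF PD(1) YD(2) k(1)]
          mod_homD(1)[OF YD(4) mod_homD(1)[OF k'(1) dp]] by simp
      then show ?thesis using \<psi>d[OF p] by simp
    qed
    then show "\<exists>k'. I (Suc n) k' \<and> J n k k'"
      using k'(1) eq by (auto simp: I_def J_def)
  qed
  then obtain h where "\<And>n. I n (h n)" "\<And>n. J n (h n) (h (Suc n))" by blast
  then show ?thesis by (intro exI[of _ h]) (simp add: I_def J_def)
qed

section \<open>Cocycles, coboundaries and criteria for isomorphic cohomology\<close>

definition cocycles ::
  "[('a, _) ring_scheme, nat \<Rightarrow> ('a, 'x, _) module_scheme, nat \<Rightarrow> 'x \<Rightarrow> 'x,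
    ('a, 'b, _) module_scheme, nat] \<Rightarrow> ('x \<Rightarrow> 'b) set"
  where "cocycles R X d N i =
    {f \<in> mod_hom R (X i) N. \<forall>x\<in>carrier (X (Suc i)). f (d i x) = \<zero>\<^bsub>N\<^esub>}"

definition coboundaries ::
  "[('a, _) ring_scheme, nat \<Rightarrow> ('a, 'x, _) module_scheme, nat \<Rightarrow> 'x \<Rightarrow> 'x,
    ('a, 'b, _) module_scheme, nat] \<Rightarrow> ('x \<Rightarrow> 'b) set"
  where "coboundaries R X d N i =
    {f \<in> mod_hom R (X i) N. case i of 0 \<Rightarrow> \<forall>x\<in>carrier (X i). f x = \<zero>\<^bsub>N\<^esub>
       | Suc j \<Rightarrow> \<exists>g\<in>mod_hom R (X j) N. \<forall>x\<in>carrier (X i). f x = g (d j x)}"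

lemma coboundaries_0:
  "f \<in> coboundaries R X d N 0 \<longleftrightarrow> f \<in> mod_hom R (X 0) N \<and> (\<forall>x\<in>carrier (X 0). f x = \<zero>\<^bsub>N\<^esub>)"
  by (simp add: coboundaries_def)

lemma coboundaries_Suc:
  "f \<in> coboundaries R X d N (Suc j) \<longleftrightarrow> f \<in> mod_hom R (X (Suc j)) N \<and>
    (\<exists>g\<in>mod_hom R (X j) N. \<forall>x\<in>carrier (X (Suc j)). f x = g (d j x))"
  by (simp add: coboundaries_def)

text \<open>Coboundaries have to be a submodule of the module of cocycles, not just of all cochains,
  before the quotient can be formed.\<close>

lemma submodule_of_submodule:
  assumes "module R M" "submodule Z R M" "submodule H R M" "H \<subseteq> Z"
  shows "submodule H R (M\<lparr>carrier := Z\<rparr>)"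
proof -
  interpret M: module R M by fact
  have Z: "module R (M\<lparr>carrier := Z\<rparr>)" by (rule submodule.submodule_is_module[OF assms(2,1)])
  show ?thesis
    by (rule module.module_incl_imp_submodule[OF Z])
      (use assms(4) submodule.submodule_is_module[OF assms(3,1)] in simp_all)
qed

context
  fixes R :: "('a, 'r) ring_scheme" and X :: "nat \<Rightarrow> ('a, 'x, 'm) module_scheme"
    and d :: "nat \<Rightarrow> 'x \<Rightarrow> 'x" and N :: "('a, 'n, 'l) module_scheme"
  assumes X: "chain_complex R X d" and N: "module R N"
begin

interpretation N: module R N by (rule N)

lemmas XD = chain_complexD[OF X]

lemma coboundary_map_hom:
  "(\<lambda>f\<in>mod_hom R (X n) N. compose (carrier (X (Suc n))) f (d n))
    \<in> mod_hom R (hom_mod R (X n) N) (hom_mod R (X (Suc n)) N)"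
proof -
  interpret Xn: module R "X n" by (rule XD)
  have "(\<lambda>f\<in>carrier (hom_mod R (X n) N). compose (carrier (X (Suc n))) f (d n))
    \<in> mod_hom R (hom_mod R (X n) N) (hom_mod R (X (Suc n)) N)"
    by (rule mod_homI[OF module_hom_mod[OF XD(1) N]])
      (auto simp: hom_mod_simps mod_hom_compose[OF XD(1,2)] compose_eq mod_homD(1)[OF XD(2)]
        intro!: extensionalityI[of _ "carrier (X (Suc n))"])
  then show ?thesis by (simp only: hom_mod_simps(1))
qed

lemma cocycles_kernel:
  "cocycles R X d N i = {f \<in> carrier (hom_mod R (X i) N).
     (\<lambda>f\<in>mod_hom R (X i) N. compose (carrier (X (Suc i))) f (d i)) f = \<zero>\<^bsub>hom_mod R (X (Suc i)) N\<^esub>}"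
  by (auto simp: cocycles_def hom_mod_simps compose_def fun_eq_iff restrict_def)

lemma submodule_cocycles: "submodule (cocycles R X d N i) R (hom_mod R (X i) N)"
  unfolding cocycles_kernel
  by (rule submodule_kernel[OF module_hom_mod[OF XD(1) N] module_hom_mod[OF XD(1) N] coboundary_map_hom])

lemma coboundaries_0_eq: "coboundaries R X d N 0 = {\<zero>\<^bsub>hom_mod R (X 0) N\<^esub>}"
  using mod_hom_const_zero[OF XD(1) N]
  by (auto simp: coboundaries_0 hom_mod_simps intro: mod_hom_ext)

lemma coboundaries_Suc_eq:
  "coboundaries R X d N (Suc j) =
    (\<lambda>f\<in>mod_hom R (X j) N. compose (carrier (X (Suc j))) f (d j)) ` carrier (hom_mod R (X j) N)"
proof -
  have eq: "f = compose (carrier (X (Suc j))) g (d j)"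
    if "f \<in> mod_hom R (X (Suc j)) N" "g \<in> mod_hom R (X j) N" "\<forall>x\<in>carrier (X (Suc j)). f x = g (d j x)" for f g
    by (rule mod_hom_ext[OF that(1) mod_hom_compose[OF XD(1,2) that(2)]]) (simp add: compose_eq that(3))
  have mem: "compose (carrier (X (Suc j))) g (d j) \<in> coboundaries R X d N (Suc j)"
    if "g \<in> mod_hom R (X j) N" for g
    using mod_hom_compose[OF XD(1,2) that] that by (auto simp: coboundaries_Suc compose_eq)
  have "coboundaries R X d N (Suc j) =
      (\<lambda>f. compose (carrier (X (Suc j))) f (d j)) ` mod_hom R (X j) N" (is "?B = ?I")
  proof (intro equalityI subsetI)
    fix f assume "f \<in> ?B"
    then obtain g where "f \<in> mod_hom R (X (Suc j)) N" "g \<in> mod_hom R (X j) N"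
      "\<forall>x\<in>carrier (X (Suc j)). f x = g (d j x)"
      by (auto simp: coboundaries_Suc)
    then show "f \<in> ?I" using eq by blast
  next
    fix f assume "f \<in> ?I"
    then show "f \<in> ?B" using mem by auto
  qed
  then show ?thesis by (simp add: hom_mod_simps(1))
qed

lemma submodule_coboundaries: "submodule (coboundaries R X d N i) R (hom_mod R (X i) N)"
proof (cases i)
  case 0
  then show ?thesis
    using submodule_zero[OF module_hom_mod[OF XD(1) N]] by (simp add: coboundaries_0_eq)
next
  case (Suc j)
  then show ?thesis
    using submodule_image[OF module_hom_mod[OF XD(1) N] module_hom_mod[OF XD(1) N] coboundary_map_hom]
    by (simp add: coboundaries_Suc_eq)
qed

lemma coboundaries_cocycles: "coboundaries R X d N i \<subseteq> cocycles R X d N i"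
proof (cases i)
  case 0
  then show ?thesis
    using mod_homD(1)[OF XD(2)] by (auto simp: coboundaries_0 cocycles_def)
next
  case (Suc j)
  have "f (d i x) = \<zero>\<^bsub>N\<^esub>" if f: "f \<in> coboundaries R X d N i" and x: "x \<in> carrier (X (Suc i))" for f x
  proof -
    obtain g where g: "g \<in> mod_hom R (X j) N" "\<forall>y\<in>carrier (X (Suc j)). f y = g (d j y)"
      using f Suc by (auto simp: coboundaries_Suc)
    have "f (d i x) = g (d j (d (Suc j) x))"
      using g(2) mod_homD(1)[OF XD(2)] x Suc by simp
    also have "\<dots> = \<zero>\<^bsub>N\<^esub>"
      using XD(3) x Suc mod_hom_zero[OF XD(1) N g(1)] by simp
    finally show ?thesis .
  qed
  then show ?thesis by (auto simp: cocycles_def coboundaries_def)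
qed

text \<open>\<open>hom_cohomology\<close> is phrased with \<open>compose\<close> and the zero
  function. In terms of \<open>cocycles\<close> and \<open>coboundaries\<close> all later arguments
  become pointwise conditions.\<close>

lemma hom_cohomology_eq:
  "hom_cohomology R X d N i =
    quot_mod ((hom_mod R (X i) N)\<lparr>carrier := cocycles R X d N i\<rparr>) (coboundaries R X d N i)"
proof -
  have "cocycles R X d N i =
      {f \<in> carrier (hom_mod R (X i) N). compose (carrier (X (Suc i))) f (d i) = \<zero>\<^bsub>hom_mod R (X (Suc i)) N\<^esub>}"
    by (auto simp: cocycles_kernel hom_mod_simps(1))
  moreover have "coboundaries R X d N i = (case i of 0 \<Rightarrow> {\<zero>\<^bsub>hom_mod R (X 0) N\<^esub>} |
      Suc j \<Rightarrow> (\<lambda>f. compose (carrier (X (Suc j))) f (d j)) ` carrier (hom_mod R (X j) N))"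
    by (cases i) (auto simp: coboundaries_0_eq coboundaries_Suc_eq hom_mod_simps(1))
  ultimately show ?thesis
    by (simp add: hom_cohomology_def cohomology_def)
qed

lemma module_cocycles: "module R ((hom_mod R (X i) N)\<lparr>carrier := cocycles R X d N i\<rparr>)"
  by (rule submodule.submodule_is_module[OF submodule_cocycles module_hom_mod[OF XD(1) N]])

lemma coboundaries_submodule_cocycles:
  "submodule (coboundaries R X d N i) R ((hom_mod R (X i) N)\<lparr>carrier := cocycles R X d N i\<rparr>)"
  by (rule submodule_of_submodule[OF module_hom_mod[OF XD(1) N] submodule_cocycles
        submodule_coboundaries coboundaries_cocycles])

lemma module_hom_cohomology: "module R (hom_cohomology R X d N i)"
  unfolding hom_cohomology_eq
  by (rule module_quot_mod[OF module_cocycles coboundaries_submodule_cocycles])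

lemma hom_cohomology_zero_iff:
  "zero_mod (hom_cohomology R X d N i) \<longleftrightarrow> cocycles R X d N i \<subseteq> coboundaries R X d N i"
  unfolding hom_cohomology_eq
  using quot_mod_zero_iff[OF module_cocycles coboundaries_submodule_cocycles] by simp

end

lemma coboundaries_add:
  assumes "chain_complex R X d" "module R N"
    and "f \<in> coboundaries R X d N i" "g \<in> coboundaries R X d N i"
  shows "(\<lambda>x\<in>carrier (X i). f x \<oplus>\<^bsub>N\<^esub> g x) \<in> coboundaries R X d N i"
proof -
  interpret H: module R "hom_mod R (X i) N"
    by (rule module_hom_mod[OF chain_complexD(1)[OF assms(1)] assms(2)])
  show ?thesis
    using H.submoduleE(5)[OF submodule_coboundaries[OF assms(1,2)] assms(3,4)]
    by (simp add: hom_mod_simps)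
qed

lemma coboundaries_cong:
  assumes "f \<in> coboundaries R X d N i" "g \<in> mod_hom R (X i) N"
    "\<And>x. x \<in> carrier (X i) \<Longrightarrow> g x = f x"
  shows "g \<in> coboundaries R X d N i"
  using assms by (cases i) (auto simp: coboundaries_0 coboundaries_Suc)

text \<open>Types, coefficient modules and degrees may all differ on the two sides, so that one
  criterion serves the adjunction, where N becomes Hom(C, N), and dimension shifting, where the
  degree changes.\<close>

lemma hom_cohomology_isoI:
  assumes X: "chain_complex R X d" and X': "chain_complex R X' d'"
    and N: "module R N" and N': "module R N'"
    and cyc: "\<And>f. f \<in> cocycles R X d N i \<Longrightarrow> F f \<in> cocycles R X' d' N' j"
    and add: "\<And>f g x. f \<in> cocycles R X d N i \<Longrightarrow> g \<in> cocycles R X d N i \<Longrightarrow> x \<in> carrier (X' j) \<Longrightarrow>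
      F (\<lambda>y\<in>carrier (X i). f y \<oplus>\<^bsub>N\<^esub> g y) x = F f x \<oplus>\<^bsub>N'\<^esub> F g x"
    and smult: "\<And>a f x. a \<in> carrier R \<Longrightarrow> f \<in> cocycles R X d N i \<Longrightarrow> x \<in> carrier (X' j) \<Longrightarrow>
      F (\<lambda>y\<in>carrier (X i). a \<odot>\<^bsub>N\<^esub> f y) x = a \<odot>\<^bsub>N'\<^esub> F f x"
    and cob: "\<And>f. f \<in> coboundaries R X d N i \<Longrightarrow> F f \<in> coboundaries R X' d' N' j"
    and inj: "\<And>f. f \<in> cocycles R X d N i \<Longrightarrow> F f \<in> coboundaries R X' d' N' j \<Longrightarrow>
      f \<in> coboundaries R X d N i"
    and surj: "\<And>g. g \<in> cocycles R X' d' N' j \<Longrightarrow> \<exists>f\<in>cocycles R X d N i.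
      \<exists>b\<in>coboundaries R X' d' N' j. \<forall>x\<in>carrier (X' j). g x = F f x \<oplus>\<^bsub>N'\<^esub> b x"
  shows "mod_isomorphic R (hom_cohomology R X d N i) (hom_cohomology R X' d' N' j)"
proof -
  let ?Z = "(hom_mod R (X i) N)\<lparr>carrier := cocycles R X d N i\<rparr>"
  let ?Z' = "(hom_mod R (X' j) N')\<lparr>carrier := cocycles R X' d' N' j\<rparr>"
  note mZ = module_cocycles[OF X N, of i] and mZ' = module_cocycles[OF X' N', of j]
  note sB = coboundaries_submodule_cocycles[OF X N, of i]
    and sB' = coboundaries_submodule_cocycles[OF X' N', of j]
  interpret Z: module R ?Z by (rule mZ)
  interpret Z': module R ?Z' by (rule mZ')
  have zh: "f \<in> mod_hom R (X' j) N'" if "f \<in> cocycles R X' d' N' j" for f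
    using that by (simp add: cocycles_def)
  have ext: "f = (\<lambda>x\<in>carrier (X' j). h x)"
    if "f \<in> cocycles R X' d' N' j" "\<And>x. x \<in> carrier (X' j) \<Longrightarrow> f x = h x" for f h
    using mod_hom_extensional[OF zh[OF that(1)]] that(2) by (metis (no_types, lifting) restrict_ext)
  have "(\<lambda>f\<in>carrier ?Z. F f) \<in> mod_hom R ?Z ?Z'"
  proof (rule mod_homI[OF mZ])
    fix f g assume fg: "f \<in> carrier ?Z" "g \<in> carrier ?Z"
    then have "f \<oplus>\<^bsub>?Z\<^esub> g \<in> carrier ?Z" by (rule Z.a_closed)
    then have "F (f \<oplus>\<^bsub>?Z\<^esub> g) = (\<lambda>x\<in>carrier (X' j). F f x \<oplus>\<^bsub>N'\<^esub> F g x)"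
      using fg by (intro ext) (simp_all add: cyc hom_mod_simps add)
    then show "F (f \<oplus>\<^bsub>?Z\<^esub> g) = F f \<oplus>\<^bsub>?Z'\<^esub> F g" by (simp add: hom_mod_simps)
  next
    fix a f assume af: "a \<in> carrier R" "f \<in> carrier ?Z"
    then have "a \<odot>\<^bsub>?Z\<^esub> f \<in> carrier ?Z" by (rule Z.smult_closed)
    then have "F (a \<odot>\<^bsub>?Z\<^esub> f) = (\<lambda>x\<in>carrier (X' j). a \<odot>\<^bsub>N'\<^esub> F f x)"
      using af by (intro ext) (simp_all add: cyc hom_mod_simps smult)
    then show "F (a \<odot>\<^bsub>?Z\<^esub> f) = a \<odot>\<^bsub>?Z'\<^esub> F f" by (simp add: hom_mod_simps)
  qed (simp add: cyc)
  then show ?thesis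
    unfolding hom_cohomology_eq[OF X N] hom_cohomology_eq[OF X' N']
  proof (rule quot_mod_isomorphicI[OF mZ sB mZ' sB'])
    fix f assume f: "f \<in> carrier ?Z"
    then show "(\<lambda>f\<in>carrier ?Z. F f) f \<in> coboundaries R X' d' N' j \<longleftrightarrow> f \<in> coboundaries R X d N i"
      using inj cob by auto
  next
    fix g assume g: "g \<in> carrier ?Z'"
    then obtain f b where f: "f \<in> cocycles R X d N i" and b: "b \<in> coboundaries R X' d' N' j"
      and eq: "\<forall>x\<in>carrier (X' j). g x = F f x \<oplus>\<^bsub>N'\<^esub> b x"
      using surj[of g] by auto
    have c: "F f \<in> carrier ?Z'" "b \<in> carrier ?Z'"
      using cyc[OF f] b coboundaries_cocycles[OF X' N'] by auto
    have "g = (\<lambda>x\<in>carrier (X' j). F f x \<oplus>\<^bsub>N'\<^esub> b x)"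
      using g eq by (intro ext) simp_all
    then have "g = F f \<oplus>\<^bsub>?Z'\<^esub> b" by (simp add: hom_mod_simps)
    then have "g \<ominus>\<^bsub>?Z'\<^esub> F f = b"
      using c by (simp only: a_minus_def Z'.a_comm[of "F f" b] Z'.a_assoc Z'.r_neg Z'.a_inv_closed Z'.r_zero)
    then show "\<exists>f\<in>carrier ?Z. g \<ominus>\<^bsub>?Z'\<^esub> (\<lambda>f\<in>carrier ?Z. F f) f \<in> coboundaries R X' d' N' j"
      using f b by (intro bexI[of _ f]) simp_all
  qed
qed

text \<open>Here \<phi> is a homomorphism in a single degree instead of a chain map. The projection
  from the mapping cone changes the degree and commutes with the differentials only up to sign, so
  each use checks its compatibilities itself.\<close>

lemma hom_cohomology_pullback_isoI:
  assumes X: "chain_complex R X d" and X': "chain_complex R X' d'" and N: "module R N"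
    and \<phi>: "\<phi> \<in> mod_hom R (X' j) (X i)"
    and cyc: "\<And>f x. f \<in> cocycles R X d N i \<Longrightarrow> x \<in> carrier (X' (Suc j)) \<Longrightarrow> f (\<phi> (d' j x)) = \<zero>\<^bsub>N\<^esub>"
    and cob: "\<And>f. f \<in> coboundaries R X d N i \<Longrightarrow>
      compose (carrier (X' j)) f \<phi> \<in> coboundaries R X' d' N j"
    and inj: "\<And>f. f \<in> cocycles R X d N i \<Longrightarrow>
      compose (carrier (X' j)) f \<phi> \<in> coboundaries R X' d' N j \<Longrightarrow> f \<in> coboundaries R X d N i"
    and surj: "\<And>g. g \<in> cocycles R X' d' N j \<Longrightarrow> \<exists>f\<in>cocycles R X d N i.
      \<exists>b\<in>coboundaries R X' d' N j. \<forall>x\<in>carrier (X' j). g x = f (\<phi> x) \<oplus>\<^bsub>N\<^esub> b x"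
  shows "mod_isomorphic R (hom_cohomology R X d N i) (hom_cohomology R X' d' N j)"
proof (rule hom_cohomology_isoI[OF X X' N N, where F = "\<lambda>f. compose (carrier (X' j)) f \<phi>"])
  note XD' = chain_complexD[OF X']
  fix f assume f: "f \<in> cocycles R X d N i"
  then have "compose (carrier (X' j)) f \<phi> \<in> mod_hom R (X' j) N"
    by (intro mod_hom_compose[OF XD'(1) \<phi>]) (simp add: cocycles_def)
  then show "compose (carrier (X' j)) f \<phi> \<in> cocycles R X' d' N j"
    using cyc[OF f] mod_homD(1)[OF XD'(2)] by (simp add: cocycles_def compose_eq)
qed (use cob inj surj mod_homD(1)[OF \<phi>] in \<open>simp_all add: compose_eq\<close>)

section \<open>Homotopy invariance and independence of the chosen resolution\<close>

lemma chain_map_id: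
  assumes "chain_complex R X d"
  shows "chain_map R X d X d (\<lambda>n. \<lambda>x\<in>carrier (X n). x)"
  using mod_hom_id[OF chain_complexD(1)[OF assms]] mod_homD(1)[OF chain_complexD(2)[OF assms]]
  by (simp add: chain_map_def)

lemma chain_map_compose:
  assumes "chain_complex R X d" "chain_map R X d Y d' \<phi>" "chain_map R Y d' Z d'' \<psi>"
  shows "chain_map R X d Z d'' (\<lambda>n. compose (carrier (X n)) (\<psi> n) (\<phi> n))"
proof -
  note XD = chain_complexD[OF assms(1)]
  have \<phi>: "\<phi> n \<in> mod_hom R (X n) (Y n)" "x \<in> carrier (X (Suc n)) \<Longrightarrow> d' n (\<phi> (Suc n) x) = \<phi> n (d n x)"
    and \<psi>: "\<psi> n \<in> mod_hom R (Y n) (Z n)" "y \<in> carrier (Y (Suc n)) \<Longrightarrow> d'' n (\<psi> (Suc n) y) = \<psi> n (d' n y)"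
    for n x y
    using assms(2,3) by (auto simp: chain_map_def)
  then show ?thesis
    using mod_hom_compose[OF XD(1) \<phi>(1) \<psi>(1)] mod_homD(1)[OF \<phi>(1)] mod_homD(1)[OF XD(2)]
    by (simp add: chain_map_def compose_eq)
qed

lemma chain_map_minus:
  assumes X: "chain_complex R X d" and Y: "chain_complex R Y d'"
    and "chain_map R X d Y d' \<phi>" "chain_map R X d Y d' \<psi>"
  shows "chain_map R X d Y d' (\<lambda>n. \<lambda>x\<in>carrier (X n). \<phi> n x \<ominus>\<^bsub>Y n\<^esub> \<psi> n x)"
proof -
  note XD = chain_complexD[OF X] and YD = chain_complexD[OF Y]
  have \<phi>: "\<phi> n \<in> mod_hom R (X n) (Y n)" "x \<in> carrier (X (Suc n)) \<Longrightarrow> d' n (\<phi> (Suc n) x) = \<phi> n (d n x)"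
    and \<psi>: "\<psi> n \<in> mod_hom R (X n) (Y n)" "x \<in> carrier (X (Suc n)) \<Longrightarrow> d' n (\<psi> (Suc n) x) = \<psi> n (d n x)"
    for n x
    using assms(3,4) by (auto simp: chain_map_def)
  show ?thesis
    unfolding chain_map_def
  proof (intro conjI allI ballI)
    show "(\<lambda>x\<in>carrier (X n). \<phi> n x \<ominus>\<^bsub>Y n\<^esub> \<psi> n x) \<in> mod_hom R (X n) (Y n)" for n
      by (rule mod_hom_minus[OF XD(1) YD(1) \<phi>(1) \<psi>(1)])
    show "d' n ((\<lambda>x\<in>carrier (X (Suc n)). \<phi> (Suc n) x \<ominus>\<^bsub>Y (Suc n)\<^esub> \<psi> (Suc n) x) x) =
        (\<lambda>x\<in>carrier (X n). \<phi> n x \<ominus>\<^bsub>Y n\<^esub> \<psi> n x) (d n x)" if "x \<in> carrier (X (Suc n))" for n x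
      using that \<phi> \<psi> mod_homD(1)[OF XD(2)] mod_homD(1)[OF \<phi>(1)] mod_homD(1)[OF \<psi>(1)]
      by (simp add: mod_hom_diff[OF YD(1) YD(1) YD(2)])
  qed
qed

lemma chain_map_cocycle:
  assumes X: "chain_complex R X d" and "chain_map R X d Y d' \<phi>"
    and "f \<in> cocycles R Y d' N i"
  shows "compose (carrier (X i)) f (\<phi> i) \<in> cocycles R X d N i"
proof -
  note XD = chain_complexD[OF X]
  have \<phi>: "\<phi> n \<in> mod_hom R (X n) (Y n)" "x \<in> carrier (X (Suc n)) \<Longrightarrow> \<phi> n (d n x) = d' n (\<phi> (Suc n) x)" for n x
    using assms(2) by (auto simp: chain_map_def)
  have "f \<in> mod_hom R (Y i) N" using assms(3) by (simp add: cocycles_def)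
  then show ?thesis
    using assms(3) mod_hom_compose[OF XD(1) \<phi>(1), of f i N] \<phi>(2) mod_homD(1)[OF XD(2)] mod_homD(1)[OF \<phi>(1)]
    by (simp add: cocycles_def compose_eq)
qed

lemma chain_map_coboundary:
  assumes X: "chain_complex R X d" and "chain_map R X d Y d' \<phi>"
    and f: "f \<in> coboundaries R Y d' N i"
  shows "compose (carrier (X i)) f (\<phi> i) \<in> coboundaries R X d N i"
proof -
  note XD = chain_complexD[OF X]
  have \<phi>: "\<phi> n \<in> mod_hom R (X n) (Y n)" "x \<in> carrier (X (Suc n)) \<Longrightarrow> d' n (\<phi> (Suc n) x) = \<phi> n (d n x)" for n x
    using assms(2) by (auto simp: chain_map_def)
  have fh: "compose (carrier (X i)) f (\<phi> i) \<in> mod_hom R (X i) N"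
    by (rule mod_hom_compose[OF XD(1) \<phi>(1)]) (use f in \<open>simp add: coboundaries_def\<close>)
  show ?thesis
  proof (cases i)
    case 0
    then show ?thesis
      using f fh mod_homD(1)[OF \<phi>(1)] by (simp add: coboundaries_0 compose_eq)
  next
    case (Suc j)
    then obtain g where "f \<in> mod_hom R (Y (Suc j)) N" and g: "g \<in> mod_hom R (Y j) N"
      "\<forall>x\<in>carrier (Y (Suc j)). f x = g (d' j x)"
      using f by (auto simp: coboundaries_Suc)
    then show ?thesis
      using Suc fh mod_hom_compose[OF XD(1) \<phi>(1) g(1)] mod_homD(1)[OF \<phi>(1)] \<phi>(2) mod_homD(1)[OF XD(2)]
      by (auto simp: coboundaries_Suc compose_eq intro!: bexI[of _ "compose (carrier (X j)) g (\<phi> j)"])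
  qed
qed

text \<open>The difference of the identity and u lifts zero, so it has the form d h + h d. A cocycle
  f kills the first term and f h d is a coboundary, so f is cohomologous to its pullback along
  u.\<close>

lemma cocycle_homotopic_id:
  assumes P: "projective_resolution R M P d e" and M: "module R M" and N: "module R N"
    and u: "chain_map R P d P d u" "\<And>p. p \<in> carrier (P 0) \<Longrightarrow> e (u 0 p) = e p"
    and f: "f \<in> cocycles R P d N i"
  shows "\<exists>b\<in>coboundaries R P d N i. \<forall>x\<in>carrier (P i). f x = f (u i x) \<oplus>\<^bsub>N\<^esub> b x"
proof -
  note res = projective_resolutionD[OF P M]
  note PD = resolutionD[OF res(1)]
  interpret N: module R N by fact
  interpret M: module R M by fact
  let ?\<psi> = "\<lambda>n. \<lambda>x\<in>carrier (P n). (\<lambda>x\<in>carrier (P n). x) x \<ominus>\<^bsub>P n\<^esub> u n x"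
  have \<psi>: "chain_map R P d P d ?\<psi>"
    by (rule chain_map_minus[OF PD(1) PD(1) chain_map_id[OF PD(1)] u(1)])
  have uh: "u n \<in> mod_hom R (P n) (P n)" and \<psi>h: "?\<psi> n \<in> mod_hom R (P n) (P n)" for n
    using u(1) \<psi> unfolding chain_map_def by blast+
  have fh: "f \<in> mod_hom R (P i) N" and fd: "\<And>x. x \<in> carrier (P (Suc i)) \<Longrightarrow> f (d i x) = \<zero>\<^bsub>N\<^esub>"
    using f by (auto simp: cocycles_def)
  have "e (?\<psi> 0 p) = \<zero>\<^bsub>M\<^esub>" if "p \<in> carrier (P 0)" for p
    using that u(2)[OF that] mod_homD(1)[OF uh] mod_homD(1)[OF PD(5)]
    by (simp add: mod_hom_diff[OF PD(2,3,5)] M.minus_eq_zero_iff)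
  then obtain h where h: "\<And>n. h n \<in> mod_hom R (P n) (P (Suc n))"
    "\<And>p. p \<in> carrier (P 0) \<Longrightarrow> ?\<psi> 0 p = d 0 (h 0 p)"
    "\<And>n p. p \<in> carrier (P (Suc n)) \<Longrightarrow> ?\<psi> (Suc n) p = d (Suc n) (h (Suc n) p) \<oplus>\<^bsub>P (Suc n)\<^esub> h n (d n p)"
    using null_homotopy[OF res(2) PD(1) res(1) \<psi>] by blast
  let ?b = "compose (carrier (P i)) f (?\<psi> i)"
  have bh: "?b \<in> mod_hom R (P i) N" by (rule mod_hom_compose[OF PD(2) \<psi>h fh])
  have "?b \<in> coboundaries R P d N i"
  proof (cases i)
    case 0
    \<comment> \<open>In degree 0 the homotopy consists of the term d h alone, so \<open>?b\<close>
      vanishes, as a coboundary in degree 0 must.\<close>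
    have "f (?\<psi> 0 x) = \<zero>\<^bsub>N\<^esub>" if "x \<in> carrier (P 0)" for x
      unfolding h(2)[OF that] using fd mod_homD(1)[OF h(1) that] 0 by simp
    then show ?thesis using bh 0 by (simp only: coboundaries_0) (simp add: compose_eq)
  next
    case (Suc j)
    have "f (?\<psi> (Suc j) x) = compose (carrier (P j)) f (h j) (d j x)" if x: "x \<in> carrier (P (Suc j))" for x
    proof -
      have c: "d j x \<in> carrier (P j)" "h j (d j x) \<in> carrier (P (Suc j))"
        "h (Suc j) x \<in> carrier (P (Suc (Suc j)))" "d (Suc j) (h (Suc j) x) \<in> carrier (P (Suc j))"
        using mod_homD(1)[OF PD(4)] mod_homD(1)[OF h(1)] x by auto
      show ?thesis
        unfolding h(3)[OF x] using c fd Suc mod_homD(1,2)[OF fh] by (simp add: compose_eq)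
    qed
    moreover have "compose (carrier (P j)) f (h j) \<in> mod_hom R (P j) N"
      using mod_hom_compose[OF PD(2) h(1)] fh Suc by simp
    ultimately show ?thesis using bh Suc by (simp only: coboundaries_Suc) (auto simp: compose_eq)
  qed
  moreover have "f x = f (u i x) \<oplus>\<^bsub>N\<^esub> ?b x" if x: "x \<in> carrier (P i)" for x
  proof -
    have "f (x \<ominus>\<^bsub>P i\<^esub> u i x) = f x \<ominus>\<^bsub>N\<^esub> f (u i x)"
      by (rule mod_hom_diff[OF PD(2) N fh x mod_homD(1)[OF uh x]])
    then show ?thesis
      using x mod_homD(1)[OF fh] mod_homD(1)[OF uh]
      by (simp add: compose_eq a_minus_def N.a_lcomm[of "f (u i x)"] N.r_neg)
  qed
  ultimately show ?thesis by blast
qed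

text \<open>The identity of M lifts to chain maps k and g in both directions, and both composites
  lift the identity again, so \<open>cocycle_homotopic_id\<close> applies to each. As P and P' may
  have different types, Ext is freed from the type in which its resolution is chosen.\<close>

lemma projective_resolution_cohomology_iso:
  assumes P: "projective_resolution R M P d e" and P': "projective_resolution R M P' d' e'"
    and M: "module R M" and N: "module R N"
  shows "mod_isomorphic R (hom_cohomology R P d N i) (hom_cohomology R P' d' N i)"
proof -
  note res = projective_resolutionD[OF P M] and res' = projective_resolutionD[OF P' M]
  note PD = resolutionD[OF res(1)] and PD' = resolutionD[OF res'(1)]
  have aug: "aug_complex R P d M e" "aug_complex R P' d' M e'"
    using P P' by (auto simp: projective_resolution_def)
  obtain k where k: "chain_map R P d P' d' k"
    "\<And>p. p \<in> carrier (P 0) \<Longrightarrow> e' (k 0 p) = (\<lambda>x\<in>carrier M. x) (e p)"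
    using chain_map_lift[OF res(2) aug(1) M res'(1) mod_hom_id[OF M]] by blast
  obtain g where g: "chain_map R P' d' P d g"
    "\<And>p. p \<in> carrier (P' 0) \<Longrightarrow> e (g 0 p) = (\<lambda>x\<in>carrier M. x) (e' p)"
    using chain_map_lift[OF res'(2) aug(2) M res(1) mod_hom_id[OF M]] by blast
  have kh: "k n \<in> mod_hom R (P n) (P' n)" and gh: "g n \<in> mod_hom R (P' n) (P n)" for n
    using k g by (auto simp: chain_map_def)
  note kg = chain_map_compose[OF PD(1) k(1) g(1)] and gk = chain_map_compose[OF PD'(1) g(1) k(1)]
  have ekg: "e (compose (carrier (P 0)) (g 0) (k 0) p) = e p" if "p \<in> carrier (P 0)" for p
    using that k(2) g(2) mod_homD(1)[OF kh] mod_homD(1)[OF PD(5)] by (simp add: compose_eq)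
  have egk: "e' (compose (carrier (P' 0)) (k 0) (g 0) p) = e' p" if "p \<in> carrier (P' 0)" for p
    using that k(2) g(2) mod_homD(1)[OF gh] mod_homD(1)[OF PD'(5)] by (simp add: compose_eq)
  show ?thesis
  proof (rule hom_cohomology_pullback_isoI[OF PD(1) PD'(1) N gh])
    fix f x assume f: "f \<in> cocycles R P d N i" and x: "x \<in> carrier (P' (Suc i))"
    show "f (g i (d' i x)) = \<zero>\<^bsub>N\<^esub>"
      using chain_map_cocycle[OF PD'(1) g(1) f] x mod_homD(1)[OF PD'(4)]
      by (simp add: cocycles_def compose_eq)
  next
    fix f assume "f \<in> coboundaries R P d N i"
    then show "compose (carrier (P' i)) f (g i) \<in> coboundaries R P' d' N i"
      by (rule chain_map_coboundary[OF PD'(1) g(1)])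
  next
    fix f assume f: "f \<in> cocycles R P d N i"
      and fg: "compose (carrier (P' i)) f (g i) \<in> coboundaries R P' d' N i"
    note c = chain_map_coboundary[OF PD(1) k(1) fg]
    from cocycle_homotopic_id[where u = "\<lambda>n. compose (carrier (P n)) (g n) (k n)", OF P M N kg ekg f]
    obtain b where b: "b \<in> coboundaries R P d N i"
      "\<forall>x\<in>carrier (P i). f x = f (compose (carrier (P i)) (g i) (k i) x) \<oplus>\<^bsub>N\<^esub> b x"
      by (rule bexE)
    show "f \<in> coboundaries R P d N i"
      by (rule coboundaries_cong[OF coboundaries_add[OF PD(1) N c b(1)]])
        (use f b(2) mod_homD(1)[OF kh] in \<open>auto simp: cocycles_def compose_eq\<close>)
  next
    fix f assume f: "f \<in> cocycles R P' d' N i"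
    from cocycle_homotopic_id[where u = "\<lambda>n. compose (carrier (P' n)) (k n) (g n)", OF P' M N gk egk f]
    obtain b where b: "b \<in> coboundaries R P' d' N i"
      "\<forall>x\<in>carrier (P' i). f x = f (compose (carrier (P' i)) (k i) (g i) x) \<oplus>\<^bsub>N\<^esub> b x"
      by (rule bexE)
    show "\<exists>h\<in>cocycles R P d N i. \<exists>b\<in>coboundaries R P' d' N i. \<forall>x\<in>carrier (P' i). f x = h (g i x) \<oplus>\<^bsub>N\<^esub> b x"
      by (rule bexI[OF _ chain_map_cocycle[OF PD(1) k(1) f]], rule bexI[OF _ b(1)])
        (use b(2) mod_homD(1)[OF gh] in \<open>simp add: compose_eq\<close>)
  qed
qed

text \<open>The choice inside \<open>Ext\<close> depends neither on N nor on the degree, so one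
  resolution serves them all.\<close>

lemma Ext_resolution:
  fixes M :: "('a, 'b, 'm) module_scheme"
  assumes "module R M"
  obtains P :: "nat \<Rightarrow> ('a, ('a, 'b) res) module" and d e
  where "projective_resolution R M P d e"
    "\<And>(N :: ('a, 'd, 'n) module_scheme) i. Ext R M N i = hom_cohomology R P d N i"
proof -
  let ?S = "SOME (P, d, e). projective_resolution R M (P :: nat \<Rightarrow> ('a, ('a, 'b) res) module) d e"
  obtain P d e where P: "?S = (P, d, e)" by (cases ?S)
  have "\<exists>S. case S of (P :: nat \<Rightarrow> ('a, ('a, 'b) res) module, d, e) \<Rightarrow> projective_resolution R M P d e"
    using ex_projective_resolution[OF assms] by auto
  then have "case ?S of (P, d, e) \<Rightarrow> projective_resolution R M P d e" by (rule someI_ex)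
  then have "projective_resolution R M P d e" by (simp add: P)
  then show thesis by (rule that) (simp add: Ext_def P)
qed

lemma Ext_iso:
  fixes M :: "('a, 'b, 'm) module_scheme"
  assumes "projective_resolution R M P d e" "module R M" "module R N"
  shows "mod_isomorphic R (hom_cohomology R P d N i) (Ext R M N i)"
    and "mod_isomorphic R (Ext R M N i) (hom_cohomology R P d N i)"
proof -
  obtain P' :: "nat \<Rightarrow> ('a, ('a, 'b) res) module" and d' e' where
    P': "projective_resolution R M P' d' e'" "Ext R M N i = hom_cohomology R P' d' N i"
    by (rule Ext_resolution[OF assms(2)]) blast
  show "mod_isomorphic R (hom_cohomology R P d N i) (Ext R M N i)"
    "mod_isomorphic R (Ext R M N i) (hom_cohomology R P d N i)"
    unfolding P'(2) by (rule projective_resolution_cohomology_iso; fact assms P'(1))+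
qed

lemma module_Ext:
  fixes M :: "('a, 'b, 'm) module_scheme"
  assumes "module R M" "module R N"
  shows "module R (Ext R M N i)"
proof -
  obtain P :: "nat \<Rightarrow> ('a, ('a, 'b) res) module" and d e where
    P: "projective_resolution R M P d e" "Ext R M N i = hom_cohomology R P d N i"
    by (rule Ext_resolution[OF assms(1)]) blast
  show ?thesis
    unfolding P(2)
    by (rule module_hom_cohomology[OF resolutionD(1)[OF projective_resolutionD(1)[OF P(1) assms(1)]] assms(2)])
qed

section \<open>The mapping cone and dimension shifting\<close>

lemma (in abelian_group) a_inv_zero: "\<ominus> \<zero> = \<zero>"
  using minus_equality[of \<zero> \<zero>] by simp

definition prod_mod ::
  "[('a, 'p, _) module_scheme, ('a, 'q, _) module_scheme] \<Rightarrow> ('a, 'p \<times> 'q) module"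
  where "prod_mod M N =
    \<lparr>carrier = carrier M \<times> carrier N, mult = undefined, one = undefined,
     zero = (\<zero>\<^bsub>M\<^esub>, \<zero>\<^bsub>N\<^esub>), add = (\<lambda>x y. (fst x \<oplus>\<^bsub>M\<^esub> fst y, snd x \<oplus>\<^bsub>N\<^esub> snd y)),
     smult = (\<lambda>a x. (a \<odot>\<^bsub>M\<^esub> fst x, a \<odot>\<^bsub>N\<^esub> snd x))\<rparr>"

lemma prod_mod_simps [simp]:
  "carrier (prod_mod M N) = carrier M \<times> carrier N"
  "\<zero>\<^bsub>prod_mod M N\<^esub> = (\<zero>\<^bsub>M\<^esub>, \<zero>\<^bsub>N\<^esub>)"
  "x \<oplus>\<^bsub>prod_mod M N\<^esub> y = (fst x \<oplus>\<^bsub>M\<^esub> fst y, snd x \<oplus>\<^bsub>N\<^esub> snd y)"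
  "a \<odot>\<^bsub>prod_mod M N\<^esub> x = (a \<odot>\<^bsub>M\<^esub> fst x, a \<odot>\<^bsub>N\<^esub> snd x)"
  by (simp_all add: prod_mod_def)

lemma module_prod_mod:
  assumes "module R M" "module R N"
  shows "module R (prod_mod M N)"
proof -
  interpret M: module R M by fact
  interpret N: module R N by fact
  show ?thesis
  proof (rule moduleI[OF M.R.is_cring])
    show "abelian_group (prod_mod M N)"
    proof (rule abelian_groupI)
      fix x assume "x \<in> carrier (prod_mod M N)"
      then show "\<exists>y\<in>carrier (prod_mod M N). y \<oplus>\<^bsub>prod_mod M N\<^esub> x = \<zero>\<^bsub>prod_mod M N\<^esub>"
        by (intro bexI[of _ "(\<ominus>\<^bsub>M\<^esub> fst x, \<ominus>\<^bsub>N\<^esub> snd x)"]) (auto simp: M.l_neg N.l_neg)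
    qed (auto simp: M.a_ac N.a_ac)
  qed (auto simp: M.smult_l_distr M.smult_r_distr M.smult_assoc1
      N.smult_l_distr N.smult_r_distr N.smult_assoc1)
qed

text \<open>The two coordinate inclusions lift to the free cover of the product, and the sum of the
  lifts splits the cover.\<close>

lemma projective_prod_mod:
  assumes "projective R P" "projective R Q"
  shows "projective R (prod_mod P Q)"
proof -
  have P: "module R P" and Q: "module R Q" using assms by (simp_all add: projective_module)
  interpret P: module R P by (rule P)
  interpret Q: module R Q by (rule Q)
  let ?PQ = "prod_mod P Q"
  have PQ: "module R ?PQ" by (rule module_prod_mod[OF P Q])
  define F c where "F = free_mod R (carrier ?PQ)" and "c = free_lift R (carrier ?PQ) ?PQ (\<lambda>x. x)"
  have F: "module R F" unfolding F_def by (rule module_free_mod[OF P.R.is_cring])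
  interpret F: module R F by (rule F)
  note c = free_cover[OF PQ, folded F_def c_def]
  have i: "(\<lambda>p\<in>carrier P. (p, \<zero>\<^bsub>Q\<^esub>)) \<in> mod_hom R P ?PQ"
    by (rule mod_homI[OF P]) auto
  have j: "(\<lambda>q\<in>carrier Q. (\<zero>\<^bsub>P\<^esub>, q)) \<in> mod_hom R Q ?PQ"
    by (rule mod_homI[OF Q]) auto
  obtain k where k: "k \<in> mod_hom R P F" "\<forall>p\<in>carrier P. c (k p) = (\<lambda>p\<in>carrier P. (p, \<zero>\<^bsub>Q\<^esub>)) p"
    using projective_lift[OF assms(1) F PQ c(1) i] c(2) by auto
  obtain l where l: "l \<in> mod_hom R Q F" "\<forall>q\<in>carrier Q. c (l q) = (\<lambda>q\<in>carrier Q. (\<zero>\<^bsub>P\<^esub>, q)) q"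
    using projective_lift[OF assms(2) F PQ c(1) j] c(2) by auto
  show ?thesis
  proof (rule projectiveI[OF PQ, folded F_def c_def])
    show "(\<lambda>x\<in>carrier ?PQ. k (fst x) \<oplus>\<^bsub>F\<^esub> l (snd x)) \<in> mod_hom R ?PQ F"
      by (rule mod_homI[OF PQ])
        (auto simp: mod_homD[OF k(1)] mod_homD[OF l(1)] F.a_ac F.smult_r_distr)
    show "c ((\<lambda>x\<in>carrier ?PQ. k (fst x) \<oplus>\<^bsub>F\<^esub> l (snd x)) x) = x" if "x \<in> carrier ?PQ" for x
      using that k(2) l(2) mod_homD(1)[OF k(1)] mod_homD(1)[OF l(1)]
      by (auto simp: mod_homD(2)[OF c(1)])
  qed
qed

text \<open>This covers the zero module that fills the second factor of the mapping cone in degree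
  0.\<close>

lemma projective_trivial:
  assumes "module R P" "carrier P = {\<zero>\<^bsub>P\<^esub>}"
  shows "projective R P"
proof -
  interpret P: module R P by fact
  have F: "module R (free_mod R (carrier P))" by (rule module_free_mod[OF P.R.is_cring])
  show ?thesis
    by (rule projectiveI[OF assms(1) mod_hom_const_zero[OF assms(1) F]])
      (use assms(2) mod_hom_zero[OF F assms(1) free_cover(1)[OF assms(1)]] in auto)
qed

text \<open>Since e presents M as a quotient of P, a map that vanishes on the kernel of e descends.
  In this form left exactness of Hom turns a cocycle in degree 0 into a map on the resolved
  module.\<close>

lemma surjective_factor:
  assumes "module R P" "module R M" "module R N" "e \<in> mod_hom R P M" "e ` carrier P = carrier M"
    and f: "f \<in> mod_hom R P N" and ker: "\<And>p. p \<in> carrier P \<Longrightarrow> e p = \<zero>\<^bsub>M\<^esub> \<Longrightarrow> f p = \<zero>\<^bsub>N\<^esub>"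
  shows "\<exists>h\<in>mod_hom R M N. \<forall>p\<in>carrier P. h (e p) = f p"
proof -
  interpret P: module R P by fact
  interpret M: module R M by fact
  interpret N: module R N by fact
  note eD = mod_homD[OF assms(4)] and fD = mod_homD[OF f]
  have "\<forall>x\<in>carrier M. \<exists>p\<in>carrier P. e p = x" using assms(5) by (metis imageE)
  then obtain s where s: "\<And>x. x \<in> carrier M \<Longrightarrow> s x \<in> carrier P" "\<And>x. x \<in> carrier M \<Longrightarrow> e (s x) = x"
    by metis
  have eq: "f p = f q" if "p \<in> carrier P" "q \<in> carrier P" "e p = e q" for p q
  proof -
    have "f (p \<ominus>\<^bsub>P\<^esub> q) = \<zero>\<^bsub>N\<^esub>"
      by (rule ker) (use that eD in \<open>simp_all add: mod_hom_diff[OF assms(1,2,4)] M.minus_eq_zero_iff\<close>)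
    then show ?thesis
      using that fD by (simp add: mod_hom_diff[OF assms(1,3) f] N.minus_eq_zero_iff)
  qed
  have "(\<lambda>x\<in>carrier M. f (s x)) \<in> mod_hom R M N"
  proof (rule mod_homI[OF assms(2)])
    show "f (s (x \<oplus>\<^bsub>M\<^esub> y)) = f (s x) \<oplus>\<^bsub>N\<^esub> f (s y)" if "x \<in> carrier M" "y \<in> carrier M" for x y
      using that s eD fD eq[of "s (x \<oplus>\<^bsub>M\<^esub> y)" "s x \<oplus>\<^bsub>P\<^esub> s y"] by simp
    show "f (s (a \<odot>\<^bsub>M\<^esub> x)) = a \<odot>\<^bsub>N\<^esub> f (s x)" if "a \<in> carrier R" "x \<in> carrier M" for a x
      using that s eD fD eq[of "s (a \<odot>\<^bsub>M\<^esub> x)" "a \<odot>\<^bsub>P\<^esub> s x"] by simp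
  qed (use s fD in simp)
  moreover have "f (s (e p)) = f p" if "p \<in> carrier P" for p
    using that s eD by (intro eq) simp_all
  ultimately show ?thesis using eD by (intro bexI) auto
qed

text \<open>
  In degree \<open>0\<close> the second factor is the zero submodule of \<open>F 0\<close>, so that all degrees live in the
  same type.
\<close>

definition cone_mod ::
  "(nat \<Rightarrow> ('a, 'p) module) \<Rightarrow> (nat \<Rightarrow> ('a, 'q) module) \<Rightarrow> nat \<Rightarrow> ('a, 'p \<times> 'q) module"
  where "cone_mod G F n =
    prod_mod (G n) (case n of 0 \<Rightarrow> (F 0)\<lparr>carrier := {\<zero>\<^bsub>F 0\<^esub>}\<rparr> | Suc k \<Rightarrow> F k)"

text \<open>The minus sign makes the mixed terms dG g and g dF cancel in the square of the
  differential.\<close>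

definition cone_diff ::
  "[nat \<Rightarrow> ('a, 'p) module, nat \<Rightarrow> 'p \<Rightarrow> 'p, nat \<Rightarrow> ('a, 'q) module, nat \<Rightarrow> 'q \<Rightarrow> 'q,
    nat \<Rightarrow> 'q \<Rightarrow> 'p, nat] \<Rightarrow> 'p \<times> 'q \<Rightarrow> 'p \<times> 'q"
  where "cone_diff G dG F dF g n = (\<lambda>x\<in>carrier (cone_mod G F (Suc n)).
    (dG n (fst x) \<oplus>\<^bsub>G n\<^esub> g n (snd x), case n of 0 \<Rightarrow> \<zero>\<^bsub>F 0\<^esub> | Suc k \<Rightarrow> \<ominus>\<^bsub>F k\<^esub> dF k (snd x)))"

lemma cone_carrier_0: "carrier (cone_mod G F 0) = carrier (G 0) \<times> {\<zero>\<^bsub>F 0\<^esub>}"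
  and cone_carrier_Suc: "carrier (cone_mod G F (Suc n)) = carrier (G (Suc n)) \<times> carrier (F n)"
  by (simp_all add: cone_mod_def)

text \<open>
  For a short exact sequence \<open>0 \<rightarrow> K \<rightarrow> A \<rightarrow> M \<rightarrow> 0\<close>, a lift \<open>g\<close> of the inclusion to projective
  resolutions \<open>F\<close> of \<open>K\<close> and \<open>G\<close> of \<open>A\<close> has a mapping cone that resolves \<open>M\<close>. Comparing the
  cohomology of the cone with that of \<open>F\<close> replaces the long exact sequence of Ext.
\<close>

locale mapping_cone =
  fixes R :: "('a, 'r) ring_scheme" and A :: "('a, 'x, 'm) module_scheme"
    and M :: "('a, 'b, 'k) module_scheme" and \<pi> :: "'x \<Rightarrow> 'b"
    and F :: "nat \<Rightarrow> ('a, 'q) module" and dF eF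
    and G :: "nat \<Rightarrow> ('a, 'p) module" and dG eG and g :: "nat \<Rightarrow> 'q \<Rightarrow> 'p"
  assumes A: "module R A" and M: "module R M"
    and \<pi>: "\<pi> \<in> mod_hom R A M" "\<pi> ` carrier A = carrier M"
    and F: "projective_resolution R (A\<lparr>carrier := {x \<in> carrier A. \<pi> x = \<zero>\<^bsub>M\<^esub>}\<rparr>) F dF eF"
    and G: "projective_resolution R A G dG eG"
    and g: "chain_map R F dF G dG g" "\<And>b. b \<in> carrier (F 0) \<Longrightarrow> eG (g 0 b) = eF b"
begin

abbreviation (input) "Ker \<equiv> A\<lparr>carrier := {x \<in> carrier A. \<pi> x = \<zero>\<^bsub>M\<^esub>}\<rparr>"

lemma module_Ker: "module R Ker"
  by (rule submodule.submodule_is_module[OF submodule_kernel[OF A M \<pi>(1)] A])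

lemmas GR = projective_resolutionD[OF G A]
lemmas FR = projective_resolutionD[OF F module_Ker]
lemmas GD = resolutionD[OF GR(1)]
lemmas FD = resolutionD[OF FR(1)]

interpretation A: module R A by (rule A)
interpretation M: module R M by (rule M)
interpretation G: module R "G n" for n by (rule GD(2))
interpretation F: module R "F n" for n by (rule FD(2))

lemma gh: "g n \<in> mod_hom R (F n) (G n)" and gd: "b \<in> carrier (F (Suc n)) \<Longrightarrow> g n (dF n b) = dG n (g (Suc n) b)"
  using g(1) by (auto simp: chain_map_def)

lemmas gD = mod_homD[OF gh]
lemmas dGD = mod_homD[OF GD(4)]
lemmas dFD = mod_homD[OF FD(4)]

lemma eGD: "a \<in> carrier (G 0) \<Longrightarrow> eG a \<in> carrier A"
  "a \<in> carrier (G 0) \<Longrightarrow> a' \<in> carrier (G 0) \<Longrightarrow> eG (a \<oplus>\<^bsub>G 0\<^esub> a') = eG a \<oplus>\<^bsub>A\<^esub> eG a'"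
  "c \<in> carrier R \<Longrightarrow> a \<in> carrier (G 0) \<Longrightarrow> eG (c \<odot>\<^bsub>G 0\<^esub> a) = c \<odot>\<^bsub>A\<^esub> eG a"
  using mod_homD[OF GD(5)] by auto

lemma eFD: "b \<in> carrier (F 0) \<Longrightarrow> eF b \<in> carrier A" "b \<in> carrier (F 0) \<Longrightarrow> \<pi> (eF b) = \<zero>\<^bsub>M\<^esub>"
  "y \<in> carrier (F (Suc 0)) \<Longrightarrow> eF (dF 0 y) = \<zero>\<^bsub>A\<^esub>"
  using mod_homD(1)[OF FD(5)] FD(7) by auto

lemma projective_cone: "projective R (cone_mod G F n)"
proof (cases n)
  case 0
  have "module R ((F 0)\<lparr>carrier := {\<zero>\<^bsub>F 0\<^esub>}\<rparr>)"
    by (rule submodule.submodule_is_module[OF submodule_zero[OF FD(2)] FD(2)])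
  then have "projective R ((F 0)\<lparr>carrier := {\<zero>\<^bsub>F 0\<^esub>}\<rparr>)"
    by (rule projective_trivial) simp
  then show ?thesis using 0 by (simp add: cone_mod_def projective_prod_mod GR(2))
next
  case (Suc k)
  then show ?thesis by (simp add: cone_mod_def projective_prod_mod GR(2) FR(2))
qed

lemmas module_cone = projective_module[OF projective_cone]

lemma cone_diff_hom: "cone_diff G dG F dF g n \<in> mod_hom R (cone_mod G F (Suc n)) (cone_mod G F n)"
  unfolding cone_diff_def
  by (rule mod_homI[OF module_cone]; cases n)
    (auto simp: cone_mod_def dGD gD dFD G.a_ac G.smult_r_distr F.minus_add F.smult_r_minus
      split: nat.splits)

lemma cone_diff_apply:
  assumes "a \<in> carrier (G (Suc n))" "b \<in> carrier (F n)"
  shows "cone_diff G dG F dF g n (a, b) =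
    (dG n a \<oplus>\<^bsub>G n\<^esub> g n b, case n of 0 \<Rightarrow> \<zero>\<^bsub>F 0\<^esub> | Suc k \<Rightarrow> \<ominus>\<^bsub>F k\<^esub> dF k b)"
  using assms by (simp add: cone_diff_def cone_carrier_Suc split: nat.split)

lemma g_minus_d: "b \<in> carrier (F (Suc n)) \<Longrightarrow>
    dG n (g (Suc n) b) \<oplus>\<^bsub>G n\<^esub> g n (\<ominus>\<^bsub>F n\<^esub> dF n b) = \<zero>\<^bsub>G n\<^esub>"
  using mod_hom_a_inv[OF FD(2) GD(2) gh] dFD(1) gD(1) dGD(1) gd by (simp add: G.r_neg)

lemma cone_diff_diff:
  assumes "x \<in> carrier (cone_mod G F (Suc (Suc n)))"
  shows "cone_diff G dG F dF g n (cone_diff G dG F dF g (Suc n) x) = \<zero>\<^bsub>cone_mod G F n\<^esub>"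
proof -
  obtain a b where x: "x = (a, b)" "a \<in> carrier (G (Suc (Suc n)))" "b \<in> carrier (F (Suc n))"
    using assms by (auto simp: cone_carrier_Suc)
  have "dG n (dG (Suc n) a \<oplus>\<^bsub>G (Suc n)\<^esub> g (Suc n) b) = dG n (g (Suc n) b)"
    using x dGD gD GD(6) by simp
  then have fst: "dG n (dG (Suc n) a \<oplus>\<^bsub>G (Suc n)\<^esub> g (Suc n) b) \<oplus>\<^bsub>G n\<^esub> g n (\<ominus>\<^bsub>F n\<^esub> dF n b) = \<zero>\<^bsub>G n\<^esub>"
    using g_minus_d x by simp
  show ?thesis
  proof (cases n)
    case 0
    then show ?thesis using x dGD gD dFD fst by (simp add: cone_diff_apply cone_mod_def)
  next
    case (Suc k)
    then have "dF k (\<ominus>\<^bsub>F (Suc k)\<^esub> dF (Suc k) b) = \<zero>\<^bsub>F k\<^esub>"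
      using x dFD FD(6) mod_hom_a_inv[OF FD(2,2) FD(4)] F.a_inv_zero by simp
    then show ?thesis
      using Suc x dGD gD dFD fst F.a_inv_zero
      by (simp add: cone_diff_apply cone_mod_def)
  qed
qed

abbreviation (input) "cone_aug \<equiv> (\<lambda>x\<in>carrier (cone_mod G F 0). \<pi> (eG (fst x)))"

lemma cone_aug_hom: "cone_aug \<in> mod_hom R (cone_mod G F 0) M"
  by (rule mod_homI[OF module_cone])
    (auto simp: cone_mod_def eGD mod_homD[OF \<pi>(1)])

text \<open>In positive degree the second component of a cycle is a boundary in F; in degree 0 an
  element b with eF b = eG a is chosen instead. What then remains of the first component is killed
  by dG or eG, hence is a boundary in G.\<close>

lemma cone_resolution:
  "projective_resolution R M (cone_mod G F) (cone_diff G dG F dF g) cone_aug"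
proof -
  let ?D = "cone_diff G dG F dF g"
  \<comment> \<open>Once the second component u is fixed, exactness of G is applied to a - g u;
    adding g u back gives the first component of a differential.\<close>
  have lift: "\<exists>a'\<in>carrier (G (Suc n)). \<exists>b'\<in>carrier (F n). a = dG n a' \<oplus>\<^bsub>G n\<^esub> g n b' \<and> u = b'"
    if au: "a \<in> carrier (G n)" "u \<in> carrier (F n)" and im: "a \<ominus>\<^bsub>G n\<^esub> g n u \<in> dG n ` carrier (G (Suc n))"
    for n a u
  proof -
    obtain a' where a': "a' \<in> carrier (G (Suc n))" "a \<ominus>\<^bsub>G n\<^esub> g n u = dG n a'" using im by auto
    have "a = (a \<ominus>\<^bsub>G n\<^esub> g n u) \<oplus>\<^bsub>G n\<^esub> g n u"
      using au gD(1) by (simp add: a_minus_def G.a_assoc G.l_neg)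
    then show ?thesis using a' au by auto
  qed
  have aug0: "cone_aug (?D 0 x) = \<zero>\<^bsub>M\<^esub>" if xc: "x \<in> carrier (cone_mod G F (Suc 0))" for x
  proof -
    obtain a b where x: "x = (a, b)" "a \<in> carrier (G (Suc 0))" "b \<in> carrier (F 0)"
      using xc by (auto simp: cone_carrier_Suc)
    then show ?thesis
      using eGD dGD gD GD(7) g(2) eFD by (simp add: cone_diff_apply cone_carrier_0)
  qed
  have surj: "cone_aug ` carrier (cone_mod G F 0) = carrier M"
  proof -
    have "cone_aug ` carrier (cone_mod G F 0) = \<pi> ` eG ` carrier (G 0)"
      by (force simp: cone_carrier_0)
    then show ?thesis using GD(8) \<pi>(2) by simp
  qed
  have ex0: "x \<in> ?D 0 ` carrier (cone_mod G F (Suc 0))"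
    if xc: "x \<in> carrier (cone_mod G F 0)" "cone_aug x = \<zero>\<^bsub>M\<^esub>" for x
  proof -
    obtain a where x: "x = (a, \<zero>\<^bsub>F 0\<^esub>)" "a \<in> carrier (G 0)" "\<pi> (eG a) = \<zero>\<^bsub>M\<^esub>"
      using xc by (auto simp: cone_carrier_0)
    then have "eG a \<in> carrier Ker" using eGD by simp
    then have "eG a \<in> eF ` carrier (F 0)" unfolding FD(8) .
    then obtain b where b: "b \<in> carrier (F 0)" "eG a = eF b" by (rule imageE) auto
    have "a \<ominus>\<^bsub>G 0\<^esub> g 0 b \<in> dG 0 ` carrier (G (Suc 0))"
    proof (rule GD(9))
      have gb: "g 0 b \<in> carrier (G 0)" by (rule gD(1)[OF b(1)])
      then show "a \<ominus>\<^bsub>G 0\<^esub> g 0 b \<in> carrier (G 0)" using x(2) by simp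
      have "eG (a \<ominus>\<^bsub>G 0\<^esub> g 0 b) = eG a \<ominus>\<^bsub>A\<^esub> eG (g 0 b)"
        by (rule mod_hom_diff[OF GD(2) A GD(5) x(2) gb])
      also have "\<dots> = \<zero>\<^bsub>A\<^esub>"
        using b(2) g(2)[OF b(1)] eFD(1)[OF b(1)] by (simp add: A.minus_eq_zero_iff)
      finally show "eG (a \<ominus>\<^bsub>G 0\<^esub> g 0 b) = \<zero>\<^bsub>A\<^esub>" .
    qed
    from lift[OF x(2) b(1) this] show ?thesis
      unfolding x(1) by (force simp: cone_carrier_Suc cone_diff_apply image_iff)
  qed
  have ex: "x \<in> ?D (Suc n) ` carrier (cone_mod G F (Suc (Suc n)))"
    if xc: "x \<in> carrier (cone_mod G F (Suc n))" "?D n x = \<zero>\<^bsub>cone_mod G F n\<^esub>" for n x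
  proof -
    obtain a b where x: "x = (a, b)" "a \<in> carrier (G (Suc n))" "b \<in> carrier (F n)"
      using xc(1) by (auto simp: cone_carrier_Suc)
    have z: "dG n a \<oplus>\<^bsub>G n\<^esub> g n b = \<zero>\<^bsub>G n\<^esub>" using xc(2) x by (simp add: cone_diff_apply cone_mod_def)
    have "b \<in> dF n ` carrier (F (Suc n))"
    proof (cases n)
      case 0
      \<comment> \<open>In degree 1 the second component of the differential is constantly zero and
        says nothing about b. The augmentation supplies the missing condition: eG kills dG 0 a and
        sends g 0 b to eF b.\<close>
      then have "eG (dG 0 a \<oplus>\<^bsub>G 0\<^esub> g 0 b) = \<zero>\<^bsub>A\<^esub>"
        using z mod_hom_zero[OF GD(2) A GD(5)] by simp
      then have "eF b = \<zero>\<^bsub>A\<^esub>"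
        using 0 x dGD gD eGD GD(7) g(2) eFD by simp
      then show ?thesis using FD(9) x 0 by simp
    next
      case (Suc k)
      then have "\<ominus>\<^bsub>F k\<^esub> dF k b = \<zero>\<^bsub>F k\<^esub>" using xc(2) x by (simp add: cone_diff_apply cone_mod_def)
      then have "dF k b = \<zero>\<^bsub>F k\<^esub>"
        using F.minus_minus F.a_inv_zero dFD(1) x Suc by metis
      then show ?thesis using FD(10) x Suc by simp
    qed
    then obtain b' where b': "b' \<in> carrier (F (Suc n))" "b = dF n b'" by auto
    \<comment> \<open>The preimage gets the second component - b', because the differential negates
      dF and must return b = dF n b'.\<close>
    have gb: "g (Suc n) (\<ominus>\<^bsub>F (Suc n)\<^esub> b') = \<ominus>\<^bsub>G (Suc n)\<^esub> g (Suc n) b'"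
      by (rule mod_hom_a_inv[OF FD(2) GD(2) gh b'(1)])
    have "dG n (a \<ominus>\<^bsub>G (Suc n)\<^esub> g (Suc n) (\<ominus>\<^bsub>F (Suc n)\<^esub> b')) = \<zero>\<^bsub>G n\<^esub>"
      using z x b' gD dGD gd by (simp add: gb a_minus_def G.minus_minus)
    then have "a \<ominus>\<^bsub>G (Suc n)\<^esub> g (Suc n) (\<ominus>\<^bsub>F (Suc n)\<^esub> b') \<in> dG (Suc n) ` carrier (G (Suc (Suc n)))"
      using x b' gD by (intro GD(10)) simp_all
    from lift[OF x(2) _ this] obtain a' where a': "a' \<in> carrier (G (Suc (Suc n)))"
      "a = dG (Suc n) a' \<oplus>\<^bsub>G (Suc n)\<^esub> g (Suc n) (\<ominus>\<^bsub>F (Suc n)\<^esub> b')"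
      using b' by auto
    have "?D (Suc n) (a', \<ominus>\<^bsub>F (Suc n)\<^esub> b') = x"
      using a' b' x(1) dFD
      by (simp add: cone_diff_apply mod_hom_a_inv[OF FD(2,2) FD(4)] F.minus_minus)
    then show ?thesis
      using a' b' by (intro image_eqI[of _ _ "(a', \<ominus>\<^bsub>F (Suc n)\<^esub> b')"]) (simp_all add: cone_carrier_Suc)
  qed
  have aug: "aug_complex R (cone_mod G F) ?D M cone_aug"
    unfolding aug_complex_def using cone_diff_hom cone_aug_hom cone_diff_diff aug0 by blast
  moreover have "aug_exact (cone_mod G F) ?D M cone_aug"
    unfolding aug_exact_def
  proof (intro conjI allI equalityI subsetI)
    fix x assume "x \<in> ?D 0 ` carrier (cone_mod G F (Suc 0))"
    then show "x \<in> {x \<in> carrier (cone_mod G F 0). cone_aug x = \<zero>\<^bsub>M\<^esub>}"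
      using aug0 mod_homD(1)[OF cone_diff_hom] by (auto simp del: restrict_apply)
  next
    fix n x assume "x \<in> ?D (Suc n) ` carrier (cone_mod G F (Suc (Suc n)))"
    then show "x \<in> {x \<in> carrier (cone_mod G F (Suc n)). ?D n x = \<zero>\<^bsub>cone_mod G F n\<^esub>}"
      using cone_diff_diff mod_homD(1)[OF cone_diff_hom] by auto
  qed (use surj ex0 ex in \<open>simp_all del: restrict_apply\<close>)
  ultimately show ?thesis
    using projective_cone unfolding projective_resolution_def by blast
qed

section \<open>Cohomology of the mapping cone\<close>

abbreviation (input) "K \<equiv> cone_mod G F"
abbreviation (input) "D \<equiv> cone_diff G dG F dF g"

lemma cone_complex: "chain_complex R K D"
  by (rule resolutionD(1)[OF projective_resolutionD(1)[OF cone_resolution M]])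

text \<open>Truncated subtraction picks the right zero in both cases: \<open>F n\<close> sits in
  degree n + 1 of the cone, and the padding in degree 0 is the zero of \<open>F 0\<close>.\<close>

lemma cone_zero_snd: "a \<in> carrier (G n) \<Longrightarrow> (a, \<zero>\<^bsub>F (n - 1)\<^esub>) \<in> carrier (K n)"
  by (cases n) (simp_all add: cone_mod_def)

lemma cone_hom_fst:
  assumes "f \<in> mod_hom R (K n) N"
  shows "(\<lambda>a\<in>carrier (G n). f (a, \<zero>\<^bsub>F (n - 1)\<^esub>)) \<in> mod_hom R (G n) N"
proof (rule mod_homI[OF GD(2)])
  note f = mod_homD[OF assms]
  show "f (a, \<zero>\<^bsub>F (n - 1)\<^esub>) \<in> carrier N" if "a \<in> carrier (G n)" for a
    by (rule f(1)[OF cone_zero_snd[OF that]])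
  show "f (a \<oplus>\<^bsub>G n\<^esub> a', \<zero>\<^bsub>F (n - 1)\<^esub>) = f (a, \<zero>\<^bsub>F (n - 1)\<^esub>) \<oplus>\<^bsub>N\<^esub> f (a', \<zero>\<^bsub>F (n - 1)\<^esub>)"
    if "a \<in> carrier (G n)" "a' \<in> carrier (G n)" for a a'
    using f(2)[OF cone_zero_snd[OF that(1)] cone_zero_snd[OF that(2)]]
    by (cases n) (simp_all add: cone_mod_def)
  show "f (c \<odot>\<^bsub>G n\<^esub> a, \<zero>\<^bsub>F (n - 1)\<^esub>) = c \<odot>\<^bsub>N\<^esub> f (a, \<zero>\<^bsub>F (n - 1)\<^esub>)"
    if "c \<in> carrier R" "a \<in> carrier (G n)" for c a
    using f(3)[OF that(1) cone_zero_snd[OF that(2)]] that by (cases n) (simp_all add: cone_mod_def)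
qed

lemma cone_hom_snd:
  assumes "f \<in> mod_hom R (K (Suc n)) N"
  shows "(\<lambda>b\<in>carrier (F n). f (\<zero>\<^bsub>G (Suc n)\<^esub>, b)) \<in> mod_hom R (F n) N"
proof (rule mod_homI[OF FD(2)])
  note f = mod_homD[OF assms]
  have c: "(\<zero>\<^bsub>G (Suc n)\<^esub>, b) \<in> carrier (K (Suc n))" if "b \<in> carrier (F n)" for b
    using that by (simp add: cone_mod_def)
  show "f (\<zero>\<^bsub>G (Suc n)\<^esub>, b) \<in> carrier N" if "b \<in> carrier (F n)" for b
    by (rule f(1)[OF c[OF that]])
  show "f (\<zero>\<^bsub>G (Suc n)\<^esub>, b \<oplus>\<^bsub>F n\<^esub> b') = f (\<zero>\<^bsub>G (Suc n)\<^esub>, b) \<oplus>\<^bsub>N\<^esub> f (\<zero>\<^bsub>G (Suc n)\<^esub>, b')"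
    if "b \<in> carrier (F n)" "b' \<in> carrier (F n)" for b b'
    using f(2)[OF c[OF that(1)] c[OF that(2)]] by (simp add: cone_mod_def)
  show "f (\<zero>\<^bsub>G (Suc n)\<^esub>, r \<odot>\<^bsub>F n\<^esub> b) = r \<odot>\<^bsub>N\<^esub> f (\<zero>\<^bsub>G (Suc n)\<^esub>, b)"
    if "r \<in> carrier R" "b \<in> carrier (F n)" for r b
    using f(3)[OF that(1) c[OF that(2)]] that by (simp add: cone_mod_def)
qed

lemma cone_hom_split:
  assumes "f \<in> mod_hom R (K (Suc n)) N" "a \<in> carrier (G (Suc n))" "b \<in> carrier (F n)"
  shows "f (a, b) = f (a, \<zero>\<^bsub>F n\<^esub>) \<oplus>\<^bsub>N\<^esub> f (\<zero>\<^bsub>G (Suc n)\<^esub>, b)"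
  using mod_homD(2)[OF assms(1), of "(a, \<zero>\<^bsub>F n\<^esub>)" "(\<zero>\<^bsub>G (Suc n)\<^esub>, b)"] assms(2,3)
  by (simp add: cone_mod_def)

lemma cone_fst_hom:
  assumes "\<beta> \<in> mod_hom R (G n) N"
  shows "(\<lambda>x\<in>carrier (K n). \<beta> (fst x)) \<in> mod_hom R (K n) N"
  by (rule mod_homI[OF module_cone]) (auto simp: cone_mod_def mod_homD[OF assms])

lemma cone_snd_hom:
  assumes "\<kappa> \<in> mod_hom R (F n) N"
  shows "(\<lambda>x\<in>carrier (K (Suc n)). \<kappa> (snd x)) \<in> mod_hom R (K (Suc n)) N"
  by (rule mod_homI[OF module_cone]) (auto simp: cone_mod_def mod_homD[OF assms])

text \<open>Restricted to the first factor, f is a cocycle of G, so acyclicity writes it as \<beta>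
  dG. Subtracting the coboundary of \<beta> composed with the first projection removes this part,
  and what is left depends on the second component alone.\<close>

lemma cone_cocycle_decomp:
  assumes N: "module R N" and ac: "cocycles R G dG N (Suc j) \<subseteq> coboundaries R G dG N (Suc j)"
    and f: "f \<in> cocycles R K D N (Suc j)"
  shows "\<exists>\<kappa>\<in>cocycles R F dF N j. \<exists>c\<in>coboundaries R K D N (Suc j).
    \<forall>x\<in>carrier (K (Suc j)). f x = \<kappa> (snd x) \<oplus>\<^bsub>N\<^esub> c x"
proof -
  interpret N: module R N by (rule N)
  have fh: "f \<in> mod_hom R (K (Suc j)) N"
    and fd: "\<And>x. x \<in> carrier (K (Suc (Suc j))) \<Longrightarrow> f (D (Suc j) x) = \<zero>\<^bsub>N\<^esub>"
    using f by (auto simp: cocycles_def)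
  let ?\<alpha> = "\<lambda>a\<in>carrier (G (Suc j)). f (a, \<zero>\<^bsub>F j\<^esub>)" and ?\<kappa> = "\<lambda>b\<in>carrier (F j). f (\<zero>\<^bsub>G (Suc j)\<^esub>, b)"
  have \<alpha>: "?\<alpha> \<in> mod_hom R (G (Suc j)) N" using cone_hom_fst[OF fh] by simp
  have \<kappa>: "?\<kappa> \<in> mod_hom R (F j) N" by (rule cone_hom_snd[OF fh])
  have "f (dG (Suc j) a, \<zero>\<^bsub>F j\<^esub>) = \<zero>\<^bsub>N\<^esub>" if a: "a \<in> carrier (G (Suc (Suc j)))" for a
    using fd[of "(a, \<zero>\<^bsub>F (Suc j)\<^esub>)"] a dGD(1)[OF a] mod_hom_zero[OF FD(2) GD(2) gh]
      mod_hom_zero[OF FD(2) FD(2) FD(4)]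
    by (simp add: cone_diff_apply cone_carrier_Suc F.a_inv_zero)
  then have "?\<alpha> \<in> cocycles R G dG N (Suc j)" using \<alpha> dGD(1) by (simp add: cocycles_def)
  then obtain \<beta> where \<beta>: "\<beta> \<in> mod_hom R (G j) N" "\<forall>a\<in>carrier (G (Suc j)). ?\<alpha> a = \<beta> (dG j a)"
    using ac by (auto simp: coboundaries_Suc subset_iff simp del: restrict_apply)
  have \<beta>\<alpha>: "\<beta> (dG j a) = f (a, \<zero>\<^bsub>F j\<^esub>)" if "a \<in> carrier (G (Suc j))" for a
    using \<beta>(2) that by simp
  \<comment> \<open>The coboundary subtracted from f sends (a, b) to \<beta> (dG a + g b). Its value
    on the second factor is \<beta> (g b), which explains the correction to
    \<open>?\<kappa>\<close>.\<close>
  let ?k = "\<lambda>b\<in>carrier (F j). ?\<kappa> b \<ominus>\<^bsub>N\<^esub> compose (carrier (F j)) \<beta> (g j) b"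
  have k: "?k \<in> mod_hom R (F j) N"
    by (rule mod_hom_minus[OF FD(2) N \<kappa> mod_hom_compose[OF FD(2) gh \<beta>(1)]])
  have kv: "?k b = f (\<zero>\<^bsub>G (Suc j)\<^esub>, b) \<ominus>\<^bsub>N\<^esub> \<beta> (g j b)" if "b \<in> carrier (F j)" for b
    using that by (simp add: compose_eq)
  have fc: "f (a, b) \<in> carrier N" if "a \<in> carrier (G (Suc j))" "b \<in> carrier (F j)" for a b
    using mod_homD(1)[OF fh] that by (simp add: cone_carrier_Suc)
  have "?k (dF j b) = \<zero>\<^bsub>N\<^esub>" if b: "b \<in> carrier (F (Suc j))" for b
  proof -
    have c: "g (Suc j) b \<in> carrier (G (Suc j))" "dF j b \<in> carrier (F j)"
      "\<ominus>\<^bsub>F j\<^esub> dF j b \<in> carrier (F j)" "g j (dF j b) \<in> carrier (G j)"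
      using b gD(1) dFD(1) by simp_all
    have "f (\<zero>\<^bsub>G (Suc j)\<^esub>, \<ominus>\<^bsub>F j\<^esub> dF j b) = \<ominus>\<^bsub>N\<^esub> f (\<zero>\<^bsub>G (Suc j)\<^esub>, dF j b)"
      using mod_hom_a_inv[OF FD(2) N \<kappa> c(2)] c by simp
    \<comment> \<open>The argument is the differential of (0, b), which links the values of f on the
      two factors.\<close>
    moreover have "f (g (Suc j) b, \<ominus>\<^bsub>F j\<^esub> dF j b) = \<zero>\<^bsub>N\<^esub>"
      using fd[of "(\<zero>\<^bsub>G (Suc (Suc j))\<^esub>, b)"] b c mod_hom_zero[OF GD(2) GD(2) GD(4)]
      by (simp add: cone_diff_apply cone_carrier_Suc)
    ultimately have "f (g (Suc j) b, \<zero>\<^bsub>F j\<^esub>) \<ominus>\<^bsub>N\<^esub> f (\<zero>\<^bsub>G (Suc j)\<^esub>, dF j b) = \<zero>\<^bsub>N\<^esub>"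
      using cone_hom_split[OF fh c(1,3)] by (simp add: a_minus_def)
    then have "f (\<zero>\<^bsub>G (Suc j)\<^esub>, dF j b) = \<beta> (dG j (g (Suc j) b))"
      using fc c by (simp add: N.minus_eq_zero_iff \<beta>\<alpha>)
    then show ?thesis
      using c b mod_homD(1)[OF \<beta>(1)] by (simp add: kv gd N.minus_eq_zero_iff del: restrict_apply)
  qed
  then have "?k \<in> cocycles R F dF N j"
    using k by (simp add: cocycles_def del: restrict_apply)
  moreover
  let ?c = "compose (carrier (K (Suc j))) (\<lambda>x\<in>carrier (K j). \<beta> (fst x)) (D j)"
  have "?c \<in> coboundaries R K D N (Suc j)"
    using mod_hom_compose[OF module_cone cone_diff_hom cone_fst_hom[OF \<beta>(1)]] cone_fst_hom[OF \<beta>(1)]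
    by (auto simp: coboundaries_Suc compose_eq simp del: restrict_apply)
  moreover have "f x = ?k (snd x) \<oplus>\<^bsub>N\<^esub> ?c x" if xc: "x \<in> carrier (K (Suc j))" for x
  proof -
    obtain a b where x: "x = (a, b)" "a \<in> carrier (G (Suc j))" "b \<in> carrier (F j)"
      using xc by (auto simp: cone_carrier_Suc)
    have gb: "g j b \<in> carrier (G j)" and da: "dG j a \<in> carrier (G j)" using x gD(1) dGD(1) by auto
    have "?c x = \<beta> (dG j a \<oplus>\<^bsub>G j\<^esub> g j b)"
      using mod_homD(1)[OF cone_diff_hom xc] x by (simp add: compose_eq cone_carrier_Suc cone_diff_apply)
    also have "\<dots> = f (a, \<zero>\<^bsub>F j\<^esub>) \<oplus>\<^bsub>N\<^esub> \<beta> (g j b)"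
      using x gb da by (simp add: mod_homD(2)[OF \<beta>(1)] \<beta>\<alpha>)
    finally have cx: "?c x = f (a, \<zero>\<^bsub>F j\<^esub>) \<oplus>\<^bsub>N\<^esub> \<beta> (g j b)" .
    have bg: "\<beta> (g j b) \<in> carrier N" by (rule mod_homD(1)[OF \<beta>(1) gb])
    have "?k (snd x) \<oplus>\<^bsub>N\<^esub> ?c x = (f (\<zero>\<^bsub>G (Suc j)\<^esub>, b) \<ominus>\<^bsub>N\<^esub> \<beta> (g j b)) \<oplus>\<^bsub>N\<^esub> (f (a, \<zero>\<^bsub>F j\<^esub>) \<oplus>\<^bsub>N\<^esub> \<beta> (g j b))"
      unfolding cx using x by (simp add: kv del: restrict_apply)
    also have "\<dots> = f (a, \<zero>\<^bsub>F j\<^esub>) \<oplus>\<^bsub>N\<^esub> f (\<zero>\<^bsub>G (Suc j)\<^esub>, b)"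
      using fc x bg by (simp add: a_minus_def N.a_ac N.r_neg1 N.r_neg2)
    also have "\<dots> = f x" using cone_hom_split[OF fh x(2,3)] x(1) by simp
    finally show ?thesis by simp
  qed
  ultimately show ?thesis by blast
qed

text \<open>The second projection lowers the degree by one and commutes with the differentials up to
  sign; acyclicity of G removes the contribution of the first factor. As the cone resolves M, this
  is the shift from degree l + 1 of Ext for the kernel to degree l + 2 for M.\<close>

lemma cone_cohomology_Suc:
  assumes N: "module R N" and ac: "\<And>i. cocycles R G dG N (Suc i) \<subseteq> coboundaries R G dG N (Suc i)"
  shows "mod_isomorphic R (hom_cohomology R F dF N (Suc l)) (hom_cohomology R K D N (Suc (Suc l)))"
proof -
  interpret N: module R N by (rule N)
  let ?\<phi> = "\<lambda>x\<in>carrier (K (Suc (Suc l))). snd x"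
  have \<phi>: "?\<phi> \<in> mod_hom R (K (Suc (Suc l))) (F (Suc l))"
    by (rule mod_homI[OF module_cone]) (auto simp: cone_mod_def)
  have snd_D: "snd (D (Suc n) x) = \<ominus>\<^bsub>F n\<^esub> dF n (snd x)" if "x \<in> carrier (K (Suc (Suc n)))" for n x
    using that by (auto simp: cone_carrier_Suc cone_diff_apply)
  show ?thesis
  proof (rule hom_cohomology_pullback_isoI[OF FD(1) cone_complex N \<phi>])
    fix f x assume f: "f \<in> cocycles R F dF N (Suc l)" and x: "x \<in> carrier (K (Suc (Suc (Suc l))))"
    have b: "snd x \<in> carrier (F (Suc (Suc l)))" using x by (auto simp: cone_carrier_Suc)
    have fh: "f \<in> mod_hom R (F (Suc l)) N" using f by (simp add: cocycles_def)
    have "f (\<ominus>\<^bsub>F (Suc l)\<^esub> dF (Suc l) (snd x)) = \<ominus>\<^bsub>N\<^esub> f (dF (Suc l) (snd x))"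
      by (rule mod_hom_a_inv[OF FD(2) N fh dFD(1)[OF b]])
    also have "\<dots> = \<zero>\<^bsub>N\<^esub>" using f b by (simp add: cocycles_def N.a_inv_zero)
    finally show "f (?\<phi> (D (Suc (Suc l)) x)) = \<zero>\<^bsub>N\<^esub>"
      using mod_homD(1)[OF cone_diff_hom x] snd_D[OF x] by simp
  next
    fix f assume f: "f \<in> coboundaries R F dF N (Suc l)"
    then obtain h where fh: "f \<in> mod_hom R (F (Suc l)) N" and h: "h \<in> mod_hom R (F l) N"
      "\<forall>b\<in>carrier (F (Suc l)). f b = h (dF l b)"
      by (auto simp: coboundaries_Suc)
    \<comment> \<open>The sign cancels the one in the second component of the cone
      differential.\<close>
    let ?\<chi> = "\<lambda>x\<in>carrier (K (Suc l)). (\<lambda>b\<in>carrier (F l). \<ominus>\<^bsub>N\<^esub> h b) (snd x)"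
    have \<chi>: "?\<chi> \<in> mod_hom R (K (Suc l)) N"
      by (rule cone_snd_hom[OF mod_hom_uminus[OF FD(2) N h(1)]])
    have "compose (carrier (K (Suc (Suc l)))) f ?\<phi> x = ?\<chi> (D (Suc l) x)"
      if xc: "x \<in> carrier (K (Suc (Suc l)))" for x
    proof -
      have b: "snd x \<in> carrier (F (Suc l))" using xc by (auto simp: cone_carrier_Suc)
      have "\<ominus>\<^bsub>N\<^esub> h (\<ominus>\<^bsub>F l\<^esub> dF l (snd x)) = h (dF l (snd x))"
        using dFD(1)[OF b] mod_homD(1)[OF h(1)]
        by (simp add: mod_hom_a_inv[OF FD(2) N h(1)] N.minus_minus)
      then show ?thesis
        using xc mod_homD(1)[OF cone_diff_hom xc] snd_D[OF xc] dFD(1)[OF b] h(2) b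
        by (simp add: compose_eq)
    qed
    then show "compose (carrier (K (Suc (Suc l)))) f ?\<phi> \<in> coboundaries R K D N (Suc (Suc l))"
      unfolding coboundaries_Suc using mod_hom_compose[OF module_cone \<phi> fh] \<chi> by blast
  next
    fix f assume f: "f \<in> cocycles R F dF N (Suc l)"
      and "compose (carrier (K (Suc (Suc l)))) f ?\<phi> \<in> coboundaries R K D N (Suc (Suc l))"
    then obtain \<chi> where \<chi>: "\<chi> \<in> mod_hom R (K (Suc l)) N"
      and "\<forall>x\<in>carrier (K (Suc (Suc l))). compose (carrier (K (Suc (Suc l)))) f ?\<phi> x = \<chi> (D (Suc l) x)"
      by (auto simp: coboundaries_Suc simp del: restrict_apply)
    then have f\<chi>: "f b = \<chi> (dG (Suc l) a \<oplus>\<^bsub>G (Suc l)\<^esub> g (Suc l) b, \<ominus>\<^bsub>F l\<^esub> dF l b)"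
      if "a \<in> carrier (G (Suc (Suc l)))" "b \<in> carrier (F (Suc l))" for a b
      using that by (auto simp: cone_carrier_Suc compose_eq cone_diff_apply)
    have fh: "f \<in> mod_hom R (F (Suc l)) N" using f by (simp add: cocycles_def)
    \<comment> \<open>The primitive \<chi> is split into its parts on G and F. The part on G is a
      cocycle, hence \<gamma> dG, and evaluating \<chi> on the differential of (0, b) shows that
      \<gamma> g minus the part on F is a primitive of f.\<close>
    let ?\<beta> = "\<lambda>a\<in>carrier (G (Suc l)). \<chi> (a, \<zero>\<^bsub>F l\<^esub>)" and ?l = "\<lambda>b\<in>carrier (F l). \<chi> (\<zero>\<^bsub>G (Suc l)\<^esub>, b)"
    have \<beta>: "?\<beta> \<in> mod_hom R (G (Suc l)) N" using cone_hom_fst[OF \<chi>] by simp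
    have l: "?l \<in> mod_hom R (F l) N" by (rule cone_hom_snd[OF \<chi>])
    have "\<chi> (dG (Suc l) a, \<zero>\<^bsub>F l\<^esub>) = \<zero>\<^bsub>N\<^esub>" if a: "a \<in> carrier (G (Suc (Suc l)))" for a
      using f\<chi>[OF a F.zero_closed] a dGD(1)[OF a] mod_hom_zero[OF FD(2) GD(2) gh]
        mod_hom_zero[OF FD(2) FD(2) FD(4)] mod_hom_zero[OF FD(2) N fh] by (simp add: F.a_inv_zero)
    then have "?\<beta> \<in> cocycles R G dG N (Suc l)" using \<beta> dGD(1) by (simp add: cocycles_def)
    then obtain \<gamma> where \<gamma>: "\<gamma> \<in> mod_hom R (G l) N" "\<forall>a\<in>carrier (G (Suc l)). ?\<beta> a = \<gamma> (dG l a)"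
      using ac[of l] by (auto simp: coboundaries_Suc subset_iff simp del: restrict_apply)
    let ?h = "\<lambda>b\<in>carrier (F l). compose (carrier (F l)) \<gamma> (g l) b \<ominus>\<^bsub>N\<^esub> ?l b"
    have h: "?h \<in> mod_hom R (F l) N"
      by (rule mod_hom_minus[OF FD(2) N mod_hom_compose[OF FD(2) gh \<gamma>(1)] l])
    have "f b = ?h (dF l b)" if b: "b \<in> carrier (F (Suc l))" for b
    proof -
      have c: "g (Suc l) b \<in> carrier (G (Suc l))" "dF l b \<in> carrier (F l)" "\<ominus>\<^bsub>F l\<^esub> dF l b \<in> carrier (F l)"
        using b gD(1) dFD(1) by simp_all
      have "f b = \<chi> (g (Suc l) b, \<ominus>\<^bsub>F l\<^esub> dF l b)"
        using f\<chi>[OF G.zero_closed b] mod_hom_zero[OF GD(2) GD(2) GD(4)] c by simp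
      also have "\<dots> = \<chi> (g (Suc l) b, \<zero>\<^bsub>F l\<^esub>) \<oplus>\<^bsub>N\<^esub> \<chi> (\<zero>\<^bsub>G (Suc l)\<^esub>, \<ominus>\<^bsub>F l\<^esub> dF l b)"
        by (rule cone_hom_split[OF \<chi> c(1,3)])
      also have "\<chi> (g (Suc l) b, \<zero>\<^bsub>F l\<^esub>) = \<gamma> (g l (dF l b))"
        using bspec[OF \<gamma>(2) c(1)] c b by (simp add: gd)
      also have "\<chi> (\<zero>\<^bsub>G (Suc l)\<^esub>, \<ominus>\<^bsub>F l\<^esub> dF l b) = \<ominus>\<^bsub>N\<^esub> \<chi> (\<zero>\<^bsub>G (Suc l)\<^esub>, dF l b)"
        using mod_hom_a_inv[OF FD(2) N l c(2)] c by simp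
      finally show ?thesis using c by (simp add: compose_eq a_minus_def)
    qed
    then show "f \<in> coboundaries R F dF N (Suc l)"
      unfolding coboundaries_Suc using fh h by blast
  next
    fix f assume "f \<in> cocycles R K D N (Suc (Suc l))"
    from cone_cocycle_decomp[OF N ac this]
    show "\<exists>\<kappa>\<in>cocycles R F dF N (Suc l). \<exists>c\<in>coboundaries R K D N (Suc (Suc l)).
        \<forall>x\<in>carrier (K (Suc (Suc l))). f x = \<kappa> (?\<phi> x) \<oplus>\<^bsub>N\<^esub> c x"
      by simp
  qed
qed

text \<open>In degree 1 both sides describe Hom(Ker, N) modulo the restrictions of maps from A to N.
  On the side of X, cocycles factor through d 0 by exactness; on the side of the cone, the cocycles
  of F in degree 0 factor through eF.\<close>

lemma cone_cohomology_1:
  assumes X: "resolution R X d M \<pi>" and X0: "X 0 = A" and N: "module R N"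
    and ac: "cocycles R G dG N (Suc 0) \<subseteq> coboundaries R G dG N (Suc 0)"
  shows "mod_isomorphic R (hom_cohomology R X d N (Suc 0)) (hom_cohomology R K D N (Suc 0))"
proof -
  interpret N: module R N by (rule N)
  note XD = resolutionD[OF X]
  interpret X: module R "X n" for n by (rule XD(2))
  have d0: "d 0 \<in> mod_hom R (X (Suc 0)) Ker"
    using XD(4)[of 0] XD(7) unfolding X0 by (auto simp: mod_hom_def)
  have eFK: "eF b \<in> d 0 ` carrier (X (Suc 0))" if "b \<in> carrier (F 0)" for b
    using XD(9) eFD(1,2)[OF that] X0 by simp
  \<comment> \<open>Both d 0 and eF map onto Ker, so lifting eF through d 0 gives a direct
    comparison from \<open>F 0\<close> to \<open>X (Suc 0)\<close>.\<close>
  obtain s where s: "s \<in> mod_hom R (F 0) (X (Suc 0))" "\<forall>b\<in>carrier (F 0). d 0 (s b) = eF b"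
    using projective_lift[OF FR(2) XD(2) module_Ker d0 FD(5) eFK] by blast
  note sD = mod_homD[OF s(1)] and dXD = mod_homD[OF XD(4)]
  let ?\<phi> = "\<lambda>x\<in>carrier (K (Suc 0)). s (snd x)"
  have \<phi>: "?\<phi> \<in> mod_hom R (K (Suc 0)) (X (Suc 0))" by (rule cone_snd_hom[OF s(1)])
  \<comment> \<open>The kernel of d 0 is the image of the next differential, on which a cocycle
    vanishes. Its value at x thus depends on d 0 x only.\<close>
  have cyc0: "f x = \<zero>\<^bsub>N\<^esub>" if f: "f \<in> cocycles R X d N (Suc 0)" and x: "x \<in> carrier (X (Suc 0))"
      "d 0 x = \<zero>\<^bsub>X 0\<^esub>" for f x
    using XD(10)[OF x] f by (auto simp: cocycles_def)
  have cyc_eq: "f x = f y" if f: "f \<in> cocycles R X d N (Suc 0)" and x: "x \<in> carrier (X (Suc 0))"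
      and y: "y \<in> carrier (X (Suc 0))" and eq: "d 0 x = d 0 y" for f x y
  proof -
    have fh: "f \<in> mod_hom R (X (Suc 0)) N" using f by (simp add: cocycles_def)
    have "d 0 (x \<ominus>\<^bsub>X (Suc 0)\<^esub> y) = \<zero>\<^bsub>X 0\<^esub>"
      using x y eq dXD(1) by (simp add: mod_hom_diff[OF XD(2,2,4)] X.minus_eq_zero_iff)
    then have "f (x \<ominus>\<^bsub>X (Suc 0)\<^esub> y) = \<zero>\<^bsub>N\<^esub>" using cyc0[OF f] x y by simp
    then show ?thesis
      using x y mod_homD(1)[OF fh] by (simp add: mod_hom_diff[OF XD(2) N fh] N.minus_eq_zero_iff)
  qed
  show ?thesis
  proof (rule hom_cohomology_pullback_isoI[OF XD(1) cone_complex N \<phi>])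
    fix f x assume f: "f \<in> cocycles R X d N (Suc 0)" and x: "x \<in> carrier (K (Suc (Suc 0)))"
    have b: "snd x \<in> carrier (F (Suc 0))" using x by (auto simp: cone_carrier_Suc)
    have sn: "snd (D (Suc 0) x) = \<ominus>\<^bsub>F 0\<^esub> dF 0 (snd x)"
      using x by (auto simp: cone_carrier_Suc cone_diff_apply)
    have c: "\<ominus>\<^bsub>F 0\<^esub> dF 0 (snd x) \<in> carrier (F 0)" using dFD(1)[OF b] by simp
    have "eF (\<ominus>\<^bsub>F 0\<^esub> dF 0 (snd x)) = \<zero>\<^bsub>A\<^esub>"
      using mod_hom_a_inv[OF FD(2) module_Ker FD(5) dFD(1)[OF b]] FD(7)[OF b]
        abelian_group.a_inv_zero[OF module.axioms(2)[OF module_Ker]] by simp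
    then have "f (s (\<ominus>\<^bsub>F 0\<^esub> dF 0 (snd x))) = \<zero>\<^bsub>N\<^esub>"
      using c s(2) sD(1) X0 by (intro cyc0[OF f]) simp_all
    then show "f (?\<phi> (D (Suc 0) x)) = \<zero>\<^bsub>N\<^esub>"
      using mod_homD(1)[OF cone_diff_hom x] sn by simp
  next
    fix f assume f: "f \<in> coboundaries R X d N (Suc 0)"
    then obtain \<psi> where fh: "f \<in> mod_hom R (X (Suc 0)) N" and \<psi>: "\<psi> \<in> mod_hom R A N"
      "\<forall>x\<in>carrier (X (Suc 0)). f x = \<psi> (d 0 x)"
      using X0 by (auto simp: coboundaries_Suc)
    let ?\<chi> = "\<lambda>x\<in>carrier (K 0). compose (carrier (G 0)) \<psi> eG (fst x)"
    have \<chi>: "?\<chi> \<in> mod_hom R (K 0) N"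
      by (rule cone_fst_hom[OF mod_hom_compose[OF GD(2) GD(5) \<psi>(1)]])
    have "compose (carrier (K (Suc 0))) f ?\<phi> x = ?\<chi> (D 0 x)" if xc: "x \<in> carrier (K (Suc 0))" for x
    proof -
      obtain a b where x: "x = (a, b)" "a \<in> carrier (G (Suc 0))" "b \<in> carrier (F 0)"
        using xc by (auto simp: cone_carrier_Suc)
      have "?\<chi> (D 0 x) = \<psi> (eG (dG 0 a \<oplus>\<^bsub>G 0\<^esub> g 0 b))"
        using mod_homD(1)[OF cone_diff_hom xc] x dGD(1) gD(1)
        by (simp add: cone_diff_apply cone_carrier_0 compose_eq)
      also have "eG (dG 0 a \<oplus>\<^bsub>G 0\<^esub> g 0 b) = eF b"
        using x dGD(1) gD(1) eFD by (simp add: eGD GD(7) g(2))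
      finally show ?thesis using x s(2) \<psi>(2) sD(1) by (simp add: compose_eq cone_carrier_Suc)
    qed
    then show "compose (carrier (K (Suc 0))) f ?\<phi> \<in> coboundaries R K D N (Suc 0)"
      unfolding coboundaries_Suc using mod_hom_compose[OF module_cone \<phi> fh] \<chi> by blast
  next
    fix f assume f: "f \<in> cocycles R X d N (Suc 0)"
      and "compose (carrier (K (Suc 0))) f ?\<phi> \<in> coboundaries R K D N (Suc 0)"
    then obtain \<chi> where \<chi>: "\<chi> \<in> mod_hom R (K 0) N"
      and "\<forall>x\<in>carrier (K (Suc 0)). compose (carrier (K (Suc 0))) f ?\<phi> x = \<chi> (D 0 x)"
      by (auto simp: coboundaries_Suc simp del: restrict_apply)
    then have f\<chi>: "f (s b) = \<chi> (dG 0 a \<oplus>\<^bsub>G 0\<^esub> g 0 b, \<zero>\<^bsub>F 0\<^esub>)"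
      if "a \<in> carrier (G (Suc 0))" "b \<in> carrier (F 0)" for a b
      using that by (auto simp: cone_carrier_Suc compose_eq cone_diff_apply)
    have fh: "f \<in> mod_hom R (X (Suc 0)) N" using f by (simp add: cocycles_def)
    let ?\<beta> = "\<lambda>a\<in>carrier (G 0). \<chi> (a, \<zero>\<^bsub>F 0\<^esub>)"
    have \<beta>: "?\<beta> \<in> mod_hom R (G 0) N" using cone_hom_fst[OF \<chi>] by simp
    \<comment> \<open>An element killed by eG is some dG 0 a'. The identity \<open>f\<chi>\<close>
      at a' and 0 then says that \<chi> vanishes on it, so \<open>?\<beta>\<close> factors through
      eG to a map on A.\<close>
    have "?\<beta> a = \<zero>\<^bsub>N\<^esub>" if a: "a \<in> carrier (G 0)" "eG a = \<zero>\<^bsub>A\<^esub>" for a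
    proof -
      obtain a' where "a' \<in> carrier (G (Suc 0))" "a = dG 0 a'" using GD(9)[OF a] by auto
      then show ?thesis
        using f\<chi>[OF _ F.zero_closed, of a'] a mod_hom_zero[OF FD(2) GD(2) gh]
          mod_hom_zero[OF FD(2) XD(2) s(1)] mod_hom_zero[OF XD(2) N fh] by simp
    qed
    then obtain \<psi> where \<psi>: "\<psi> \<in> mod_hom R A N" "\<forall>a\<in>carrier (G 0). \<psi> (eG a) = ?\<beta> a"
      using surjective_factor[OF GD(2) A N GD(5) GD(8) \<beta>] by blast
    have "f x = \<psi> (d 0 x)" if x: "x \<in> carrier (X (Suc 0))" for x
    proof -
      have "d 0 x \<in> carrier Ker" by (rule mod_homD(1)[OF d0 x])
      then have "d 0 x \<in> eF ` carrier (F 0)" unfolding FD(8) .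
      then obtain b where b: "b \<in> carrier (F 0)" "d 0 x = eF b" by (rule imageE) auto
      have "f x = f (s b)" by (rule cyc_eq[OF f x sD(1)[OF b(1)]]) (use b s(2) in simp)
      also have "\<dots> = \<chi> (g 0 b, \<zero>\<^bsub>F 0\<^esub>)"
        using f\<chi>[OF G.zero_closed b(1)] mod_hom_zero[OF GD(2) GD(2) GD(4)] gD(1)[OF b(1)] by simp
      also have "\<dots> = \<psi> (eG (g 0 b))" using \<psi>(2) gD(1)[OF b(1)] by simp
      finally show ?thesis using g(2) b by simp
    qed
    then show "f \<in> coboundaries R X d N (Suc 0)"
      unfolding coboundaries_Suc using fh \<psi>(1) X0 by auto
  next
    fix f assume "f \<in> cocycles R K D N (Suc 0)"
    from cone_cocycle_decomp[OF N ac this]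
    obtain \<kappa> c where \<kappa>: "\<kappa> \<in> cocycles R F dF N 0" and c: "c \<in> coboundaries R K D N (Suc 0)"
      and eq: "\<forall>x\<in>carrier (K (Suc 0)). f x = \<kappa> (snd x) \<oplus>\<^bsub>N\<^esub> c x" by blast
    have \<kappa>h: "\<kappa> \<in> mod_hom R (F 0) N" and \<kappa>d: "\<And>b. b \<in> carrier (F (Suc 0)) \<Longrightarrow> \<kappa> (dF 0 b) = \<zero>\<^bsub>N\<^esub>"
      using \<kappa> by (auto simp: cocycles_def)
    \<comment> \<open>A cocycle of F in degree 0 factors through eF and so is a map on Ker; composed
      with d 0 it becomes a cocycle of X.\<close>
    have "\<kappa> b = \<zero>\<^bsub>N\<^esub>" if "b \<in> carrier (F 0)" "eF b = \<zero>\<^bsub>Ker\<^esub>" for b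
      using FD(9)[OF that] \<kappa>d by auto
    then obtain k where k: "k \<in> mod_hom R Ker N" "\<forall>b\<in>carrier (F 0). k (eF b) = \<kappa> b"
      using surjective_factor[OF FD(2) module_Ker N FD(5) FD(8) \<kappa>h] by blast
    have "compose (carrier (X (Suc 0))) k (d 0) \<in> cocycles R X d N (Suc 0)"
      using mod_hom_compose[OF XD(2) d0 k(1)] mod_hom_zero[OF module_Ker N k(1)] dXD(1) XD(6) X0
      by (simp add: cocycles_def compose_eq)
    moreover have "f x = compose (carrier (X (Suc 0))) k (d 0) (?\<phi> x) \<oplus>\<^bsub>N\<^esub> c x"
      if "x \<in> carrier (K (Suc 0))" for x
    proof -
      have "snd x \<in> carrier (F 0)" using that by (auto simp: cone_carrier_Suc)
      then show ?thesis using that eq k(2) s(2) sD(1) by (simp add: compose_eq)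
    qed
    ultimately show "\<exists>h\<in>cocycles R X d N (Suc 0). \<exists>c\<in>coboundaries R K D N (Suc 0).
        \<forall>x\<in>carrier (K (Suc 0)). f x = h (?\<phi> x) \<oplus>\<^bsub>N\<^esub> c x"
      using c by blast
  qed
qed

end

section \<open>Computing Ext from acyclic resolutions\<close>

definition hom_acyclic ::
  "[('a, _) ring_scheme, ('a, 'b, _) module_scheme, ('a, 'd, _) module_scheme] \<Rightarrow> bool"
  where "hom_acyclic R A N \<longleftrightarrow> (\<forall>i. zero_mod (Ext R A N (Suc i)))"

lemma zero_mod_isomorphic:
  assumes "module R M" "module R N" "mod_isomorphic R M N" "zero_mod N"
  shows "zero_mod M"
proof -
  interpret M: module R M by fact
  obtain f where f: "f \<in> mod_hom R M N" "inj_on f (carrier M)"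
    using assms(3) by (auto simp: mod_isomorphic_def is_mod_iso_def bij_betw_def)
  have z: "f x = \<zero>\<^bsub>N\<^esub>" if "x \<in> carrier M" for x
    using mod_homD(1)[OF f(1) that] assms(4) by (simp add: zero_mod_def)
  have "x = \<zero>\<^bsub>M\<^esub>" if "x \<in> carrier M" for x
    by (rule inj_onD[OF f(2) _ that M.zero_closed]) (simp add: z that)
  then show ?thesis unfolding zero_mod_def by (intro equalityI subsetI) simp_all
qed

text \<open>The vanishing concerns the resolution chosen inside \<open>Ext\<close>; independence of
  the resolution carries it over to any other one, in any type.\<close>

lemma hom_acyclic_iff:
  assumes "projective_resolution R A P d e" "module R A" "module R N"
  shows "hom_acyclic R A N \<longleftrightarrow> (\<forall>i. cocycles R P d N (Suc i) \<subseteq> coboundaries R P d N (Suc i))"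
proof -
  have P: "chain_complex R P d"
    by (rule resolutionD(1)[OF projective_resolutionD(1)[OF assms(1,2)]])
  have "zero_mod (Ext R A N (Suc i)) \<longleftrightarrow> zero_mod (hom_cohomology R P d N (Suc i))" for i
    using zero_mod_isomorphic[OF module_hom_cohomology[OF P assms(3)] module_Ext[OF assms(2,3)] Ext_iso(1)[OF assms]]
      zero_mod_isomorphic[OF module_Ext[OF assms(2,3)] module_hom_cohomology[OF P assms(3)] Ext_iso(2)[OF assms]]
    by (rule iffI)
  then show ?thesis
    by (simp add: hom_acyclic_def hom_cohomology_zero_iff[OF P assms(3)])
qed

text \<open>The inclusion of the kernel of e into \<open>X 0\<close> lifts to projective resolutions
  F and G, and the cone of the lift resolves M. As \<open>X 0\<close> is acyclic, the cone has the
  cohomology of X in degree 1, and above it that of F shifted by one.\<close>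

lemma dimension_shift:
  fixes X :: "nat \<Rightarrow> ('a, 'x, 'm) module_scheme"
  assumes X: "resolution R X d M e" and N: "module R N" and ac: "hom_acyclic R (X 0) N"
  shows "mod_isomorphic R (hom_cohomology R X d N (Suc 0)) (Ext R M N (Suc 0))"
    and "mod_isomorphic R (Ext R ((X 0)\<lparr>carrier := {x \<in> carrier (X 0). e x = \<zero>\<^bsub>M\<^esub>}\<rparr>) N (Suc l))
      (Ext R M N (Suc (Suc l)))"
proof -
  note XD = resolutionD[OF X]
  let ?K = "(X 0)\<lparr>carrier := {x \<in> carrier (X 0). e x = \<zero>\<^bsub>M\<^esub>}\<rparr>"
  have K: "module R ?K"
    by (rule submodule.submodule_is_module[OF submodule_kernel[OF XD(2,3,5)] XD(2)])
  obtain F :: "nat \<Rightarrow> ('a, ('a, 'x) res) module" and dF eF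
    where F: "projective_resolution R ?K F dF eF"
    using ex_projective_resolution[OF K] by blast
  obtain G :: "nat \<Rightarrow> ('a, ('a, 'x) res) module" and dG eG
    where G: "projective_resolution R (X 0) G dG eG"
    using ex_projective_resolution[OF XD(2)] by blast
  note FR = projective_resolutionD[OF F K] and GR = projective_resolutionD[OF G XD(2)]
  have inc: "(\<lambda>x\<in>carrier ?K. x) \<in> mod_hom R ?K (X 0)"
    by (rule mod_homI[OF K]) auto
  have "aug_complex R F dF ?K eF" using F by (simp add: projective_resolution_def)
  from chain_map_lift[OF FR(2) this K GR(1) inc]
  obtain g where g: "chain_map R F dF G dG g"
    "\<forall>b\<in>carrier (F 0). eG (g 0 b) = (\<lambda>x\<in>carrier ?K. x) (eF b)" by blast
  interpret mapping_cone R "X 0" M e F dF eF G dG eG g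
  proof (rule mapping_cone.intro)
    show "eG (g 0 b) = eF b" if "b \<in> carrier (F 0)" for b
      using g(2) that mod_homD(1)[OF resolutionD(5)[OF FR(1)] that] by simp
  qed (rule XD F G g(1))+
  have acG: "cocycles R G dG N (Suc i) \<subseteq> coboundaries R G dG N (Suc i)" for i
    using ac hom_acyclic_iff[OF G XD(2) N] by blast
  note cone = Ext_iso(1)[OF cone_resolution XD(3) N]
  show "mod_isomorphic R (hom_cohomology R X d N (Suc 0)) (Ext R M N (Suc 0))"
    by (rule mod_isomorphic_trans[OF module_hom_cohomology[OF XD(1) N]
          cone_cohomology_1[OF X refl N acG] cone])
  show "mod_isomorphic R (Ext R ?K N (Suc l)) (Ext R M N (Suc (Suc l)))"
    by (rule mod_isomorphic_trans[OF module_Ext[OF K N] Ext_iso(2)[OF F K N]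
          mod_isomorphic_trans[OF module_hom_cohomology[OF resolutionD(1)[OF FR(1)] N]
            cone_cohomology_Suc[OF N acG] cone]])
qed

lemma resolution_shift:
  assumes X: "resolution R X d M e"
  shows "resolution R (\<lambda>n. X (Suc n)) (\<lambda>n. d (Suc n))
    ((X 0)\<lparr>carrier := {x \<in> carrier (X 0). e x = \<zero>\<^bsub>M\<^esub>}\<rparr>) (d 0)"
proof -
  note XD = resolutionD[OF X]
  have "module R ((X 0)\<lparr>carrier := {x \<in> carrier (X 0). e x = \<zero>\<^bsub>M\<^esub>}\<rparr>)"
    by (rule submodule.submodule_is_module[OF submodule_kernel[OF XD(2,3,5)] XD(2)])
  moreover have "d 0 \<in> mod_hom R (X (Suc 0)) ((X 0)\<lparr>carrier := {x \<in> carrier (X 0). e x = \<zero>\<^bsub>M\<^esub>}\<rparr>)"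
    using XD(4)[of 0] XD(7) by (auto simp: mod_hom_def)
  ultimately show ?thesis
    using X by (simp add: resolution_def aug_complex_def aug_exact_def)
qed

text \<open>M shares the type of the complex because the induction replaces it by the kernel of e
  inside \<open>X 0\<close>, and types stay fixed during an induction.\<close>

lemma acyclic_resolution_Suc:
  fixes X :: "nat \<Rightarrow> ('a, 'x, 'm) module_scheme" and M :: "('a, 'x, 'm) module_scheme"
  assumes "resolution R X d M e" "module R N" "\<And>n. hom_acyclic R (X n) N"
  shows "mod_isomorphic R (hom_cohomology R X d N (Suc i)) (Ext R M N (Suc i))"
  using assms(1,3)
proof (induction i arbitrary: X d M e)
  case 0
  show ?case by (rule dimension_shift(1)[OF 0(1) assms(2) 0(2)])
next
  case (Suc i)
  let ?K = "(X 0)\<lparr>carrier := {x \<in> carrier (X 0). e x = \<zero>\<^bsub>M\<^esub>}\<rparr>"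
  \<comment> \<open>The index shift is an equality only from degree 2 on: degree 1 of X would become
    degree 0 of the shifted complex, where the incoming differential is gone.\<close>
  have sh: "hom_cohomology R X d N (Suc (Suc i)) =
      hom_cohomology R (\<lambda>n. X (Suc n)) (\<lambda>n. d (Suc n)) N (Suc i)"
    by (simp add: hom_cohomology_def cohomology_def)
  note r = resolution_shift[OF Suc.prems(1)]
  show ?case
    unfolding sh
    by (rule mod_isomorphic_trans[OF module_hom_cohomology[OF resolutionD(1)[OF r] assms(2)]
          Suc.IH[OF r Suc.prems(2)] dimension_shift(2)[OF Suc.prems(1) assms(2) Suc.prems(2)]])
qed

text \<open>Both sides are Hom(M, N), since a cocycle in degree 0 factors through the surjective
  augmentation.\<close>

lemma left_exact_cohomology_0:
  assumes X: "resolution R X d M e" and P: "projective_resolution R M P d' e'" and N: "module R N"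
  shows "mod_isomorphic R (hom_cohomology R X d N 0) (hom_cohomology R P d' N 0)"
proof -
  interpret N: module R N by fact
  note XD = resolutionD[OF X]
  note PR = projective_resolutionD[OF P XD(3)]
  note PD = resolutionD[OF PR(1)]
  have "aug_complex R P d' M e'" using P by (simp add: projective_resolution_def)
  from chain_map_lift[OF PR(2) this XD(3) X mod_hom_id[OF XD(3)]]
  obtain \<phi> where \<phi>: "chain_map R P d' X d \<phi>"
    "\<forall>p\<in>carrier (P 0). e (\<phi> 0 p) = (\<lambda>x\<in>carrier M. x) (e' p)" by blast
  have e\<phi>: "e (\<phi> 0 p) = e' p" if "p \<in> carrier (P 0)" for p
    using \<phi>(2) that mod_homD(1)[OF PD(5) that] by simp
  have \<phi>h: "\<phi> n \<in> mod_hom R (P n) (X n)" for n using \<phi>(1) by (simp add: chain_map_def)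
  show ?thesis
  proof (rule hom_cohomology_pullback_isoI[OF XD(1) PD(1) N \<phi>h])
    fix f x assume "f \<in> cocycles R X d N 0" "x \<in> carrier (P (Suc 0))"
    then show "f (\<phi> 0 (d' 0 x)) = \<zero>\<^bsub>N\<^esub>"
      using chain_map_cocycle[OF PD(1) \<phi>(1), of f N 0] mod_homD(1)[OF PD(4)]
      by (simp add: cocycles_def compose_eq)
  next
    fix f assume "f \<in> coboundaries R X d N 0"
    then show "compose (carrier (P 0)) f (\<phi> 0) \<in> coboundaries R P d' N 0"
      by (rule chain_map_coboundary[OF PD(1) \<phi>(1)])
  next
    fix f assume f: "f \<in> cocycles R X d N 0"
      and f\<phi>: "compose (carrier (P 0)) f (\<phi> 0) \<in> coboundaries R P d' N 0"
    have fh: "f \<in> mod_hom R (X 0) N" and fd: "\<And>x. x \<in> carrier (X (Suc 0)) \<Longrightarrow> f (d 0 x) = \<zero>\<^bsub>N\<^esub>"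
      using f by (auto simp: cocycles_def)
    have "f p = \<zero>\<^bsub>N\<^esub>" if "p \<in> carrier (X 0)" "e p = \<zero>\<^bsub>M\<^esub>" for p
      using XD(9)[OF that] fd by auto
    then obtain h where h: "h \<in> mod_hom R M N" "\<forall>p\<in>carrier (X 0). h (e p) = f p"
      using surjective_factor[OF XD(2,3) N XD(5,8) fh] by blast
    have "f x = \<zero>\<^bsub>N\<^esub>" if x: "x \<in> carrier (X 0)" for x
    proof -
      have "e x \<in> e' ` carrier (P 0)" using mod_homD(1)[OF XD(5) x] PD(8) by simp
      then obtain p where p: "p \<in> carrier (P 0)" "e x = e' p" by (rule imageE) auto
      have "f x = h (e (\<phi> 0 p))" using bspec[OF h(2) x] p(2) e\<phi>[OF p(1)] by simp
      also have "\<dots> = f (\<phi> 0 p)" using h(2) mod_homD(1)[OF \<phi>h p(1)] by simp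
      finally show ?thesis using f\<phi> p(1) by (simp add: coboundaries_0 compose_eq)
    qed
    then show "f \<in> coboundaries R X d N 0" using fh by (simp add: coboundaries_0)
  next
    fix f assume f: "f \<in> cocycles R P d' N 0"
    have fh: "f \<in> mod_hom R (P 0) N" and fd: "\<And>x. x \<in> carrier (P (Suc 0)) \<Longrightarrow> f (d' 0 x) = \<zero>\<^bsub>N\<^esub>"
      using f by (auto simp: cocycles_def)
    have "f p = \<zero>\<^bsub>N\<^esub>" if "p \<in> carrier (P 0)" "e' p = \<zero>\<^bsub>M\<^esub>" for p
      using PD(9)[OF that] fd by auto
    then obtain h where h: "h \<in> mod_hom R M N" "\<forall>p\<in>carrier (P 0). h (e' p) = f p"
      using surjective_factor[OF PD(2,3) N PD(5,8) fh] by blast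
    have "compose (carrier (X 0)) h e \<in> cocycles R X d N 0"
      using mod_hom_compose[OF XD(2,5) h(1)] mod_hom_zero[OF XD(3) N h(1)] XD(7) mod_homD(1)[OF XD(4)]
      by (simp add: cocycles_def compose_eq)
    moreover have "(\<lambda>x\<in>carrier (P 0). \<zero>\<^bsub>N\<^esub>) \<in> coboundaries R P d' N 0"
      using mod_hom_const_zero[OF PD(2) N] by (simp add: coboundaries_0)
    moreover have "f x = compose (carrier (X 0)) h e (\<phi> 0 x) \<oplus>\<^bsub>N\<^esub> (\<lambda>x\<in>carrier (P 0). \<zero>\<^bsub>N\<^esub>) x"
      if "x \<in> carrier (P 0)" for x
      using that h(2) e\<phi> mod_homD(1)[OF \<phi>h that] mod_homD(1)[OF fh] by (simp add: compose_eq)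
    ultimately show "\<exists>h\<in>cocycles R X d N 0. \<exists>b\<in>coboundaries R P d' N 0.
        \<forall>x\<in>carrier (P 0). f x = h (\<phi> 0 x) \<oplus>\<^bsub>N\<^esub> b x" by blast
  qed
qed

text \<open>The first shift is made by hand: it leaves the type of M and arrives at a kernel inside
  \<open>X 0\<close>, where \<open>acyclic_resolution_Suc\<close> applies. Degree 0 is left
  exactness, and degree 1 is read off the cone.\<close>

theorem acyclic_resolution_Ext:
  fixes X :: "nat \<Rightarrow> ('a, 'x, 'm) module_scheme" and M :: "('a, 'b, 'k) module_scheme"
  assumes X: "resolution R X d M e" and N: "module R N" and ac: "\<And>n. hom_acyclic R (X n) N"
  shows "mod_isomorphic R (hom_cohomology R X d N i) (Ext R M N i)"
proof -
  note XD = resolutionD[OF X]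
  consider "i = 0" | "i = Suc 0" | j where "i = Suc (Suc j)" by (metis not0_implies_Suc)
  then show ?thesis
  proof cases
    case 1
    obtain P :: "nat \<Rightarrow> ('a, ('a, 'b) res) module" and d' e' where "projective_resolution R M P d' e'"
      using ex_projective_resolution[OF XD(3)] by blast
    then show ?thesis
      unfolding 1
      by (intro mod_isomorphic_trans[OF module_hom_cohomology[OF XD(1) N]
            left_exact_cohomology_0[OF X _ N] Ext_iso(1)] XD(3) N)
  next
    case 2
    show ?thesis unfolding 2 by (rule dimension_shift(1)[OF X N ac])
  next
    case 3
    have sh: "hom_cohomology R X d N (Suc (Suc j)) = hom_cohomology R (\<lambda>n. X (Suc n)) (\<lambda>n. d (Suc n)) N (Suc j)"
      by (simp add: hom_cohomology_def cohomology_def)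
    note r = resolution_shift[OF X]
    show ?thesis
      unfolding 3 sh
      by (rule mod_isomorphic_trans[OF module_hom_cohomology[OF resolutionD(1)[OF r] N]
            acyclic_resolution_Suc[OF r N ac] dimension_shift(2)[OF X N ac]])
  qed
qed

section \<open>Direct sums\<close>

definition dsum_mod :: "['s set, ('a, 'b, _) module_scheme] \<Rightarrow> ('a, 's \<Rightarrow> 'b) module"
  where "dsum_mod S A =
    \<lparr>carrier = {v. (\<forall>s. v s \<in> carrier A) \<and> (\<forall>s. s \<notin> S \<longrightarrow> v s = \<zero>\<^bsub>A\<^esub>) \<and> finite {s. v s \<noteq> \<zero>\<^bsub>A\<^esub>}},
     mult = undefined, one = undefined,
     zero = (\<lambda>s. \<zero>\<^bsub>A\<^esub>), add = (\<lambda>v w s. v s \<oplus>\<^bsub>A\<^esub> w s), smult = (\<lambda>a v s. a \<odot>\<^bsub>A\<^esub> v s)\<rparr>"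

lemma dsum_mod_simps:
  "\<zero>\<^bsub>dsum_mod S A\<^esub> = (\<lambda>s. \<zero>\<^bsub>A\<^esub>)"
  "v \<oplus>\<^bsub>dsum_mod S A\<^esub> w = (\<lambda>s. v s \<oplus>\<^bsub>A\<^esub> w s)"
  "a \<odot>\<^bsub>dsum_mod S A\<^esub> v = (\<lambda>s. a \<odot>\<^bsub>A\<^esub> v s)"
  by (simp_all add: dsum_mod_def)

lemma dsum_mod_carrier:
  "v \<in> carrier (dsum_mod S A) \<longleftrightarrow>
    (\<forall>s. v s \<in> carrier A) \<and> (\<forall>s. s \<notin> S \<longrightarrow> v s = \<zero>\<^bsub>A\<^esub>) \<and> finite {s. v s \<noteq> \<zero>\<^bsub>A\<^esub>}"
  by (simp add: dsum_mod_def)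

lemma dsum_mod_pointwise:
  assumes "v \<in> carrier (dsum_mod S A)" "w \<in> carrier (dsum_mod S A)" "\<And>s. u s \<in> carrier A"
    and "\<And>s. v s = \<zero>\<^bsub>A\<^esub> \<Longrightarrow> w s = \<zero>\<^bsub>A\<^esub> \<Longrightarrow> u s = \<zero>\<^bsub>A\<^esub>"
  shows "u \<in> carrier (dsum_mod S A)"
proof -
  have "{s. u s \<noteq> \<zero>\<^bsub>A\<^esub>} \<subseteq> {s. v s \<noteq> \<zero>\<^bsub>A\<^esub>} \<union> {s. w s \<noteq> \<zero>\<^bsub>A\<^esub>}" using assms(4) by auto
  then have "finite {s. u s \<noteq> \<zero>\<^bsub>A\<^esub>}"
    using assms(1,2) by (auto simp: dsum_mod_carrier intro: finite_subset)
  then show ?thesis using assms by (auto simp: dsum_mod_carrier)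
qed

lemma module_dsum_mod:
  assumes "module R A"
  shows "module R (dsum_mod S A)"
proof -
  interpret A: module R A by fact
  have c: "v s \<in> carrier A" if "v \<in> carrier (dsum_mod S A)" for v s
    using that by (simp add: dsum_mod_carrier)
  show ?thesis
  proof (rule moduleI[OF A.R.is_cring])
    show "abelian_group (dsum_mod S A)"
    proof (rule abelian_groupI)
      fix v assume v: "v \<in> carrier (dsum_mod S A)"
      have "(\<lambda>s. \<ominus>\<^bsub>A\<^esub> v s) \<in> carrier (dsum_mod S A)"
        by (rule dsum_mod_pointwise[OF v v]) (simp_all add: c[OF v] A.a_inv_zero)
      then show "\<exists>w\<in>carrier (dsum_mod S A). w \<oplus>\<^bsub>dsum_mod S A\<^esub> v = \<zero>\<^bsub>dsum_mod S A\<^esub>"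
        by (intro bexI[of _ "\<lambda>s. \<ominus>\<^bsub>A\<^esub> v s"]) (simp_all add: dsum_mod_simps c[OF v] A.l_neg)
    next
      fix v w assume v: "v \<in> carrier (dsum_mod S A)" "w \<in> carrier (dsum_mod S A)"
      then show "v \<oplus>\<^bsub>dsum_mod S A\<^esub> w \<in> carrier (dsum_mod S A)"
        unfolding dsum_mod_simps by (intro dsum_mod_pointwise[OF v]) (simp_all add: c)
    next
      show "\<zero>\<^bsub>dsum_mod S A\<^esub> \<in> carrier (dsum_mod S A)"
        by (simp add: dsum_mod_carrier dsum_mod_simps)
    qed (auto simp: dsum_mod_simps c A.a_ac)
  next
    fix a v assume v: "a \<in> carrier R" "v \<in> carrier (dsum_mod S A)"
    then show "a \<odot>\<^bsub>dsum_mod S A\<^esub> v \<in> carrier (dsum_mod S A)"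
      unfolding dsum_mod_simps by (intro dsum_mod_pointwise[OF v(2) v(2)]) (simp_all add: c)
  qed (auto simp: dsum_mod_simps c A.smult_l_distr A.smult_r_distr A.smult_assoc1)
qed

definition dsum_single :: "[('a, 'b, _) module_scheme, 's, 'b] \<Rightarrow> 's \<Rightarrow> 'b"
  where "dsum_single A s a = (\<lambda>t. if t = s then a else \<zero>\<^bsub>A\<^esub>)"

lemma dsum_single_hom:
  assumes "module R A" "s \<in> S"
  shows "(\<lambda>a\<in>carrier A. dsum_single A s a) \<in> mod_hom R A (dsum_mod S A)"
proof -
  interpret A: module R A by fact
  show ?thesis
    by (rule mod_homI[OF assms(1)])
      (use assms(2) in \<open>auto simp: dsum_mod_carrier dsum_mod_simps dsum_single_def\<close>)
qed

lemma dsum_mod_hom_ext: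
  assumes "module R A" "module R N" "f \<in> mod_hom R (dsum_mod S A) N" "g \<in> mod_hom R (dsum_mod S A) N"
    and eq: "\<And>s a. s \<in> S \<Longrightarrow> a \<in> carrier A \<Longrightarrow> f (dsum_single A s a) = g (dsum_single A s a)"
  shows "f = g"
proof (rule mod_hom_ext[OF assms(3,4)])
  interpret A: module R A by fact
  fix v assume v: "v \<in> carrier (dsum_mod S A)"
  then have "finite {s. v s \<noteq> \<zero>\<^bsub>A\<^esub>}" by (simp add: dsum_mod_carrier)
  \<comment> \<open>The induction is over a finite set containing the support, for all v at once, so
    that v with the coordinate s cleared falls under the induction hypothesis.\<close>
  moreover have "\<forall>v. v \<in> carrier (dsum_mod S A) \<and> {s. v s \<noteq> \<zero>\<^bsub>A\<^esub>} \<subseteq> B \<longrightarrow> f v = g v" if "finite B" for B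
    using that
  proof (induction B)
    case empty
    have "f v = g v" if "v \<in> carrier (dsum_mod S A)" "{s. v s \<noteq> \<zero>\<^bsub>A\<^esub>} \<subseteq> {}" for v
    proof -
      have "v = \<zero>\<^bsub>dsum_mod S A\<^esub>" using that(2) by (auto simp: dsum_mod_simps)
      then show ?thesis
        using mod_hom_zero[OF module_dsum_mod[OF assms(1)] assms(2,3)]
          mod_hom_zero[OF module_dsum_mod[OF assms(1)] assms(2,4)] by simp
    qed
    then show ?case by blast
  next
    case (insert s B)
    have "f v = g v" if vc: "v \<in> carrier (dsum_mod S A)" and sub: "{t. v t \<noteq> \<zero>\<^bsub>A\<^esub>} \<subseteq> insert s B" for v
    proof (cases "s \<in> S")
      case True
      have v': "v(s := \<zero>\<^bsub>A\<^esub>) \<in> carrier (dsum_mod S A)"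
        by (rule dsum_mod_pointwise[OF vc vc]) (use vc in \<open>auto simp: dsum_mod_carrier\<close>)
      have "{t. (v(s := \<zero>\<^bsub>A\<^esub>)) t \<noteq> \<zero>\<^bsub>A\<^esub>} \<subseteq> B" using sub by auto
      then have fv': "f (v(s := \<zero>\<^bsub>A\<^esub>)) = g (v(s := \<zero>\<^bsub>A\<^esub>))" using insert.IH v' by blast
      have vs: "v s \<in> carrier A" using vc by (simp add: dsum_mod_carrier)
      have single: "dsum_single A s (v s) \<in> carrier (dsum_mod S A)"
        using mod_homD(1)[OF dsum_single_hom[OF assms(1) True] vs] vs by simp
      have dec: "v = dsum_single A s (v s) \<oplus>\<^bsub>dsum_mod S A\<^esub> v(s := \<zero>\<^bsub>A\<^esub>)"
        using vc by (auto simp: dsum_mod_simps dsum_single_def dsum_mod_carrier fun_eq_iff)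
      have hv: "h v = h (dsum_single A s (v s)) \<oplus>\<^bsub>N\<^esub> h (v(s := \<zero>\<^bsub>A\<^esub>))"
        if "h \<in> mod_hom R (dsum_mod S A) N" for h
        using mod_homD(2)[OF that single v'] dec by simp
      show ?thesis using hv[OF assms(3)] hv[OF assms(4)] fv' eq[OF True vs] by simp
    next
      case False
      then have "{t. v t \<noteq> \<zero>\<^bsub>A\<^esub>} \<subseteq> B" using sub vc by (auto simp: dsum_mod_carrier)
      then show ?thesis using insert.IH vc by blast
    qed
    then show ?case by blast
  qed
  ultimately show "f v = g v" using v by blast
qed

definition dsum_lift ::
  "['s set, ('a, 'b, _) module_scheme, ('a, 'd, _) module_scheme, 's \<Rightarrow> 'b \<Rightarrow> 'd] \<Rightarrow> ('s \<Rightarrow> 'b) \<Rightarrow> 'd"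
  where "dsum_lift S A N \<psi> =
    (\<lambda>v\<in>carrier (dsum_mod S A). \<Oplus>\<^bsub>N\<^esub>s\<in>{s. v s \<noteq> \<zero>\<^bsub>A\<^esub>}. \<psi> s (v s))"

lemma dsum_lift:
  assumes A: "module R A" and N: "module R N" and \<psi>: "\<And>s. s \<in> S \<Longrightarrow> \<psi> s \<in> mod_hom R A N"
  shows dsum_lift_hom: "dsum_lift S A N \<psi> \<in> mod_hom R (dsum_mod S A) N"
    and dsum_lift_single: "\<And>s a. s \<in> S \<Longrightarrow> a \<in> carrier A \<Longrightarrow>
      dsum_lift S A N \<psi> (dsum_single A s a) = \<psi> s a"
proof -
  interpret A: module R A by fact
  interpret N: module R N by fact
  let ?l = "dsum_lift S A N \<psi>"
  note \<psi>D = mod_homD[OF \<psi>]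
  have \<psi>0: "s \<in> S \<Longrightarrow> \<psi> s \<zero>\<^bsub>A\<^esub> = \<zero>\<^bsub>N\<^esub>" for s by (rule mod_hom_zero[OF A N \<psi>])
  have vc: "v s \<in> carrier A" "finite {s. v s \<noteq> \<zero>\<^bsub>A\<^esub>}" "{s. v s \<noteq> \<zero>\<^bsub>A\<^esub>} \<subseteq> S"
    if "v \<in> carrier (dsum_mod S A)" for v s
    using that by (auto simp: dsum_mod_carrier)
  \<comment> \<open>As \<psi> s maps 0 to 0, the sum may run over any finite B between the support
    and S. Two families can then be added over a common index set.\<close>
  have sup: "?l v = (\<Oplus>\<^bsub>N\<^esub>s\<in>B. \<psi> s (v s))"
    if v: "v \<in> carrier (dsum_mod S A)" and B: "finite B" "{s. v s \<noteq> \<zero>\<^bsub>A\<^esub>} \<subseteq> B" "B \<subseteq> S" for v B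
  proof -
    have "(\<Oplus>\<^bsub>N\<^esub>s\<in>{s. v s \<noteq> \<zero>\<^bsub>A\<^esub>}. \<psi> s (v s)) = (\<Oplus>\<^bsub>N\<^esub>s\<in>B. \<psi> s (v s))"
      by (rule N.add.finprod_mono_neutral_cong_left)
        (use B vc[OF v] \<psi>0 \<psi>D(1) in \<open>auto simp: subset_iff\<close>)
    then show ?thesis using v by (simp add: dsum_lift_def)
  qed
  interpret D: module R "dsum_mod S A" by (rule module_dsum_mod[OF A])
  have "(\<lambda>v\<in>carrier (dsum_mod S A). ?l v) \<in> mod_hom R (dsum_mod S A) N"
  proof (rule mod_homI[OF D.module_axioms])
    show "?l v \<in> carrier N" if "v \<in> carrier (dsum_mod S A)" for v
      unfolding sup[OF that vc(2)[OF that] order_refl vc(3)[OF that]]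
      using vc[OF that] \<psi>D(1) by (intro N.finsum_closed) (auto simp: subset_iff)
  next
    fix v w assume v: "v \<in> carrier (dsum_mod S A)" and w: "w \<in> carrier (dsum_mod S A)"
    let ?B = "{s. v s \<noteq> \<zero>\<^bsub>A\<^esub>} \<union> {s. w s \<noteq> \<zero>\<^bsub>A\<^esub>}"
    have B: "finite ?B" "?B \<subseteq> S" using vc v w by auto
    have BS: "v s \<noteq> \<zero>\<^bsub>A\<^esub> \<Longrightarrow> s \<in> S" "w s \<noteq> \<zero>\<^bsub>A\<^esub> \<Longrightarrow> s \<in> S" for s using B by blast+
    have vw: "v s \<in> carrier A" "w s \<in> carrier A" for s using vc v w by auto
    have "?l (v \<oplus>\<^bsub>dsum_mod S A\<^esub> w) = (\<Oplus>\<^bsub>N\<^esub>s\<in>?B. \<psi> s ((v \<oplus>\<^bsub>dsum_mod S A\<^esub> w) s))"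
      by (rule sup[OF D.a_closed[OF v w] B(1) _ B(2)]) (auto simp: dsum_mod_simps)
    also have "\<dots> = (\<Oplus>\<^bsub>N\<^esub>s\<in>?B. \<psi> s (v s) \<oplus>\<^bsub>N\<^esub> \<psi> s (w s))"
      using BS vw \<psi>D by (intro N.add.finprod_cong') (auto simp: dsum_mod_simps)
    also have "\<dots> = (\<Oplus>\<^bsub>N\<^esub>s\<in>?B. \<psi> s (v s)) \<oplus>\<^bsub>N\<^esub> (\<Oplus>\<^bsub>N\<^esub>s\<in>?B. \<psi> s (w s))"
      using BS vw \<psi>D(1) B by (intro N.finsum_addf) auto
    also have "\<dots> = ?l v \<oplus>\<^bsub>N\<^esub> ?l w"
      using sup[OF v B(1) _ B(2)] sup[OF w B(1) _ B(2)] by simp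
    finally show "?l (v \<oplus>\<^bsub>dsum_mod S A\<^esub> w) = ?l v \<oplus>\<^bsub>N\<^esub> ?l w" .
  next
    fix a v assume a: "a \<in> carrier R" and v: "v \<in> carrier (dsum_mod S A)"
    let ?B = "{s. v s \<noteq> \<zero>\<^bsub>A\<^esub>}"
    have B: "finite ?B" "?B \<subseteq> S" using vc v by auto
    have BS: "v s \<noteq> \<zero>\<^bsub>A\<^esub> \<Longrightarrow> s \<in> S" for s using B by blast
    have vA: "v s \<in> carrier A" for s using vc v by auto
    have "?l (a \<odot>\<^bsub>dsum_mod S A\<^esub> v) = (\<Oplus>\<^bsub>N\<^esub>s\<in>?B. \<psi> s ((a \<odot>\<^bsub>dsum_mod S A\<^esub> v) s))"
      by (rule sup[OF D.smult_closed[OF a v] B(1) _ B(2)]) (use a in \<open>auto simp: dsum_mod_simps\<close>)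
    also have "\<dots> = (\<Oplus>\<^bsub>N\<^esub>s\<in>?B. a \<odot>\<^bsub>N\<^esub> \<psi> s (v s))"
      using BS vA \<psi>D a by (intro N.add.finprod_cong') (auto simp: dsum_mod_simps)
    also have "\<dots> = a \<odot>\<^bsub>N\<^esub> (\<Oplus>\<^bsub>N\<^esub>s\<in>?B. \<psi> s (v s))"
      using BS vA \<psi>D(1) B a by (intro N.finsum_smult_ldistr[symmetric]) auto
    also have "\<dots> = a \<odot>\<^bsub>N\<^esub> ?l v" using sup[OF v B(1) order_refl B(2)] by simp
    finally show "?l (a \<odot>\<^bsub>dsum_mod S A\<^esub> v) = a \<odot>\<^bsub>N\<^esub> ?l v" .
  qed
  moreover have "(\<lambda>v\<in>carrier (dsum_mod S A). ?l v) = ?l"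
    by (rule extensional_restrict) (simp only: dsum_lift_def restrict_extensional)
  ultimately show "?l \<in> mod_hom R (dsum_mod S A) N" by simp
  show "?l (dsum_single A s a) = \<psi> s a" if "s \<in> S" "a \<in> carrier A" for s a
  proof -
    have "dsum_single A s a \<in> carrier (dsum_mod S A)"
      using mod_homD(1)[OF dsum_single_hom[OF A that(1)] that(2)] that by simp
    then have "?l (dsum_single A s a) = (\<Oplus>\<^bsub>N\<^esub>t\<in>{s}. \<psi> t (dsum_single A s a t))"
      using that by (intro sup) (auto simp: dsum_single_def)
    then show ?thesis using that \<psi>D(1) by (simp add: dsum_single_def)
  qed
qed

text \<open>The inclusion of each summand lifts to the free cover of the sum, and
  \<open>dsum_lift\<close> glues the lifts to a splitting.\<close>

lemma projective_dsum_mod: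
  assumes "projective R G"
  shows "projective R (dsum_mod S G)"
proof -
  have G: "module R G" by (rule projective_module[OF assms])
  interpret G: module R G by (rule G)
  have D: "module R (dsum_mod S G)" by (rule module_dsum_mod[OF G])
  define F c where "F = free_mod R (carrier (dsum_mod S G))"
    and "c = free_lift R (carrier (dsum_mod S G)) (dsum_mod S G) (\<lambda>x. x)"
  have F: "module R F" unfolding F_def by (rule module_free_mod[OF G.R.is_cring])
  note c = free_cover[OF D, folded F_def c_def]
  have "\<exists>k\<in>mod_hom R G F. \<forall>a\<in>carrier G. c (k a) = (\<lambda>a\<in>carrier G. dsum_single G s a) a" if "s \<in> S" for s
    using projective_lift[OF assms F D c(1) dsum_single_hom[OF G that]]
      mod_homD(1)[OF dsum_single_hom[OF G that]] c(2) by simp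
  then obtain k where k: "\<And>s. s \<in> S \<Longrightarrow> k s \<in> mod_hom R G F"
    "\<And>s a. s \<in> S \<Longrightarrow> a \<in> carrier G \<Longrightarrow> c (k s a) = dsum_single G s a" by (metis restrict_apply')
  let ?l = "dsum_lift S G F k"
  have l: "?l \<in> mod_hom R (dsum_mod S G) F" by (rule dsum_lift_hom[OF G F k(1)])
  have single: "dsum_single G s a \<in> carrier (dsum_mod S G)" if "s \<in> S" "a \<in> carrier G" for s a
    using mod_homD(1)[OF dsum_single_hom[OF G that(1)] that(2)] that by simp
  have eq: "compose (carrier (dsum_mod S G)) c ?l = (\<lambda>v\<in>carrier (dsum_mod S G). v)"
    by (rule dsum_mod_hom_ext[OF G D mod_hom_compose[OF D l c(1)] mod_hom_id[OF D]])
      (simp add: compose_eq single dsum_lift_single[OF G F k(1)] k(2))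
  have "c (?l v) = v" if "v \<in> carrier (dsum_mod S G)" for v
    using that fun_cong[OF eq, of v] by (simp add: compose_eq)
  then show ?thesis
    by (intro projectiveI[OF D, folded F_def c_def, OF l])
qed

definition dsum_map :: "['s set, ('a, 'b, _) module_scheme, 'b \<Rightarrow> 'c] \<Rightarrow> ('s \<Rightarrow> 'b) \<Rightarrow> 's \<Rightarrow> 'c"
  where "dsum_map S A f = (\<lambda>v\<in>carrier (dsum_mod S A). \<lambda>s. f (v s))"

lemma dsum_map_hom:
  assumes "module R A" "module R B" "f \<in> mod_hom R A B"
  shows "dsum_map S A f \<in> mod_hom R (dsum_mod S A) (dsum_mod S B)"
  unfolding dsum_map_def
proof (rule mod_homI[OF module_dsum_mod[OF assms(1)]])
  note f = mod_homD[OF assms(3)] mod_hom_zero[OF assms]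
  fix v assume v: "v \<in> carrier (dsum_mod S A)"
  have "{s. f (v s) \<noteq> \<zero>\<^bsub>B\<^esub>} \<subseteq> {s. v s \<noteq> \<zero>\<^bsub>A\<^esub>}" using f(4) by auto
  then show "(\<lambda>s. f (v s)) \<in> carrier (dsum_mod S B)"
    using v f by (auto simp: dsum_mod_carrier intro: finite_subset)
qed (auto simp: dsum_mod_simps dsum_mod_carrier mod_homD[OF assms(3)])

lemma dsum_map_image:
  assumes "module R A" "module R B" "f \<in> mod_hom R A B"
    and v: "v \<in> carrier (dsum_mod S B)" "\<And>s. v s \<in> f ` carrier A"
  shows "v \<in> dsum_map S A f ` carrier (dsum_mod S A)"
proof -
  interpret A: module R A by fact
  have "\<exists>a\<in>carrier A. f a = v s" for s using v(2)[of s] by auto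
  then obtain u where u: "\<And>s. u s \<in> carrier A" "\<And>s. f (u s) = v s" by metis
  \<comment> \<open>Preimages are used only where v is nonzero, which keeps the support
    finite.\<close>
  define w where "w s = (if v s = \<zero>\<^bsub>B\<^esub> then \<zero>\<^bsub>A\<^esub> else u s)" for s
  have "{s. w s \<noteq> \<zero>\<^bsub>A\<^esub>} \<subseteq> {s. v s \<noteq> \<zero>\<^bsub>B\<^esub>}" by (auto simp: w_def)
  then have w1: "w \<in> carrier (dsum_mod S A)"
    using u v(1) by (auto simp: dsum_mod_carrier w_def intro: finite_subset)
  have w2: "dsum_map S A f w = v"
    using w1 u(2) mod_hom_zero[OF assms(1-3)] by (auto simp: dsum_map_def fun_eq_iff w_def)
  show ?thesis using imageI[OF w1, of "dsum_map S A f"] unfolding w2 .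
qed

lemma dsum_resolution:
  assumes P: "projective_resolution R C P d e" and C: "module R C"
  shows "projective_resolution R (dsum_mod S C) (\<lambda>n. dsum_mod S (P n))
    (\<lambda>n. dsum_map S (P (Suc n)) (d n)) (dsum_map S (P 0) e)"
proof -
  note PR = projective_resolutionD[OF P C]
  note PD = resolutionD[OF PR(1)]
  have dh: "dsum_map S (P (Suc n)) (d n) \<in> mod_hom R (dsum_mod S (P (Suc n))) (dsum_mod S (P n))" for n
    by (rule dsum_map_hom[OF PD(2,2,4)])
  have eh: "dsum_map S (P 0) e \<in> mod_hom R (dsum_mod S (P 0)) (dsum_mod S C)"
    by (rule dsum_map_hom[OF PD(2,3,5)])
  have cP: "v s \<in> carrier (P n)" if "v \<in> carrier (dsum_mod S (P n))" for v s n
    using that by (simp add: dsum_mod_carrier)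
  have dd: "dsum_map S (P (Suc n)) (d n) (dsum_map S (P (Suc (Suc n))) (d (Suc n)) v) = \<zero>\<^bsub>dsum_mod S (P n)\<^esub>"
    if "v \<in> carrier (dsum_mod S (P (Suc (Suc n))))" for n v
    using mod_homD(1)[OF dh that] that PD(6)[OF cP[OF that]] by (simp add: dsum_map_def dsum_mod_simps)
  have ed: "dsum_map S (P 0) e (dsum_map S (P (Suc 0)) (d 0) v) = \<zero>\<^bsub>dsum_mod S C\<^esub>"
    if "v \<in> carrier (dsum_mod S (P (Suc 0)))" for v
    using mod_homD(1)[OF dh that] that PD(7)[OF cP[OF that]] by (simp add: dsum_map_def dsum_mod_simps)
  have surj: "v \<in> dsum_map S (P 0) e ` carrier (dsum_mod S (P 0))" if "v \<in> carrier (dsum_mod S C)" for v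
    by (rule dsum_map_image[OF PD(2,3,5) that]) (use that PD(8) in \<open>simp add: dsum_mod_carrier\<close>)
  have ex0: "v \<in> dsum_map S (P (Suc 0)) (d 0) ` carrier (dsum_mod S (P (Suc 0)))"
    if "v \<in> carrier (dsum_mod S (P 0))" "dsum_map S (P 0) e v = \<zero>\<^bsub>dsum_mod S C\<^esub>" for v
  proof (rule dsum_map_image[OF PD(2,2,4) that(1)])
    show "v s \<in> d 0 ` carrier (P (Suc 0))" for s
      using PD(9)[OF cP[OF that(1)]] that by (auto simp: dsum_map_def dsum_mod_simps fun_eq_iff)
  qed
  have ex: "v \<in> dsum_map S (P (Suc (Suc n))) (d (Suc n)) ` carrier (dsum_mod S (P (Suc (Suc n))))"
    if "v \<in> carrier (dsum_mod S (P (Suc n)))"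
      "dsum_map S (P (Suc n)) (d n) v = \<zero>\<^bsub>dsum_mod S (P n)\<^esub>" for n v
  proof (rule dsum_map_image[OF PD(2,2,4) that(1)])
    show "v s \<in> d (Suc n) ` carrier (P (Suc (Suc n)))" for s
      using PD(10)[OF cP[OF that(1)]] that by (auto simp: dsum_map_def dsum_mod_simps fun_eq_iff)
  qed
  show ?thesis
    unfolding projective_resolution_def aug_complex_def aug_exact_def
    using projective_dsum_mod[OF PR(2)] dh eh dd ed surj ex0 ex mod_homD(1)[OF dh] mod_homD(1)[OF eh]
    by (intro conjI allI ballI equalityI subsetI) auto
qed

text \<open>Hom out of a direct sum is a product of Homs. A cocycle splits into one cocycle per
  summand, each of them has a primitive, and the chosen primitives glue, for S of any size.\<close>

lemma hom_acyclic_dsum_mod: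
  fixes C :: "('a, 'c, 'k) module_scheme"
  assumes "hom_acyclic R C N" and C: "module R C" and N: "module R N"
  shows "hom_acyclic R (dsum_mod S C) N"
proof -
  obtain P :: "nat \<Rightarrow> ('a, ('a, 'c) res) module" and d e where P: "projective_resolution R C P d e"
    using ex_projective_resolution[OF C] by blast
  note PD = resolutionD[OF projective_resolutionD(1)[OF P C]]
  have ac: "cocycles R P d N (Suc i) \<subseteq> coboundaries R P d N (Suc i)" for i
    using assms(1) hom_acyclic_iff[OF P C N] by blast
  let ?P = "\<lambda>n. dsum_mod S (P n)" and ?d = "\<lambda>n. dsum_map S (P (Suc n)) (d n)"
  note DP = dsum_resolution[OF P C, of S]
  note DD = resolutionD[OF projective_resolutionD(1)[OF DP module_dsum_mod[OF C]]]
  have single: "dsum_single (P n) s a \<in> carrier (?P n)" if "s \<in> S" "a \<in> carrier (P n)" for n s a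
    using mod_homD(1)[OF dsum_single_hom[OF PD(2) that(1)] that(2)] that by simp
  have d_single: "?d n (dsum_single (P (Suc n)) s a) = dsum_single (P n) s (d n a)"
    if "s \<in> S" "a \<in> carrier (P (Suc n))" for n s a
    using single[OF that] mod_hom_zero[OF PD(2,2,4)] by (auto simp: dsum_map_def dsum_single_def)
  have "f \<in> coboundaries R ?P ?d N (Suc i)" if f: "f \<in> cocycles R ?P ?d N (Suc i)" for f i
  proof -
    have fh: "f \<in> mod_hom R (?P (Suc i)) N"
      and fd: "\<And>v. v \<in> carrier (?P (Suc (Suc i))) \<Longrightarrow> f (?d (Suc i) v) = \<zero>\<^bsub>N\<^esub>"
      using f by (auto simp: cocycles_def)
    have "\<exists>\<psi>\<in>mod_hom R (P i) N. \<forall>a\<in>carrier (P (Suc i)). f (dsum_single (P (Suc i)) s a) = \<psi> (d i a)"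
      if s: "s \<in> S" for s
    proof -
      let ?f = "compose (carrier (P (Suc i))) f (\<lambda>a\<in>carrier (P (Suc i)). dsum_single (P (Suc i)) s a)"
      have "?f \<in> mod_hom R (P (Suc i)) N"
        by (rule mod_hom_compose[OF PD(2) dsum_single_hom[OF PD(2) s] fh])
      moreover have "?f (d (Suc i) a) = \<zero>\<^bsub>N\<^esub>" if a: "a \<in> carrier (P (Suc (Suc i)))" for a
        using fd[OF single[OF s a]] d_single[OF s a] mod_homD(1)[OF PD(4) a] by (simp add: compose_eq)
      ultimately have "?f \<in> coboundaries R P d N (Suc i)" using ac by (auto simp: cocycles_def)
      then show ?thesis by (auto simp: coboundaries_Suc compose_eq)
    qed
    then obtain \<psi> where \<psi>: "\<And>s. s \<in> S \<Longrightarrow> \<psi> s \<in> mod_hom R (P i) N"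
      "\<And>s a. s \<in> S \<Longrightarrow> a \<in> carrier (P (Suc i)) \<Longrightarrow> f (dsum_single (P (Suc i)) s a) = \<psi> s (d i a)"
      by metis
    let ?\<psi> = "dsum_lift S (P i) N \<psi>"
    have \<psi>h: "?\<psi> \<in> mod_hom R (?P i) N" by (rule dsum_lift_hom[OF PD(2) N \<psi>(1)])
    have eq: "f = compose (carrier (?P (Suc i))) ?\<psi> (?d i)"
      by (rule dsum_mod_hom_ext[OF PD(2) N fh mod_hom_compose[OF DD(2,4) \<psi>h]])
        (use mod_homD(1)[OF PD(4)] in
          \<open>simp add: compose_eq single d_single \<psi>(2) dsum_lift_single[OF PD(2) N \<psi>(1)]\<close>)
    have "f v = ?\<psi> (?d i v)" if "v \<in> carrier (?P (Suc i))" for v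
      using fun_cong[OF eq, of v] that by (simp add: compose_eq)
    then show ?thesis using fh \<psi>h by (auto simp: coboundaries_Suc)
  qed
  then show ?thesis unfolding hom_acyclic_iff[OF DP module_dsum_mod[OF C] N] by blast
qed

text \<open>\<sigma> and \<rho> lift to chain maps s and r, and r s lifts the identity of B. So a
  cocycle f is cohomologous to f r s, where f r is a coboundary because A is acyclic.\<close>

lemma hom_acyclic_retract:
  fixes A :: "('a, 'x, 'm) module_scheme" and B :: "('a, 'y, 'k) module_scheme"
  assumes ac: "hom_acyclic R A N" and A: "module R A" and B: "module R B" and N: "module R N"
    and \<sigma>: "\<sigma> \<in> mod_hom R B A" and \<rho>: "\<rho> \<in> mod_hom R A B" and \<rho>\<sigma>: "\<And>b. b \<in> carrier B \<Longrightarrow> \<rho> (\<sigma> b) = b"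
  shows "hom_acyclic R B N"
proof -
  obtain F :: "nat \<Rightarrow> ('a, ('a, 'x) res) module" and dF eF where F: "projective_resolution R A F dF eF"
    using ex_projective_resolution[OF A] by blast
  obtain G :: "nat \<Rightarrow> ('a, ('a, 'y) res) module" and dG eG where G: "projective_resolution R B G dG eG"
    using ex_projective_resolution[OF B] by blast
  note FR = projective_resolutionD[OF F A] and GR = projective_resolutionD[OF G B]
  note FD = resolutionD[OF FR(1)] and GD = resolutionD[OF GR(1)]
  have "aug_complex R G dG B eG" using G by (simp add: projective_resolution_def)
  from chain_map_lift[OF GR(2) this B FR(1) \<sigma>] obtain s where s: "chain_map R G dG F dF s"
    "\<forall>p\<in>carrier (G 0). eF (s 0 p) = \<sigma> (eG p)" by blast
  have "aug_complex R F dF A eF" using F by (simp add: projective_resolution_def)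
  from chain_map_lift[OF FR(2) this A GR(1) \<rho>] obtain r where r: "chain_map R F dF G dG r"
    "\<forall>p\<in>carrier (F 0). eG (r 0 p) = \<rho> (eF p)" by blast
  have sh: "s n \<in> mod_hom R (G n) (F n)" for n using s(1) by (simp add: chain_map_def)
  let ?u = "\<lambda>n. compose (carrier (G n)) (r n) (s n)"
  note u = chain_map_compose[OF GD(1) s(1) r(1)]
  have eu: "eG (?u 0 p) = eG p" if "p \<in> carrier (G 0)" for p
    using that s(2) r(2) mod_homD(1)[OF sh that] \<rho>\<sigma> mod_homD(1)[OF GD(5) that] by (simp add: compose_eq)
  have "f \<in> coboundaries R G dG N (Suc i)" if f: "f \<in> cocycles R G dG N (Suc i)" for f i
  proof -
    have "compose (carrier (F (Suc i))) f (r (Suc i)) \<in> coboundaries R F dF N (Suc i)"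
      using chain_map_cocycle[OF FD(1) r(1) f] ac hom_acyclic_iff[OF F A N] by blast
    note c = chain_map_coboundary[OF GD(1) s(1) this]
    from cocycle_homotopic_id[where u = ?u, OF G B N u eu f]
    obtain b where b: "b \<in> coboundaries R G dG N (Suc i)"
      "\<forall>x\<in>carrier (G (Suc i)). f x = f (?u (Suc i) x) \<oplus>\<^bsub>N\<^esub> b x" by (rule bexE)
    show ?thesis
      by (rule coboundaries_cong[OF coboundaries_add[OF GD(1) N c b(1)]])
        (use f b(2) mod_homD(1)[OF sh] in \<open>auto simp: cocycles_def compose_eq\<close>)
  qed
  then show ?thesis unfolding hom_acyclic_iff[OF G B N] by blast
qed

section \<open>Tensoring a semidualizing module with projective modules\<close>

lemma pure_tensor_hom_left:
  assumes "module R C" "module R P" "p \<in> carrier P"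
  shows "(\<lambda>c\<in>carrier C. pure_tensor R C P c p) \<in> mod_hom R C (tensor_mod R C P)"
  by (rule mod_homI[OF assms(1)])
    (simp_all add: assms(3) pure_tensor_closed[OF assms(1,2)] pure_tensor_bilinear[OF assms(1,2)])

lemma pure_tensor_hom_right:
  assumes "module R C" "module R P" "c \<in> carrier C"
  shows "(\<lambda>p\<in>carrier P. pure_tensor R C P c p) \<in> mod_hom R P (tensor_mod R C P)"
  by (rule mod_homI[OF assms(2)])
    (simp_all add: assms(3) pure_tensor_closed[OF assms(1,2)] pure_tensor_bilinear[OF assms(1,2)])

text \<open>For fixed c this is R^(S) \<rightarrow> C^(S), acting on c in every coordinate. The map
  \<sigma> below sends c \<otimes> p to its value at s p.\<close>

lemma free_mod_smult_hom:
  assumes "module R C" "c \<in> carrier C"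
  shows "(\<lambda>f\<in>carrier (free_mod R S). \<lambda>t. f t \<odot>\<^bsub>C\<^esub> c) \<in> mod_hom R (free_mod R S) (dsum_mod S C)"
proof -
  interpret C: module R C by fact
  have F: "module R (free_mod R S)" by (rule module_free_mod[OF C.R.is_cring])
  have fR: "f t \<in> carrier R" if "f \<in> carrier (free_mod R S)" for f t
    using that by (simp add: free_mod_def)
  show ?thesis
  proof (rule mod_homI[OF F])
    fix f assume f: "f \<in> carrier (free_mod R S)"
    have "{t. f t \<odot>\<^bsub>C\<^esub> c \<noteq> \<zero>\<^bsub>C\<^esub>} \<subseteq> {t. f t \<noteq> \<zero>\<^bsub>R\<^esub>}" using assms(2) by auto
    moreover have "finite {t. f t \<noteq> \<zero>\<^bsub>R\<^esub>}" "\<And>t. t \<notin> S \<Longrightarrow> f t = \<zero>\<^bsub>R\<^esub>" using f by (auto simp: free_mod_def)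
    ultimately show "(\<lambda>t. f t \<odot>\<^bsub>C\<^esub> c) \<in> carrier (dsum_mod S C)"
      using fR[OF f] assms(2) by (auto simp: dsum_mod_carrier intro: finite_subset)
  qed (use assms(2) fR in \<open>auto simp: free_mod_simps dsum_mod_simps C.smult_l_distr C.smult_assoc1\<close>)
qed

text \<open>The maps \<open>\<sigma>\<close> and \<open>\<rho>\<close> below exhibit \<open>C \<otimes> P\<close> as a direct summand of \<open>C\<^sup>(\<^sup>S\<^sup>)\<close>.\<close>

locale tensor_retract =
  fixes R :: "('a, 'r) ring_scheme" and C :: "('a, 'c, 'k) module_scheme"
    and P :: "('a, 'p, 'l) module_scheme" and S :: "'s set" and s r
  assumes C: "module R C" and P: "module R P"
    and s: "s \<in> mod_hom R P (free_mod R S)" and r: "r \<in> mod_hom R (free_mod R S) P"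
    and rs: "\<And>p. p \<in> carrier P \<Longrightarrow> r (s p) = p"
begin

interpretation C: module R C by (rule C)
interpretation P: module R P by (rule P)

definition \<sigma> where "\<sigma> = tensor_lift R C P (dsum_mod S C) (\<lambda>c p t. s p t \<odot>\<^bsub>C\<^esub> c)"
definition \<rho> where "\<rho> = dsum_lift S C (tensor_mod R C P)
  (\<lambda>t. \<lambda>c\<in>carrier C. pure_tensor R C P c (r (free_gen R t)))"

lemma module_free: "module R (free_mod R S)"
  by (rule module_free_mod[OF C.R.is_cring])

lemma s_coeff: "p \<in> carrier P \<Longrightarrow> s p t \<in> carrier R"
  using mod_homD(1)[OF s, of p] by (simp add: free_mod_def)

lemma bilinear_\<sigma>: "bilinear R C P (dsum_mod S C) (\<lambda>c p t. s p t \<odot>\<^bsub>C\<^esub> c)"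
proof -
  have "(\<lambda>t. s p t \<odot>\<^bsub>C\<^esub> c) \<in> carrier (dsum_mod S C)" if "p \<in> carrier P" "c \<in> carrier C" for p c
    using mod_homD(1)[OF free_mod_smult_hom[OF C that(2), of S] mod_homD(1)[OF s that(1)]]
      mod_homD(1)[OF s that(1)] by simp
  moreover have "a \<odot>\<^bsub>C\<^esub> (b \<odot>\<^bsub>C\<^esub> c) = b \<odot>\<^bsub>C\<^esub> (a \<odot>\<^bsub>C\<^esub> c)"
    if "a \<in> carrier R" "b \<in> carrier R" "c \<in> carrier C" for a b c
    using that by (simp add: C.smult_assoc1[symmetric] C.R.m_comm)
  ultimately show ?thesis
    unfolding bilinear_def
    by (auto simp: dsum_mod_simps s_coeff mod_homD[OF s] free_mod_simps C.smult_r_distr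
        C.smult_l_distr C.smult_assoc1)
qed

lemma \<sigma>_hom: "\<sigma> \<in> mod_hom R (tensor_mod R C P) (dsum_mod S C)"
  and \<sigma>_pure: "c \<in> carrier C \<Longrightarrow> p \<in> carrier P \<Longrightarrow> \<sigma> (pure_tensor R C P c p) = (\<lambda>t. s p t \<odot>\<^bsub>C\<^esub> c)"
  using tensor_lift_hom_pure[OF C P module_dsum_mod[OF C] bilinear_\<sigma>] by (simp_all add: \<sigma>_def)

lemma r_gen: "t \<in> S \<Longrightarrow> r (free_gen R t) \<in> carrier P"
  by (rule mod_homD(1)[OF r free_gen_closed[OF C.R.is_cring]])

lemma \<rho>_hom: "\<rho> \<in> mod_hom R (dsum_mod S C) (tensor_mod R C P)"
  unfolding \<rho>_def
  by (rule dsum_lift_hom[OF C module_tensor_mod[OF C P] pure_tensor_hom_left[OF C P r_gen]])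

lemma \<rho>_single:
  "t \<in> S \<Longrightarrow> c \<in> carrier C \<Longrightarrow> \<rho> (dsum_single C t c) = pure_tensor R C P c (r (free_gen R t))"
  unfolding \<rho>_def
  using dsum_lift_single[OF C module_tensor_mod[OF C P] pure_tensor_hom_left[OF C P r_gen]] by simp

text \<open>Both sides are linear in f and agree on generators, where the family is a single copy of
  c. With f = s p this gives \<open>\<rho>_\<sigma>\<close>; with f a family of scalars it produces
  the element sought in \<open>semidualizing_unit_surj\<close>.\<close>

lemma \<rho>_family:
  assumes f: "f \<in> carrier (free_mod R S)" and c: "c \<in> carrier C"
  shows "\<rho> (\<lambda>t. f t \<odot>\<^bsub>C\<^esub> c) = pure_tensor R C P c (r f)"
proof -
  let ?m = "\<lambda>f\<in>carrier (free_mod R S). \<lambda>t. f t \<odot>\<^bsub>C\<^esub> c" and ?p = "\<lambda>p\<in>carrier P. pure_tensor R C P c p"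
  note m = free_mod_smult_hom[OF C c, of S] and p = pure_tensor_hom_right[OF C P c]
  have gen: "free_gen R t \<in> carrier (free_mod R S)" if "t \<in> S" for t
    by (rule free_gen_closed[OF C.R.is_cring that])
  have "(\<lambda>t'. free_gen R t t' \<odot>\<^bsub>C\<^esub> c) = dsum_single C t c" for t :: 's
    using c by (auto simp: free_gen_def dsum_single_def)
  then have g: "\<rho> (\<lambda>t'. free_gen R t t' \<odot>\<^bsub>C\<^esub> c) = pure_tensor R C P c (r (free_gen R t))" if "t \<in> S" for t
    using \<rho>_single[OF that c] by simp
  have eq: "compose (carrier (free_mod R S)) \<rho> ?m = compose (carrier (free_mod R S)) ?p r"
    by (intro free_mod_hom_ext[OF module_tensor_mod[OF C P] mod_hom_compose[OF module_free m \<rho>_hom]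
          mod_hom_compose[OF module_free r p]])
      (simp add: compose_eq gen r_gen g)
  show ?thesis
    using fun_cong[OF eq, of f] f mod_homD(1)[OF r f] by (simp add: compose_eq)
qed

lemma \<rho>_\<sigma>:
  assumes "u \<in> carrier (tensor_mod R C P)"
  shows "\<rho> (\<sigma> u) = u"
proof -
  note T = module_tensor_mod[OF C P]
  have eq: "compose (carrier (tensor_mod R C P)) \<rho> \<sigma> = (\<lambda>u\<in>carrier (tensor_mod R C P). u)"
    by (rule tensor_mod_hom_ext[OF C P T mod_hom_compose[OF T \<sigma>_hom \<rho>_hom] mod_hom_id[OF T]])
      (simp add: compose_eq pure_tensor_closed[OF C P] \<sigma>_pure \<rho>_family mod_homD(1)[OF s] rs)
  show ?thesis using fun_cong[OF eq, of u] assms by (simp add: compose_eq)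
qed

end

lemma tensor_projective_acyclic:
  fixes C :: "('a, 'c, 'k) module_scheme" and P :: "('a, 'p, 'l) module_scheme"
  assumes "hom_acyclic R C N" "module R C" "module R N" "projective R P"
  shows "hom_acyclic R (tensor_mod R C P) N"
proof -
  note P = projective_module[OF assms(4)]
  obtain S :: "'p set" and s r where s: "s \<in> mod_hom R P (free_mod R S)" "r \<in> mod_hom R (free_mod R S) P"
    "\<forall>x\<in>carrier P. r (s x) = x"
    using assms(4) unfolding projective_def by blast
  interpret tensor_retract R C P S s r
    by (rule tensor_retract.intro) (use assms(2) P s in auto)
  show ?thesis
    by (rule hom_acyclic_retract[where \<sigma> = \<sigma> and \<rho> = \<rho>, OF hom_acyclic_dsum_mod[OF assms(1-3)]
          module_dsum_mod[OF assms(2)] module_tensor_mod[OF assms(2) P] assms(3) \<sigma>_hom \<rho>_hom \<rho>_\<sigma>])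
qed

section \<open>Maps from a semidualizing module into its tensor products\<close>

lemma semidualizing_fin_gen:
  fixes C :: "('a, 'c, 'k) module_scheme"
  assumes "semidualizing R C"
  shows "\<exists>X. finite X \<and> X \<subseteq> carrier C \<and> (\<forall>H. submodule H R C \<and> X \<subseteq> H \<longrightarrow> carrier C \<subseteq> H)"
proof -
  have C: "module R C" using assms by (simp add: semidualizing_def)
  obtain P :: "nat \<Rightarrow> ('a, ('a, 'c) res) module" and d e where
    P: "projective_resolution R C P d e" and fg: "fin_gen R (P 0)"
    using assms unfolding semidualizing_def by blast
  note PD = resolutionD[OF projective_resolutionD(1)[OF P C]]
  interpret P0: module R "P 0" by (rule PD(2))
  interpret C: module R C by (rule C)
  note e = mod_homD[OF PD(5)] mod_hom_zero[OF PD(2,3,5)] mod_hom_a_inv[OF PD(2,3,5)]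
  obtain X where X: "finite X" "X \<subseteq> carrier (P 0)" "submod_span R (P 0) X = carrier (P 0)"
    using fg by (auto simp: fin_gen_def)
  \<comment> \<open>Generation is expressed through submodules because it is applied to kernels: a
    map that vanishes on the generators is zero. Pulling H back along e reduces the claim to the
    generators of \<open>P 0\<close>.\<close>
  have "carrier C \<subseteq> H" if H: "submodule H R C" and sub: "e ` X \<subseteq> H" for H
  proof -
    have "submodule {p \<in> carrier (P 0). e p \<in> H} R (P 0)"
      by (rule P0.submoduleI)
        (use C.submoduleE[OF H] e subgroup.one_closed[OF submodule.axioms(1)[OF H]] in auto)
    then have "carrier (P 0) \<subseteq> {p \<in> carrier (P 0). e p \<in> H}"
      using submod_span_least[of _ R "P 0" X] X(2,3) sub by blast
    then show ?thesis unfolding PD(8)[symmetric] by auto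
  qed
  then show ?thesis using X e(1) by (intro exI[of _ "e ` X"]) auto
qed

text \<open>Under \<sigma>, the tensor c \<otimes> p has the coordinates s p t times c. If they
  vanish for all c, each scalar s p t annihilates C and is 0 by injectivity of the homothety
  map.\<close>

lemma semidualizing_unit_inj:
  fixes C :: "('a, 'c, 'k) module_scheme" and P :: "('a, 'p, 'l) module_scheme"
  assumes sd: "semidualizing R C" and pr: "projective R P"
    and p: "p \<in> carrier P" "\<And>c. c \<in> carrier C \<Longrightarrow> pure_tensor R C P c p = \<zero>\<^bsub>tensor_mod R C P\<^esub>"
  shows "p = \<zero>\<^bsub>P\<^esub>"
proof -
  have C: "module R C" and h: "inj_on (homothety R C) (carrier R)"
    using sd by (auto simp: semidualizing_def is_mod_iso_def bij_betw_def regular_mod_def)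
  note P = projective_module[OF pr]
  obtain S :: "'p set" and s r where s: "s \<in> mod_hom R P (free_mod R S)" "r \<in> mod_hom R (free_mod R S) P"
    "\<forall>x\<in>carrier P. r (s x) = x"
    using pr unfolding projective_def by blast
  interpret tensor_retract R C P S s r
    by (rule tensor_retract.intro) (use C P s in auto)
  interpret C: module R C by (rule C)
  have "s p t = \<zero>\<^bsub>R\<^esub>" for t
  proof -
    have "s p t \<odot>\<^bsub>C\<^esub> c = \<zero>\<^bsub>C\<^esub>" if c: "c \<in> carrier C" for c
      using \<sigma>_pure[OF c p(1)] p(2)[OF c] mod_hom_zero[OF module_tensor_mod[OF C P] module_dsum_mod[OF C] \<sigma>_hom]
      by (simp add: dsum_mod_simps fun_eq_iff)
    then have "homothety R C (s p t) = homothety R C \<zero>\<^bsub>R\<^esub>"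
      using s_coeff[OF p(1)] by (auto simp: homothety_def intro!: restrict_ext)
    then show ?thesis using inj_onD[OF h] s_coeff[OF p(1)] by simp
  qed
  then have "s p = \<zero>\<^bsub>free_mod R S\<^esub>" by (auto simp: free_mod_simps)
  then have "r (s p) = \<zero>\<^bsub>P\<^esub>" using mod_hom_zero[OF module_free P r] by simp
  then show ?thesis using rs[OF p(1)] by simp
qed

text \<open>Embedded into C^(S) by \<sigma>, each coordinate of \<phi> is an endomorphism of C,
  hence a scalar. Almost all of these scalars can be taken to be 0, so they form an element of the
  free module on S, and r sends it to the required p.\<close>

lemma semidualizing_unit_surj:
  fixes C :: "('a, 'c, 'k) module_scheme" and P :: "('a, 'p, 'l) module_scheme"
  assumes sd: "semidualizing R C" and pr: "projective R P"
    and \<phi>: "\<phi> \<in> mod_hom R C (tensor_mod R C P)"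
  shows "\<exists>p\<in>carrier P. \<forall>c\<in>carrier C. \<phi> c = pure_tensor R C P c p"
proof -
  have C: "module R C" and bij: "bij_betw (homothety R C) (carrier R) (mod_hom R C C)"
    using sd by (auto simp: semidualizing_def is_mod_iso_def regular_mod_def hom_mod_simps)
  note P = projective_module[OF pr]
  obtain S :: "'p set" and s r where s: "s \<in> mod_hom R P (free_mod R S)" "r \<in> mod_hom R (free_mod R S) P"
    "\<forall>x\<in>carrier P. r (s x) = x"
    using pr unfolding projective_def by blast
  interpret tensor_retract R C P S s r
    by (rule tensor_retract.intro) (use C P s in auto)
  interpret C: module R C by (rule C)
  let ?f = "compose (carrier C) \<sigma> \<phi>"
  have f: "?f \<in> mod_hom R C (dsum_mod S C)" by (rule mod_hom_compose[OF C \<phi> \<sigma>_hom])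
  have fc: "?f c t \<in> carrier C" if "c \<in> carrier C" for c t
    using mod_homD(1)[OF f that] by (simp add: dsum_mod_carrier)
  let ?ft = "\<lambda>t. \<lambda>c\<in>carrier C. ?f c t"
  have ft: "?ft t \<in> mod_hom R C C" for t
    by (rule mod_homI[OF C]) (simp_all add: fc mod_homD[OF f] dsum_mod_simps)
  from semidualizing_fin_gen[OF sd]
  obtain X where X: "finite X" "X \<subseteq> carrier C"
    "\<forall>H. submodule H R C \<and> X \<subseteq> H \<longrightarrow> carrier C \<subseteq> H" by (elim exE conjE)
  \<comment> \<open>A coordinate outside \<open>?T\<close> vanishes on the generators X and is
    therefore zero. Since X is finite and each value has finite support, \<open>?T\<close> is
    finite.\<close>
  let ?T = "\<Union>x\<in>X. {t. ?f x t \<noteq> \<zero>\<^bsub>C\<^esub>}"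
  have "finite ?T"
    using X(1,2) mod_homD(1)[OF f] by (auto simp: dsum_mod_carrier)
  have zero: "?f c t = \<zero>\<^bsub>C\<^esub>" if c: "c \<in> carrier C" and t: "t \<notin> ?T \<or> t \<notin> S" for c t
  proof (cases "t \<in> S")
    case True
    have "carrier C \<subseteq> {c \<in> carrier C. ?ft t c = \<zero>\<^bsub>C\<^esub>}"
      by (rule X(3)[rule_format, OF conjI, OF submodule_kernel[OF C C ft]]) (use X(2) t True in auto)
    then show ?thesis using c by auto
  next
    case False
    then show ?thesis using mod_homD(1)[OF f c] by (simp add: dsum_mod_carrier)
  qed
  have "\<exists>a\<in>carrier R. \<forall>c\<in>carrier C. ?f c t = a \<odot>\<^bsub>C\<^esub> c" for t
  proof -
    have "?ft t \<in> homothety R C ` carrier R" using ft[of t] bij by (simp add: bij_betw_def)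
    then obtain a where "a \<in> carrier R" "?ft t = homothety R C a" by (rule imageE) auto
    then show ?thesis by (intro bexI[of _ a]) (auto simp: homothety_def fun_eq_iff restrict_def split: if_splits)
  qed
  then obtain a where a: "\<And>t. a t \<in> carrier R" "\<And>t c. c \<in> carrier C \<Longrightarrow> ?f c t = a t \<odot>\<^bsub>C\<^esub> c" by metis
  \<comment> \<open>Outside \<open>?T\<close> \<inter> S the scalar acts on C as zero, so replacing
    it by 0 changes nothing there and puts the family into the free module.\<close>
  let ?a = "\<lambda>t. if t \<in> ?T \<inter> S then a t else \<zero>\<^bsub>R\<^esub>"
  have aF: "?a \<in> carrier (free_mod R S)"
    using a(1) \<open>finite ?T\<close> by (auto simp: free_mod_def intro: finite_subset[of _ ?T])
  have "\<phi> c = pure_tensor R C P c (r ?a)" if c: "c \<in> carrier C" for c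
  proof -
    have "\<sigma> (\<phi> c) = (\<lambda>t. ?a t \<odot>\<^bsub>C\<^esub> c)"
    proof
      fix t
      have "\<sigma> (\<phi> c) t = ?f c t" using c by (simp add: compose_eq)
      also have "\<dots> = ?a t \<odot>\<^bsub>C\<^esub> c" using a(2)[OF c] zero[OF c, of t] c by auto
      finally show "\<sigma> (\<phi> c) t = ?a t \<odot>\<^bsub>C\<^esub> c" .
    qed
    then show ?thesis
      using \<rho>_\<sigma>[OF mod_homD(1)[OF \<phi> c]] \<rho>_family[OF aF c] by simp
  qed
  then show ?thesis using mod_homD(1)[OF r aF] by blast
qed

lemma pure_tensor_cancel:
  fixes C :: "('a, 'c, 'k) module_scheme" and P :: "('a, 'p, 'l) module_scheme"
  assumes sd: "semidualizing R C" and pr: "projective R P"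
    and p: "p \<in> carrier P" "p' \<in> carrier P"
    and eq: "\<And>c. c \<in> carrier C \<Longrightarrow> pure_tensor R C P c p = pure_tensor R C P c p'"
  shows "p = p'"
proof -
  have C: "module R C" using sd by (simp add: semidualizing_def)
  note P = projective_module[OF pr]
  interpret P: module R P by (rule P)
  interpret T: module R "tensor_mod R C P" by (rule module_tensor_mod[OF C P])
  have "p \<ominus>\<^bsub>P\<^esub> p' = \<zero>\<^bsub>P\<^esub>"
  proof (rule semidualizing_unit_inj[OF sd pr])
    fix c assume c: "c \<in> carrier C"
    show "pure_tensor R C P c (p \<ominus>\<^bsub>P\<^esub> p') = \<zero>\<^bsub>tensor_mod R C P\<^esub>"
      using mod_hom_diff[OF P module_tensor_mod[OF C P] pure_tensor_hom_right[OF C P c] p] p eq[OF c]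
        pure_tensor_closed[OF C P c] by (simp add: T.minus_eq_zero_iff)
  qed (use p in simp)
  then show ?thesis using p by (simp add: P.minus_eq_zero_iff)
qed

text \<open>For each q the map c \<mapsto> f (c \<otimes> q) goes from C to C \<otimes> P, so it is
  c \<mapsto> c \<otimes> p for some p. By \<open>pure_tensor_cancel\<close> this p is unique, and
  uniqueness makes q \<mapsto> p linear.\<close>

lemma tensor_full_faithful:
  fixes C :: "('a, 'c, 'k) module_scheme" and P :: "('a, 'p, 'l) module_scheme"
  assumes sd: "semidualizing R C" and pr: "projective R P" and Q: "module R Q"
    and f: "f \<in> mod_hom R (tensor_mod R C Q) (tensor_mod R C P)"
  shows "\<exists>\<phi>\<in>mod_hom R Q P. f = tensor_map R C Q P \<phi>"
proof -
  have C: "module R C" using sd by (simp add: semidualizing_def)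
  note P = projective_module[OF pr]
  interpret P: module R P by (rule P)
  interpret Q: module R Q by (rule Q)
  interpret T: module R "tensor_mod R C P" by (rule module_tensor_mod[OF C P])
  note curry = tensor_curry_closed[OF C Q module_tensor_mod[OF C P] f]
  have "\<exists>p\<in>carrier P. \<forall>c\<in>carrier C. f (pure_tensor R C Q c q) = pure_tensor R C P c p"
    if q: "q \<in> carrier Q" for q
  proof -
    have "tensor_curry R C Q f q \<in> mod_hom R C (tensor_mod R C P)"
      using mod_homD(1)[OF curry q] by (simp add: hom_mod_simps)
    from semidualizing_unit_surj[OF sd pr this] obtain p where
      "p \<in> carrier P" "\<forall>c\<in>carrier C. tensor_curry R C Q f q c = pure_tensor R C P c p" by (rule bexE)
    then show ?thesis
      by (intro bexI[of _ p]) (simp_all add: tensor_curry_apply[OF C Q module_tensor_mod[OF C P] q])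
  qed
  then obtain \<phi> where \<phi>: "\<And>q. q \<in> carrier Q \<Longrightarrow> \<phi> q \<in> carrier P"
    "\<And>q c. q \<in> carrier Q \<Longrightarrow> c \<in> carrier C \<Longrightarrow> f (pure_tensor R C Q c q) = pure_tensor R C P c (\<phi> q)"
    by metis
  note uniq = pure_tensor_cancel[OF sd pr]
  have h: "(\<lambda>q\<in>carrier Q. \<phi> q) \<in> mod_hom R Q P"
  proof (rule mod_homI[OF Q])
    show "\<phi> (q \<oplus>\<^bsub>Q\<^esub> q') = \<phi> q \<oplus>\<^bsub>P\<^esub> \<phi> q'" if q: "q \<in> carrier Q" "q' \<in> carrier Q" for q q'
    proof (rule uniq)
      fix c assume c: "c \<in> carrier C"
      have "pure_tensor R C P c (\<phi> (q \<oplus>\<^bsub>Q\<^esub> q')) = f (pure_tensor R C Q c (q \<oplus>\<^bsub>Q\<^esub> q'))"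
        using \<phi>(2)[of "q \<oplus>\<^bsub>Q\<^esub> q'"] q c by simp
      then show "pure_tensor R C P c (\<phi> (q \<oplus>\<^bsub>Q\<^esub> q')) = pure_tensor R C P c (\<phi> q \<oplus>\<^bsub>P\<^esub> \<phi> q')"
        using q c \<phi> by (simp add: pure_tensor_bilinear[OF C Q] pure_tensor_bilinear[OF C P]
            mod_homD(2)[OF f] pure_tensor_closed[OF C Q])
    qed (use q \<phi>(1) in simp_all)
    show "\<phi> (a \<odot>\<^bsub>Q\<^esub> q) = a \<odot>\<^bsub>P\<^esub> \<phi> q" if q: "a \<in> carrier R" "q \<in> carrier Q" for a q
    proof (rule uniq)
      fix c assume c: "c \<in> carrier C"
      have "pure_tensor R C P c (\<phi> (a \<odot>\<^bsub>Q\<^esub> q)) = f (pure_tensor R C Q c (a \<odot>\<^bsub>Q\<^esub> q))"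
        using \<phi>(2)[of "a \<odot>\<^bsub>Q\<^esub> q"] q c by simp
      then show "pure_tensor R C P c (\<phi> (a \<odot>\<^bsub>Q\<^esub> q)) = pure_tensor R C P c (a \<odot>\<^bsub>P\<^esub> \<phi> q)"
        using q c \<phi> by (simp add: pure_tensor_bilinear[OF C Q] pure_tensor_bilinear[OF C P]
            mod_homD(3)[OF f] pure_tensor_closed[OF C Q])
    qed (use q \<phi>(1) in simp_all)
  qed (rule \<phi>(1))
  have "f = tensor_map R C Q P (\<lambda>q\<in>carrier Q. \<phi> q)"
    by (rule tensor_mod_hom_ext[OF C Q module_tensor_mod[OF C P] f tensor_map_hom[OF C Q P h]])
      (simp add: tensor_map_pure[OF C Q P h] \<phi>(2))
  then show ?thesis using h by blast
qed

section \<open>Proper resolutions and the Bass class\<close>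

lemma pure_tensor_zero_right:
  assumes "module R C" "module R P" "c \<in> carrier C"
  shows "pure_tensor R C P c \<zero>\<^bsub>P\<^esub> = \<zero>\<^bsub>tensor_mod R C P\<^esub>"
proof -
  interpret P: module R P by fact
  show ?thesis
    using mod_hom_zero[OF assms(2) module_tensor_mod[OF assms(1,2)] pure_tensor_hom_right[OF assms]]
      P.zero_closed by simp
qed

lemma tensor_chain_complex:
  assumes C: "module R C" and P: "chain_complex R P \<delta>"
  shows "chain_complex R (\<lambda>n. tensor_mod R C (P n)) (\<lambda>n. tensor_map R C (P (Suc n)) (P n) (\<delta> n))"
proof -
  note PD = chain_complexD[OF P]
  have T: "module R (tensor_mod R C (P n))" for n by (rule module_tensor_mod[OF C PD(1)])
  have h: "tensor_map R C (P (Suc n)) (P n) (\<delta> n)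
      \<in> mod_hom R (tensor_mod R C (P (Suc n))) (tensor_mod R C (P n))" for n
    by (rule tensor_map_hom[OF C PD(1,1,2)])
  have "tensor_map R C (P (Suc n)) (P n) (\<delta> n)
      (tensor_map R C (P (Suc (Suc n))) (P (Suc n)) (\<delta> (Suc n)) x) = \<zero>\<^bsub>tensor_mod R C (P n)\<^esub>"
    if x: "x \<in> carrier (tensor_mod R C (P (Suc (Suc n))))" for n x
  proof -
    let ?Z = "\<lambda>x\<in>carrier (tensor_mod R C (P (Suc (Suc n)))). \<zero>\<^bsub>tensor_mod R C (P n)\<^esub>"
    have "pure_tensor R C (P n) c \<zero>\<^bsub>P n\<^esub> = \<zero>\<^bsub>tensor_mod R C (P n)\<^esub>" if "c \<in> carrier C" for c
      by (rule pure_tensor_zero_right[OF C PD(1) that])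
    then have eq: "compose (carrier (tensor_mod R C (P (Suc (Suc n))))) (tensor_map R C (P (Suc n)) (P n) (\<delta> n))
        (tensor_map R C (P (Suc (Suc n))) (P (Suc n)) (\<delta> (Suc n))) = ?Z"
      by (intro tensor_mod_hom_ext[OF C PD(1) T mod_hom_compose[OF T h h] mod_hom_const_zero[OF T T]])
        (simp add: compose_eq pure_tensor_closed[OF C PD(1)] tensor_map_pure[OF C PD(1,1,2)]
          mod_homD(1)[OF PD(2)] PD(3))
    show ?thesis using fun_cong[OF eq, of x] x by (simp add: compose_eq)
  qed
  then show ?thesis using T h by (simp add: chain_complex_def)
qed

text \<open>Currying is a bijection of cochains compatible with the differentials, since either way
  a cochain ends up evaluated at c \<otimes> \<delta> p. Cocycles and coboundaries therefore
  correspond exactly.\<close>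

lemma tensor_cohomology_iso:
  assumes C: "module R C" and P: "chain_complex R P \<delta>" and N: "module R N"
  shows "mod_isomorphic R
    (hom_cohomology R (\<lambda>n. tensor_mod R C (P n)) (\<lambda>n. tensor_map R C (P (Suc n)) (P n) (\<delta> n)) N i)
    (hom_cohomology R P \<delta> (hom_mod R C N) i)"
proof -
  let ?X = "\<lambda>n. tensor_mod R C (P n)" and ?D = "\<lambda>n. tensor_map R C (P (Suc n)) (P n) (\<delta> n)"
  note PD = chain_complexD[OF P] and TC = tensor_chain_complex[OF C P]
  note TD = chain_complexD[OF TC]
  have H: "module R (hom_mod R C N)" by (rule module_hom_mod[OF C N])
  interpret H: module R "hom_mod R C N" by (rule H)
  interpret N: module R N by (rule N)
  note app = tensor_curry_apply[OF C PD(1) N]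
  note D_pure = tensor_map_pure[OF C PD(1,1,2)]
  note pc = pure_tensor_closed[OF C PD(1)]
  have curry_d: "tensor_curry R C (P n) f (\<delta> n p) =
      (\<lambda>c\<in>carrier C. f (?D n (pure_tensor R C (P (Suc n)) c p)))" if "p \<in> carrier (P (Suc n))" for n f p
    using that mod_homD(1)[OF PD(2)] by (auto simp: tensor_curry_def D_pure intro!: restrict_ext)
  have curry_eq: "tensor_curry R C (P n) f p = (\<lambda>c\<in>carrier C. f (pure_tensor R C (P n) c p))"
    if "p \<in> carrier (P n)" for n f p
    using that by (simp add: tensor_curry_def)
  have cob_curry: "f \<in> coboundaries R ?X ?D N i \<longleftrightarrow>
      tensor_curry R C (P i) f \<in> coboundaries R P \<delta> (hom_mod R C N) i"
    if fh: "f \<in> mod_hom R (?X i) N" for f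
  proof (cases i)
    case 0
    have z: "(\<lambda>x\<in>carrier (?X 0). \<zero>\<^bsub>N\<^esub>) \<in> mod_hom R (?X 0) N" by (rule mod_hom_const_zero[OF TD(1) N])
    have "tensor_curry R C (P 0) (\<lambda>x\<in>carrier (?X 0). \<zero>\<^bsub>N\<^esub>) = (\<lambda>p\<in>carrier (P 0). \<zero>\<^bsub>hom_mod R C N\<^esub>)"
      by (auto simp: tensor_curry_def pc hom_mod_simps intro!: restrict_ext)
    note zc = this
    show ?thesis
    proof
      assume "f \<in> coboundaries R ?X ?D N i"
      then show "tensor_curry R C (P i) f \<in> coboundaries R P \<delta> (hom_mod R C N) i"
        using 0 tensor_curry_closed[OF C PD(1) N fh]
        by (auto simp: coboundaries_0 hom_mod_simps curry_eq pc intro!: restrict_ext)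
    next
      assume "tensor_curry R C (P i) f \<in> coboundaries R P \<delta> (hom_mod R C N) i"
      then have "tensor_curry R C (P 0) f p = \<zero>\<^bsub>hom_mod R C N\<^esub>" if "p \<in> carrier (P 0)" for p
        using 0 that by (simp add: coboundaries_0)
      then have "tensor_curry R C (P 0) f = (\<lambda>p\<in>carrier (P 0). \<zero>\<^bsub>hom_mod R C N\<^esub>)"
        using tensor_curry_closed[OF C PD(1) N fh] mod_hom_const_zero[OF PD(1) H] 0
        by (intro mod_hom_ext[of _ R "P 0" "hom_mod R C N"]) simp_all
      then have "f = (\<lambda>x\<in>carrier (?X 0). \<zero>\<^bsub>N\<^esub>)"
        using tensor_curry_inj[OF C PD(1) N] fh z zc 0 by metis
      then show "f \<in> coboundaries R ?X ?D N i" using z 0 by (simp add: coboundaries_0)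
    qed
  next
    case (Suc j)
    show ?thesis
    proof
      assume "f \<in> coboundaries R ?X ?D N i"
      then obtain g where g: "g \<in> mod_hom R (?X j) N" "\<forall>x\<in>carrier (?X (Suc j)). f x = g (?D j x)"
        using Suc by (auto simp: coboundaries_Suc)
      have "tensor_curry R C (P (Suc j)) f p = tensor_curry R C (P j) g (\<delta> j p)" if "p \<in> carrier (P (Suc j))" for p
        using that g(2) by (auto simp: curry_eq curry_d pc intro!: restrict_ext)
      then show "tensor_curry R C (P i) f \<in> coboundaries R P \<delta> (hom_mod R C N) i"
        using tensor_curry_closed[OF C PD(1) N fh] tensor_curry_closed[OF C PD(1) N g(1)] Suc
        by (auto simp: coboundaries_Suc)
    next
      assume "tensor_curry R C (P i) f \<in> coboundaries R P \<delta> (hom_mod R C N) i"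
      then obtain g' where g': "g' \<in> mod_hom R (P j) (hom_mod R C N)"
        "\<forall>p\<in>carrier (P (Suc j)). tensor_curry R C (P (Suc j)) f p = g' (\<delta> j p)"
        using Suc by (auto simp: coboundaries_Suc)
      let ?g = "tensor_lift R C (P j) N (\<lambda>c p. g' p c)"
      have g: "?g \<in> mod_hom R (?X j) N" "tensor_curry R C (P j) ?g = g'"
        using tensor_uncurry[OF C PD(1) N g'(1)] by auto
      have "f (pure_tensor R C (P (Suc j)) c p) = ?g (?D j (pure_tensor R C (P (Suc j)) c p))"
        if "c \<in> carrier C" "p \<in> carrier (P (Suc j))" for c p
      proof -
        have "f (pure_tensor R C (P (Suc j)) c p) = tensor_curry R C (P (Suc j)) f p c"
          using that by (simp add: app)
        also have "\<dots> = tensor_curry R C (P j) ?g (\<delta> j p) c" using g'(2) g(2) that by simp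
        finally show ?thesis using that by (simp add: curry_d)
      qed
      then have eq: "f = compose (carrier (?X (Suc j))) ?g (?D j)"
        using fh Suc
        by (intro tensor_mod_hom_ext[OF C PD(1) N _ mod_hom_compose[OF TD(1,2) g(1)]])
          (simp_all add: compose_eq pc)
      have "f x = ?g (?D j x)" if "x \<in> carrier (?X (Suc j))" for x
        using fun_cong[OF eq, of x] that by (simp add: compose_eq)
      then show "f \<in> coboundaries R ?X ?D N i" using fh g(1) Suc by (auto simp: coboundaries_Suc)
    qed
  qed
  show ?thesis
  proof (rule hom_cohomology_isoI[OF TC P N H, where F = "tensor_curry R C (P i)"])
    fix f assume f: "f \<in> cocycles R ?X ?D N i"
    then have fh: "f \<in> mod_hom R (?X i) N" by (simp add: cocycles_def)
    show "tensor_curry R C (P i) f \<in> cocycles R P \<delta> (hom_mod R C N) i"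
      using f tensor_curry_closed[OF C PD(1) N fh]
      by (auto simp: cocycles_def curry_d pc hom_mod_simps intro!: restrict_ext)
    show "tensor_curry R C (P i) f \<in> coboundaries R P \<delta> (hom_mod R C N) i \<Longrightarrow>
        f \<in> coboundaries R ?X ?D N i"
      using cob_curry[OF fh] by simp
  next
    fix f assume f: "f \<in> coboundaries R ?X ?D N i"
    then have "f \<in> mod_hom R (?X i) N" by (simp add: coboundaries_def)
    then show "tensor_curry R C (P i) f \<in> coboundaries R P \<delta> (hom_mod R C N) i"
      using cob_curry f by blast
  next
    fix g assume g: "g \<in> cocycles R P \<delta> (hom_mod R C N) i"
    then have gh: "g \<in> mod_hom R (P i) (hom_mod R C N)" by (simp add: cocycles_def)
    let ?f = "tensor_lift R C (P i) N (\<lambda>c p. g p c)"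
    have f: "?f \<in> mod_hom R (?X i) N" "tensor_curry R C (P i) ?f = g"
      using tensor_uncurry[OF C PD(1) N gh] by auto
    have z: "(\<lambda>x\<in>carrier (?X (Suc i)). \<zero>\<^bsub>N\<^esub>) \<in> mod_hom R (?X (Suc i)) N"
      by (rule mod_hom_const_zero[OF TD(1) N])
    have "?f (?D i (pure_tensor R C (P (Suc i)) c p)) = \<zero>\<^bsub>N\<^esub>"
      if "c \<in> carrier C" "p \<in> carrier (P (Suc i))" for c p
    proof -
      have "?f (?D i (pure_tensor R C (P (Suc i)) c p)) = tensor_curry R C (P i) ?f (\<delta> i p) c"
        using that by (simp add: curry_d)
      also have "\<dots> = g (\<delta> i p) c" unfolding f(2) ..
      also have "\<dots> = \<zero>\<^bsub>N\<^esub>" using g that by (simp add: cocycles_def hom_mod_simps)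
      finally show ?thesis .
    qed
    then have eq: "compose (carrier (?X (Suc i))) ?f (?D i) = (\<lambda>x\<in>carrier (?X (Suc i)). \<zero>\<^bsub>N\<^esub>)"
      by (intro tensor_mod_hom_ext[OF C PD(1) N mod_hom_compose[OF TD(1,2) f(1)] z])
        (simp add: compose_eq pc)
    have "?f (?D i x) = \<zero>\<^bsub>N\<^esub>" if "x \<in> carrier (?X (Suc i))" for x
      using fun_cong[OF eq, of x] that by (simp add: compose_eq)
    then have fc: "?f \<in> cocycles R ?X ?D N i" using f(1) by (simp add: cocycles_def)
    \<comment> \<open>Currying already reaches every cocycle, so the correction by a coboundary in
      the criterion is zero.\<close>
    have "(\<lambda>p\<in>carrier (P i). \<zero>\<^bsub>hom_mod R C N\<^esub>) \<in> coboundaries R P \<delta> (hom_mod R C N) i"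
      using mod_hom_const_zero[OF PD(1) H] submodule_coboundaries[OF P H, of i]
        subgroup.one_closed[OF submodule.axioms(1)[OF submodule_coboundaries[OF P H, of i]]]
      by (simp add: hom_mod_simps)
    then show "\<exists>f\<in>cocycles R ?X ?D N i. \<exists>b\<in>coboundaries R P \<delta> (hom_mod R C N) i.
        \<forall>p\<in>carrier (P i). g p = tensor_curry R C (P i) f p \<oplus>\<^bsub>hom_mod R C N\<^esub> b p"
      using fc f(2) mod_homD(1)[OF gh] by (intro bexI[OF _ fc] bexI) auto
  qed (auto simp: hom_mod_simps curry_eq pc intro!: restrict_ext)
qed

text \<open>Maps C \<otimes> Q \<rightarrow> C \<otimes> P n are maps Q \<rightarrow> P n, and maps
  C \<otimes> Q \<rightarrow> M are maps Q \<rightarrow> Hom(C, M). So Hom(C \<otimes> Q, -) of the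
  tensored complex is Hom(Q, -) of the augmented resolution P, which is exact because Q is
  projective.\<close>

lemma projective_to_proper:
  fixes C :: "('a, 'c, 'k) module_scheme" and M :: "('a, 'm, 'l) module_scheme"
    and P :: "nat \<Rightarrow> ('a, 's \<Rightarrow> 'a) module"
  assumes sd: "semidualizing R C" and M: "module R M"
    and P: "projective_resolution R (hom_mod R C M) P \<delta> \<epsilon>"
  shows "proper_PC_resolution R C M P (\<lambda>n. tensor_map R C (P (Suc n)) (P n) (\<delta> n))
    (tensor_lift R C (P 0) M (\<lambda>c p. \<epsilon> p c))"
proof -
  have C: "module R C" using sd by (simp add: semidualizing_def)
  have H: "module R (hom_mod R C M)" by (rule module_hom_mod[OF C M])
  note PR = projective_resolutionD[OF P H]
  note PD = resolutionD[OF PR(1)]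
  let ?X = "\<lambda>n. tensor_mod R C (P n)" and ?D = "\<lambda>n. tensor_map R C (P (Suc n)) (P n) (\<delta> n)"
  let ?E = "tensor_lift R C (P 0) M (\<lambda>c p. \<epsilon> p c)"
  note TD = chain_complexD[OF tensor_chain_complex[OF C PD(1)]]
  interpret M: module R M by (rule M)
  interpret H: module R "hom_mod R C M" by (rule H)
  note pc = pure_tensor_closed[OF C PD(2)]
  have E: "?E \<in> mod_hom R (?X 0) M" "tensor_curry R C (P 0) ?E = \<epsilon>"
    using tensor_uncurry[OF C PD(2) M PD(5)] by auto
  have E_pure: "?E (pure_tensor R C (P 0) c p) = \<epsilon> p c" if "c \<in> carrier C" "p \<in> carrier (P 0)" for c p
    using tensor_curry_apply[OF C PD(2) M that(2,1), of ?E] E(2) by simp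
  note D_pure = tensor_map_pure[OF C PD(2,2,4)]
  have ED: "?E (?D 0 x) = \<zero>\<^bsub>M\<^esub>" if x: "x \<in> carrier (?X (Suc 0))" for x
  proof -
    have eq: "compose (carrier (?X (Suc 0))) ?E (?D 0) = (\<lambda>x\<in>carrier (?X (Suc 0)). \<zero>\<^bsub>M\<^esub>)"
      by (rule tensor_mod_hom_ext[OF C PD(2) M mod_hom_compose[OF TD(1,2) E(1)] mod_hom_const_zero[OF TD(1) M]])
        (simp add: compose_eq pc D_pure E_pure mod_homD(1)[OF PD(4)] PD(7) hom_mod_simps)
    show ?thesis using fun_cong[OF eq, of x] x by (simp add: compose_eq)
  qed
  have aug: "aug_complex R ?X ?D M ?E"
    unfolding aug_complex_def using TD E(1) ED by blast
  have exact: "aug_exact (\<lambda>n. hom_mod R T (?X n)) (\<lambda>n f. compose (carrier T) (?D n) f)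
      (hom_mod R T M) (\<lambda>f. compose (carrier T) ?E f)"
    if Q: "projective R Q" and T_def: "T = tensor_mod R C Q"
    for Q :: "('a, 's \<Rightarrow> 'a) module" and T
  proof -
    have Qm: "module R Q" by (rule projective_module[OF Q])
    have Tm: "module R T" unfolding T_def by (rule module_tensor_mod[OF C Qm])
    interpret Q: module R Q by (rule Qm)
    have qT: "pure_tensor R C Q c q \<in> carrier T" if "c \<in> carrier C" "q \<in> carrier Q" for c q
      unfolding T_def by (rule pure_tensor_closed[OF C Qm that])
    have extT: "f = g" if "module R L" "f \<in> mod_hom R T L" "g \<in> mod_hom R T L"
      "\<And>c q. c \<in> carrier C \<Longrightarrow> q \<in> carrier Q \<Longrightarrow> f (pure_tensor R C Q c q) = g (pure_tensor R C Q c q)"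
      for f g and L :: "('a, ('c \<times> ('s \<Rightarrow> 'a) \<Rightarrow> 'a) set) module"
      using tensor_mod_hom_ext[OF C Qm that(1)] that(2-4) unfolding T_def by blast
    have full: "\<exists>\<phi>\<in>mod_hom R Q (P n). f = tensor_map R C Q (P n) \<phi>" if "f \<in> mod_hom R T (?X n)" for f n
      using tensor_full_faithful[OF sd PR(2) Qm] that unfolding T_def by blast
    have map: "tensor_map R C Q (P n) \<phi> \<in> mod_hom R T (?X n)"
      "\<And>c q. c \<in> carrier C \<Longrightarrow> q \<in> carrier Q \<Longrightarrow>
        tensor_map R C Q (P n) \<phi> (pure_tensor R C Q c q) = pure_tensor R C (P n) c (\<phi> q)"
      if "\<phi> \<in> mod_hom R Q (P n)" for n \<phi>
      using tensor_map_hom_pure[OF C Qm PD(2) that] unfolding T_def by auto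
    have surj: "f \<in> compose (carrier T) ?E ` mod_hom R T (?X 0)" if f: "f \<in> mod_hom R T M" for f
    proof -
      have fc: "tensor_curry R C Q f \<in> mod_hom R Q (hom_mod R C M)"
        using tensor_curry_closed[OF C Qm M] f unfolding T_def by blast
      obtain \<phi> where \<phi>: "\<phi> \<in> mod_hom R Q (P 0)" "\<forall>q\<in>carrier Q. \<epsilon> (\<phi> q) = tensor_curry R C Q f q"
        using projective_lift[OF Q PD(2) H PD(5) fc] PD(8) mod_homD(1)[OF fc] by blast
      have "f = compose (carrier T) ?E (tensor_map R C Q (P 0) \<phi>)"
      proof (rule tensor_mod_hom_ext[OF C Qm M])
        show "f \<in> mod_hom R (tensor_mod R C Q) M" using f unfolding T_def .
        show "compose (carrier T) ?E (tensor_map R C Q (P 0) \<phi>) \<in> mod_hom R (tensor_mod R C Q) M"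
          using mod_hom_compose[OF Tm map(1)[OF \<phi>(1)] E(1)] unfolding T_def .
        fix c q assume cq: "c \<in> carrier C" "q \<in> carrier Q"
        have "f (pure_tensor R C Q c q) = \<epsilon> (\<phi> q) c"
          using \<phi>(2) cq tensor_curry_apply[OF C Qm M cq(2,1), of f] by simp
        then show "f (pure_tensor R C Q c q) = compose (carrier T) ?E (tensor_map R C Q (P 0) \<phi>) (pure_tensor R C Q c q)"
          using cq mod_homD(1)[OF \<phi>(1)] by (simp add: compose_eq qT map(2)[OF \<phi>(1)] E_pure)
      qed
      then show ?thesis using map(1)[OF \<phi>(1)] by blast
    qed
    \<comment> \<open>Lifting f through the differential amounts to lifting the corresponding \<phi>
      through \<delta> n. As Q is projective, the pointwise condition \<open>im\<close>
      suffices.\<close>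
    have ker: "f \<in> compose (carrier T) (?D n) ` mod_hom R T (?X (Suc n))"
      if f: "f \<in> mod_hom R T (?X n)"
        and im: "\<And>\<phi>. \<phi> \<in> mod_hom R Q (P n) \<Longrightarrow> f = tensor_map R C Q (P n) \<phi> \<Longrightarrow>
          \<forall>q\<in>carrier Q. \<phi> q \<in> \<delta> n ` carrier (P (Suc n))" for f n
    proof -
      obtain \<phi> where \<phi>: "\<phi> \<in> mod_hom R Q (P n)" "f = tensor_map R C Q (P n) \<phi>" using full[OF f] by blast
      obtain \<psi> where \<psi>: "\<psi> \<in> mod_hom R Q (P (Suc n))" "\<forall>q\<in>carrier Q. \<delta> n (\<psi> q) = \<phi> q"
        using projective_lift[OF Q PD(2,2) PD(4) \<phi>(1)] im[OF \<phi>] by blast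
      have "f = compose (carrier T) (?D n) (tensor_map R C Q (P (Suc n)) \<psi>)"
        by (rule extT[OF TD(1) f mod_hom_compose[OF Tm map(1)[OF \<psi>(1)] TD(2)]])
          (simp add: \<phi>(2) compose_eq qT map(2)[OF \<phi>(1)] map(2)[OF \<psi>(1)] D_pure mod_homD(1)[OF \<psi>(1)] \<psi>(2))
      then show ?thesis using map(1)[OF \<psi>(1)] by blast
    qed
    have ker0: "f \<in> compose (carrier T) (?D 0) ` mod_hom R T (?X (Suc 0))"
      if f: "f \<in> mod_hom R T (?X 0)" and z: "compose (carrier T) ?E f = (\<lambda>x\<in>carrier T. \<zero>\<^bsub>M\<^esub>)" for f
    proof (rule ker[OF f], intro ballI)
      fix \<phi> q assume \<phi>: "\<phi> \<in> mod_hom R Q (P 0)" "f = tensor_map R C Q (P 0) \<phi>" and q: "q \<in> carrier Q"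
      have pq: "\<phi> q \<in> carrier (P 0)" by (rule mod_homD(1)[OF \<phi>(1) q])
      have e: "\<epsilon> (\<phi> q) \<in> mod_hom R C M" using mod_homD(1)[OF PD(5) pq] by (simp add: hom_mod_simps)
      have "\<epsilon> (\<phi> q) c = \<zero>\<^bsub>M\<^esub>" if c: "c \<in> carrier C" for c
        using fun_cong[OF z, of "pure_tensor R C Q c q"] c q pq
        by (simp add: \<phi>(2) compose_eq qT map(2)[OF \<phi>(1)] E_pure)
      then have "\<epsilon> (\<phi> q) = \<zero>\<^bsub>hom_mod R C M\<^esub>"
        unfolding hom_mod_simps by (intro mod_hom_ext[OF e mod_hom_const_zero[OF C M]]) simp
      then show "\<phi> q \<in> \<delta> 0 ` carrier (P (Suc 0))" by (rule PD(9)[OF pq])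
    qed
    have ker_Suc: "f \<in> compose (carrier T) (?D (Suc n)) ` mod_hom R T (?X (Suc (Suc n)))"
      if f: "f \<in> mod_hom R T (?X (Suc n))" and z: "compose (carrier T) (?D n) f = (\<lambda>x\<in>carrier T. \<zero>\<^bsub>?X n\<^esub>)" for f n
    proof (rule ker[OF f], intro ballI)
      fix \<phi> q assume \<phi>: "\<phi> \<in> mod_hom R Q (P (Suc n))" "f = tensor_map R C Q (P (Suc n)) \<phi>"
        and q: "q \<in> carrier Q"
      have pq: "\<phi> q \<in> carrier (P (Suc n))" by (rule mod_homD(1)[OF \<phi>(1) q])
      \<comment> \<open>That f is a cycle only says c \<otimes> \<delta> n (\<phi> q) = 0 for all c;
        injectivity of the unit on the projective module \<open>P n\<close> removes the
        tensor.\<close>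
      have "\<delta> n (\<phi> q) = \<zero>\<^bsub>P n\<^esub>"
      proof (rule semidualizing_unit_inj[OF sd PR(2) mod_homD(1)[OF PD(4) pq]])
        fix c assume c: "c \<in> carrier C"
        show "pure_tensor R C (P n) c (\<delta> n (\<phi> q)) = \<zero>\<^bsub>?X n\<^esub>"
          using fun_cong[OF z, of "pure_tensor R C Q c q"] c q pq
          by (simp add: \<phi>(2) compose_eq qT map(2)[OF \<phi>(1)] D_pure)
      qed
      then show "\<phi> q \<in> \<delta> (Suc n) ` carrier (P (Suc (Suc n)))" by (rule PD(10)[OF pq])
    qed
    have EDz: "compose (carrier T) ?E (compose (carrier T) (?D 0) f) = (\<lambda>x\<in>carrier T. \<zero>\<^bsub>M\<^esub>)"
      if "f \<in> mod_hom R T (?X (Suc 0))" for f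
      using mod_homD(1)[OF that] ED by (auto simp: compose_def intro!: restrict_ext)
    have DDz: "compose (carrier T) (?D n) (compose (carrier T) (?D (Suc n)) f) = (\<lambda>x\<in>carrier T. \<zero>\<^bsub>?X n\<^esub>)"
      if "f \<in> mod_hom R T (?X (Suc (Suc n)))" for f n
      using mod_homD(1)[OF that] TD(3) by (auto simp: compose_def intro!: restrict_ext)
    have Dc: "compose (carrier T) (?D n) f \<in> mod_hom R T (?X n)" if "f \<in> mod_hom R T (?X (Suc n))" for f n
      by (rule mod_hom_compose[OF Tm that TD(2)])
    have Ec: "compose (carrier T) ?E f \<in> mod_hom R T M" if "f \<in> mod_hom R T (?X 0)" for f
      by (rule mod_hom_compose[OF Tm that E(1)])
    show ?thesis
      unfolding aug_exact_def hom_mod_simps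
    proof (intro conjI allI equalityI subsetI)
      fix f assume "f \<in> compose (carrier T) ?E ` mod_hom R T (?X 0)"
      then show "f \<in> mod_hom R T M" using Ec by (elim imageE) simp
    next
      fix f assume "f \<in> compose (carrier T) (?D 0) ` mod_hom R T (?X (Suc 0))"
      then show "f \<in> {f \<in> mod_hom R T (?X 0). compose (carrier T) ?E f = (\<lambda>x\<in>carrier T. \<zero>\<^bsub>M\<^esub>)}"
        using EDz Dc by (elim imageE) simp
    next
      fix n f assume "f \<in> compose (carrier T) (?D (Suc n)) ` mod_hom R T (?X (Suc (Suc n)))"
      then show "f \<in> {f \<in> mod_hom R T (?X (Suc n)). compose (carrier T) (?D n) f = (\<lambda>x\<in>carrier T. \<zero>\<^bsub>?X n\<^esub>)}"
        using DDz Dc by (elim imageE) simp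
    next
      fix f assume "f \<in> mod_hom R T M"
      then show "f \<in> compose (carrier T) ?E ` mod_hom R T (?X 0)" by (rule surj)
    next
      fix f assume "f \<in> {f \<in> mod_hom R T (?X 0). compose (carrier T) ?E f = (\<lambda>x\<in>carrier T. \<zero>\<^bsub>M\<^esub>)}"
      then show "f \<in> compose (carrier T) (?D 0) ` mod_hom R T (?X (Suc 0))" by (intro ker0) auto
    next
      fix n f assume "f \<in> {f \<in> mod_hom R T (?X (Suc n)). compose (carrier T) (?D n) f = (\<lambda>x\<in>carrier T. \<zero>\<^bsub>?X n\<^esub>)}"
      then show "f \<in> compose (carrier T) (?D (Suc n)) ` mod_hom R T (?X (Suc (Suc n)))"
        by (intro ker_Suc) auto
    qed
  qed
  show ?thesis
    unfolding proper_PC_resolution_def Let_def using PR(2) aug exact by blast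
qed

text \<open>The choice in \<open>Ext_PC\<close> may return any proper resolution, so each one has to
  be recognized as a tensored projective resolution. Full faithfulness gives the differentials
  \<delta>, currying E gives \<epsilon>, and exactness is read off from one test module.\<close>

lemma proper_to_projective:
  fixes R :: "('a, 'r) ring_scheme" and C :: "('a, 'c, 'k) module_scheme"
    and M :: "('a, 'm, 'l) module_scheme" and P :: "nat \<Rightarrow> ('a, 's \<Rightarrow> 'a) module"
  assumes sd: "semidualizing R C" and M: "module R M"
    and proper: "proper_PC_resolution R C M P D E"
  shows "\<exists>\<delta> \<epsilon>. projective_resolution R (hom_mod R C M) P \<delta> \<epsilon> \<and>
    (\<forall>n. D n = tensor_map R C (P (Suc n)) (P n) (\<delta> n))"
proof -
  have C: "module R C" using sd by (simp add: semidualizing_def)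
  interpret C: module R C by (rule C)
  interpret M: module R M by (rule M)
  have H: "module R (hom_mod R C M)" by (rule module_hom_mod[OF C M])
  let ?X = "\<lambda>n. tensor_mod R C (P n)"
  have pr: "projective R (P n)" for n using proper by (simp add: proper_PC_resolution_def)
  have Pm: "module R (P n)" for n by (rule projective_module[OF pr])
  interpret P: module R "P n" for n by (rule Pm)
  have X: "module R (?X n)" for n by (rule module_tensor_mod[OF C Pm])
  note pc = pure_tensor_closed[OF C Pm]
  have D: "D n \<in> mod_hom R (?X (Suc n)) (?X n)" and E: "E \<in> mod_hom R (?X 0) M"
    and DD: "x \<in> carrier (?X (Suc (Suc n))) \<Longrightarrow> D n (D (Suc n) x) = \<zero>\<^bsub>?X n\<^esub>"
    and ED: "y \<in> carrier (?X (Suc 0)) \<Longrightarrow> E (D 0 y) = \<zero>\<^bsub>M\<^esub>" for n x y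
    using proper unfolding proper_PC_resolution_def aug_complex_def by blast+
  have "\<exists>\<phi>\<in>mod_hom R (P (Suc n)) (P n). D n = tensor_map R C (P (Suc n)) (P n) \<phi>" for n
    by (rule tensor_full_faithful[OF sd pr Pm D])
  then obtain \<delta> where \<delta>: "\<And>n. \<delta> n \<in> mod_hom R (P (Suc n)) (P n)"
    "\<And>n. D n = tensor_map R C (P (Suc n)) (P n) (\<delta> n)" by metis
  note \<delta>D = mod_homD[OF \<delta>(1)]
  have D_pure: "D n (pure_tensor R C (P (Suc n)) c p) = pure_tensor R C (P n) c (\<delta> n p)"
    if "c \<in> carrier C" "p \<in> carrier (P (Suc n))" for n c p
    unfolding \<delta>(2) by (rule tensor_map_pure[OF C Pm Pm \<delta>(1) that])
  let ?\<epsilon> = "tensor_curry R C (P 0) E"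
  have \<epsilon>: "?\<epsilon> \<in> mod_hom R (P 0) (hom_mod R C M)" by (rule tensor_curry_closed[OF C Pm M E])
  have \<epsilon>_app: "?\<epsilon> p c = E (pure_tensor R C (P 0) c p)" if "p \<in> carrier (P 0)" "c \<in> carrier C" for p c
    using that by (simp add: tensor_curry_def)
  have \<epsilon>h: "?\<epsilon> p \<in> mod_hom R C M" if "p \<in> carrier (P 0)" for p
    using mod_homD(1)[OF \<epsilon> that] by (simp add: hom_mod_simps)
  have \<delta>\<delta>: "\<delta> n (\<delta> (Suc n) p) = \<zero>\<^bsub>P n\<^esub>" if p: "p \<in> carrier (P (Suc (Suc n)))" for n p
  proof (rule semidualizing_unit_inj[OF sd pr])
    fix c assume c: "c \<in> carrier C"
    show "pure_tensor R C (P n) c (\<delta> n (\<delta> (Suc n) p)) = \<zero>\<^bsub>?X n\<^esub>"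
      using DD[OF pc[OF c p]] D_pure[OF c] p \<delta>D(1) by simp
  qed (use p \<delta>D(1) in simp)
  have \<epsilon>\<delta>: "?\<epsilon> (\<delta> 0 p) = \<zero>\<^bsub>hom_mod R C M\<^esub>" if p: "p \<in> carrier (P (Suc 0))" for p
    unfolding hom_mod_simps
  proof (rule mod_hom_ext[OF \<epsilon>h mod_hom_const_zero[OF C M]])
    fix c assume c: "c \<in> carrier C"
    show "?\<epsilon> (\<delta> 0 p) c = (\<lambda>x\<in>carrier C. \<zero>\<^bsub>M\<^esub>) c"
      using ED[OF pc[OF c p]] D_pure[OF c p] p \<delta>D(1) c by (simp add: \<epsilon>_app)
  qed (use p \<delta>D(1) in simp)
  have aug: "aug_complex R P \<delta> (hom_mod R C M) ?\<epsilon>"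
    unfolding aug_complex_def using \<delta>(1) \<epsilon> \<delta>\<delta> \<epsilon>\<delta> by blast

  \<comment> \<open>Exactness is tested against the copy \<open>Q\<close> of \<open>R\<close>, whose homs \<open>Q \<rightarrow> P n\<close> are the elements of \<open>P n\<close>.\<close>
  define Q :: "('a, 's \<Rightarrow> 'a) module" where "Q = free_mod R {undefined}"
  define q :: "'s \<Rightarrow> 'a" where "q = free_gen R undefined"
  let ?T = "tensor_mod R C Q"
  have Q: "projective R Q" unfolding Q_def by (rule projective_free_mod[OF C.R.is_cring])
  have Qm: "module R Q" by (rule projective_module[OF Q])
  have q: "q \<in> carrier Q" unfolding Q_def q_def by (rule free_gen_closed[OF C.R.is_cring]) simp
  have Q_hom: "\<exists>\<phi>\<in>mod_hom R Q L. \<phi> q = x" if "module R L" "x \<in> carrier L" for L :: "('a, 'y, 'z) module_scheme" and x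
    unfolding Q_def q_def
    by (rule bexI[of _ "free_lift R {undefined} L (\<lambda>_. x)"])
      (simp_all add: that free_lift_hom[OF that(1)] free_lift_gen[OF that(1)])
  have T: "module R ?T" by (rule module_tensor_mod[OF C Qm])
  note qT = pure_tensor_closed[OF C Qm]
  have "aug_exact (\<lambda>n. hom_mod R ?T (?X n)) (\<lambda>n f. compose (carrier ?T) (D n) f)
      (hom_mod R ?T M) (\<lambda>f. compose (carrier ?T) E f)"
    using proper Q unfolding proper_PC_resolution_def Let_def by blast
  then have ex: "(\<lambda>f. compose (carrier ?T) E f) ` mod_hom R ?T (?X 0) = mod_hom R ?T M"
    "{f \<in> mod_hom R ?T (?X 0). compose (carrier ?T) E f = (\<lambda>x\<in>carrier ?T. \<zero>\<^bsub>M\<^esub>)} =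
      (\<lambda>f. compose (carrier ?T) (D 0) f) ` mod_hom R ?T (?X (Suc 0))"
    "\<And>n. {f \<in> mod_hom R ?T (?X (Suc n)). compose (carrier ?T) (D n) f = (\<lambda>x\<in>carrier ?T. \<zero>\<^bsub>?X n\<^esub>)} =
      (\<lambda>f. compose (carrier ?T) (D (Suc n)) f) ` mod_hom R ?T (?X (Suc (Suc n)))"
    unfolding aug_exact_def hom_mod_simps by simp_all
  \<comment> \<open>The element p is encoded as the map \<phi> with \<phi> q = p. A lift of the
    induced map through D n is itself induced by some \<psi>, and \<psi> q is the preimage of
    p.\<close>
  have im: "p \<in> \<delta> n ` carrier (P (Suc n))"
    if p: "p \<in> carrier (P n)" and \<phi>: "\<phi> \<in> mod_hom R Q (P n)" "\<phi> q = p"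
      and f: "tensor_map R C Q (P n) \<phi> \<in> (\<lambda>f. compose (carrier ?T) (D n) f) ` mod_hom R ?T (?X (Suc n))"
    for n p \<phi>
  proof -
    obtain f where f: "f \<in> mod_hom R ?T (?X (Suc n))" "tensor_map R C Q (P n) \<phi> = compose (carrier ?T) (D n) f"
      using f by blast
    obtain \<psi> where \<psi>: "\<psi> \<in> mod_hom R Q (P (Suc n))" "f = tensor_map R C Q (P (Suc n)) \<psi>"
      using tensor_full_faithful[OF sd pr Qm f(1)] by blast
    have \<psi>q: "\<psi> q \<in> carrier (P (Suc n))" by (rule mod_homD(1)[OF \<psi>(1) q])
    have "p = \<delta> n (\<psi> q)"
    proof (rule pure_tensor_cancel[OF sd pr p])
      fix c assume c: "c \<in> carrier C"
      show "pure_tensor R C (P n) c p = pure_tensor R C (P n) c (\<delta> n (\<psi> q))"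
        using fun_cong[OF f(2), of "pure_tensor R C Q c q"] c q \<psi>q \<phi>(2)
        by (simp add: compose_eq qT \<psi>(2) tensor_map_pure[OF C Qm Pm \<phi>(1)]
            tensor_map_pure[OF C Qm Pm \<psi>(1)] D_pure)
    qed (rule \<delta>D(1)[OF \<psi>q])
    then show ?thesis using \<psi>q by blast
  qed
  have surj: "f \<in> ?\<epsilon> ` carrier (P 0)" if f: "f \<in> mod_hom R C M" for f
  proof -
    \<comment> \<open>The element f of Hom(C, M) becomes a map from Q sending q to f, and uncurrying
      makes it a map C \<otimes> Q \<rightarrow> M, to which properness applies.\<close>
    obtain \<phi> where \<phi>: "\<phi> \<in> mod_hom R Q (hom_mod R C M)" "\<phi> q = f"
      using Q_hom[OF H, of f] f by (auto simp: hom_mod_simps)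
    let ?h = "tensor_lift R C Q M (\<lambda>c p. \<phi> p c)"
    have h: "?h \<in> mod_hom R ?T M" "tensor_curry R C Q ?h = \<phi>"
      using tensor_uncurry[OF C Qm M \<phi>(1)] by auto
    then obtain g where g: "g \<in> mod_hom R ?T (?X 0)" "?h = compose (carrier ?T) E g"
      using ex(1) by blast
    obtain \<psi> where \<psi>: "\<psi> \<in> mod_hom R Q (P 0)" "g = tensor_map R C Q (P 0) \<psi>"
      using tensor_full_faithful[OF sd pr Qm g(1)] by blast
    have \<psi>q: "\<psi> q \<in> carrier (P 0)" by (rule mod_homD(1)[OF \<psi>(1) q])
    have "f = ?\<epsilon> (\<psi> q)"
    proof (rule mod_hom_ext[OF f \<epsilon>h[OF \<psi>q]])
      fix c assume c: "c \<in> carrier C"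
      have "f c = ?h (pure_tensor R C Q c q)"
        using fun_cong[OF fun_cong[OF h(2), of q], of c] c q \<phi>(2) by (simp add: tensor_curry_def)
      also have "\<dots> = E (pure_tensor R C (P 0) c (\<psi> q))"
        unfolding g(2) \<psi>(2) using c q by (simp add: compose_eq qT tensor_map_pure[OF C Qm Pm \<psi>(1)])
      finally show "f c = ?\<epsilon> (\<psi> q) c" using \<epsilon>_app[OF \<psi>q c] by simp
    qed
    then show ?thesis using \<psi>q by blast
  qed
  have ker0: "p \<in> \<delta> 0 ` carrier (P (Suc 0))" if p: "p \<in> carrier (P 0)" "?\<epsilon> p = \<zero>\<^bsub>hom_mod R C M\<^esub>" for p
  proof -
    obtain \<phi> where \<phi>: "\<phi> \<in> mod_hom R Q (P 0)" "\<phi> q = p" using Q_hom[OF Pm p(1)] by blast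
    let ?f = "tensor_map R C Q (P 0) \<phi>"
    have f: "?f \<in> mod_hom R ?T (?X 0)" by (rule tensor_map_hom[OF C Qm Pm \<phi>(1)])
    \<comment> \<open>Q is free on the single generator q, so vanishing at \<phi> q = p extends to
      all of Q.\<close>
    have \<epsilon>\<phi>: "compose (carrier Q) ?\<epsilon> \<phi> = (\<lambda>x\<in>carrier Q. \<zero>\<^bsub>hom_mod R C M\<^esub>)"
      unfolding Q_def
      by (rule free_mod_hom_ext[OF H mod_hom_compose[OF _ _ \<epsilon>] mod_hom_const_zero[OF _ H]])
        (use Qm \<phi> p q in \<open>auto simp: Q_def q_def compose_eq\<close>)
    have "compose (carrier ?T) E ?f = (\<lambda>x\<in>carrier ?T. \<zero>\<^bsub>M\<^esub>)"
    proof (rule tensor_mod_hom_ext[OF C Qm M mod_hom_compose[OF T f E] mod_hom_const_zero[OF T M]])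
      fix c x assume c: "c \<in> carrier C" and x: "x \<in> carrier Q"
      have "E (pure_tensor R C (P 0) c (\<phi> x)) = ?\<epsilon> (\<phi> x) c"
        using \<epsilon>_app[OF mod_homD(1)[OF \<phi>(1) x] c] by simp
      also have "\<dots> = \<zero>\<^bsub>M\<^esub>"
        using fun_cong[OF \<epsilon>\<phi>, of x] x c by (simp add: compose_eq hom_mod_simps)
      finally show "compose (carrier ?T) E ?f (pure_tensor R C Q c x) =
          (\<lambda>x\<in>carrier ?T. \<zero>\<^bsub>M\<^esub>) (pure_tensor R C Q c x)"
        using c x by (simp add: compose_eq qT tensor_map_pure[OF C Qm Pm \<phi>(1)])
    qed
    then show ?thesis using im[OF p(1) \<phi>] f ex(2) by blast
  qed
  have ker: "p \<in> \<delta> (Suc n) ` carrier (P (Suc (Suc n)))"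
    if p: "p \<in> carrier (P (Suc n))" "\<delta> n p = \<zero>\<^bsub>P n\<^esub>" for n p
  proof -
    obtain \<phi> where \<phi>: "\<phi> \<in> mod_hom R Q (P (Suc n))" "\<phi> q = p" using Q_hom[OF Pm p(1)] by blast
    let ?f = "tensor_map R C Q (P (Suc n)) \<phi>"
    have f: "?f \<in> mod_hom R ?T (?X (Suc n))" by (rule tensor_map_hom[OF C Qm Pm \<phi>(1)])
    have \<delta>\<phi>: "compose (carrier Q) (\<delta> n) \<phi> = (\<lambda>x\<in>carrier Q. \<zero>\<^bsub>P n\<^esub>)"
      unfolding Q_def
      by (rule free_mod_hom_ext[OF Pm mod_hom_compose[OF _ _ \<delta>(1)] mod_hom_const_zero[OF _ Pm]])
        (use Qm \<phi> p q in \<open>auto simp: Q_def q_def compose_eq\<close>)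
    have "compose (carrier ?T) (D n) ?f = (\<lambda>x\<in>carrier ?T. \<zero>\<^bsub>?X n\<^esub>)"
    proof (rule tensor_mod_hom_ext[OF C Qm X mod_hom_compose[OF T f D] mod_hom_const_zero[OF T X]])
      fix c x assume c: "c \<in> carrier C" and x: "x \<in> carrier Q"
      have "\<delta> n (\<phi> x) = \<zero>\<^bsub>P n\<^esub>" using fun_cong[OF \<delta>\<phi>, of x] x by (simp add: compose_eq)
      then show "compose (carrier ?T) (D n) ?f (pure_tensor R C Q c x) =
          (\<lambda>x\<in>carrier ?T. \<zero>\<^bsub>?X n\<^esub>) (pure_tensor R C Q c x)"
        using c x mod_homD(1)[OF \<phi>(1) x]
        by (simp add: compose_eq qT tensor_map_pure[OF C Qm Pm \<phi>(1)] D_pure pure_tensor_zero_right[OF C Pm])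
    qed
    then show ?thesis using im[OF p(1) \<phi>] f ex(3) by blast
  qed
  have "aug_exact P \<delta> (hom_mod R C M) ?\<epsilon>"
    unfolding aug_exact_def
  proof (intro conjI allI equalityI subsetI)
    fix f assume "f \<in> ?\<epsilon> ` carrier (P 0)"
    then show "f \<in> carrier (hom_mod R C M)" using mod_homD(1)[OF \<epsilon>] by auto
  next
    fix f assume "f \<in> carrier (hom_mod R C M)"
    then show "f \<in> ?\<epsilon> ` carrier (P 0)" using surj by (simp add: hom_mod_simps)
  next
    fix p assume "p \<in> \<delta> 0 ` carrier (P (Suc 0))"
    then show "p \<in> {p \<in> carrier (P 0). ?\<epsilon> p = \<zero>\<^bsub>hom_mod R C M\<^esub>}" using \<epsilon>\<delta> \<delta>D(1) by auto
  next
    fix n p assume "p \<in> \<delta> (Suc n) ` carrier (P (Suc (Suc n)))"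
    then show "p \<in> {p \<in> carrier (P (Suc n)). \<delta> n p = \<zero>\<^bsub>P n\<^esub>}" using \<delta>\<delta> \<delta>D(1) by auto
  qed (use ker0 ker in auto)
  then have "projective_resolution R (hom_mod R C M) P \<delta> ?\<epsilon>"
    using pr aug by (simp add: projective_resolution_def)
  then show ?thesis using \<delta>(2) by blast
qed

section \<open>Right exactness of the tensor product\<close>

lemma tensor_mod_span:
  assumes A: "module R A" and B: "module R B" and H: "submodule H R (tensor_mod R A B)"
    and pure: "\<And>x y. x \<in> carrier A \<Longrightarrow> y \<in> carrier B \<Longrightarrow> pure_tensor R A B x y \<in> H"
  shows "carrier (tensor_mod R A B) \<subseteq> H"
proof
  note T = module_tensor_mod[OF A B]
  note p = quot_proj_hom[OF T H] and Qm = module_quot_mod[OF T H]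
  note pc = pure_tensor_closed[OF A B]
  \<comment> \<open>The projection modulo H kills all pure tensors and hence equals the zero map, so
    every element lies in H.\<close>
  have eq: "(\<lambda>x\<in>carrier (tensor_mod R A B). H +>\<^bsub>tensor_mod R A B\<^esub> x) =
      (\<lambda>x\<in>carrier (tensor_mod R A B). \<zero>\<^bsub>quot_mod (tensor_mod R A B) H\<^esub>)"
    by (rule tensor_mod_hom_ext[OF A B Qm p mod_hom_const_zero[OF T Qm]])
      (simp add: pc quot_mod_simps coset_zero_iff[OF T H] pure)
  fix u assume u: "u \<in> carrier (tensor_mod R A B)"
  then show "u \<in> H"
    using fun_cong[OF eq, of u] by (simp add: quot_mod_simps coset_zero_iff[OF T H])
qed

lemma tensor_map_surj:
  assumes C: "module R C" and P: "module R P" and Q: "module R Q" and e: "e \<in> mod_hom R P Q"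
    and surj: "e ` carrier P = carrier Q"
  shows "tensor_map R C P Q e ` carrier (tensor_mod R C P) = carrier (tensor_mod R C Q)"
proof
  note h = tensor_map_hom[OF C P Q e]
  show "tensor_map R C P Q e ` carrier (tensor_mod R C P) \<subseteq> carrier (tensor_mod R C Q)"
    using mod_homD(1)[OF h] by auto
  show "carrier (tensor_mod R C Q) \<subseteq> tensor_map R C P Q e ` carrier (tensor_mod R C P)"
  proof (rule tensor_mod_span[OF C Q submodule_image[OF module_tensor_mod[OF C P] module_tensor_mod[OF C Q] h]])
    fix c y assume c: "c \<in> carrier C" and "y \<in> carrier Q"
    then have "y \<in> e ` carrier P" using surj by simp
    then obtain p where p: "p \<in> carrier P" "y = e p" by (rule imageE) auto
    show "pure_tensor R C Q c y \<in> tensor_map R C P Q e ` carrier (tensor_mod R C P)"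
      unfolding p(2) tensor_map_pure[OF C P Q e c p(1), symmetric]
      by (rule imageI[OF pure_tensor_closed[OF C P c p(1)]])
  qed
qed

text \<open>A map from C \<otimes> Q to the cokernel of C \<otimes> d is constructed, sending c
  \<otimes> e p to the class of c \<otimes> p. Composed with C \<otimes> e it is the coset map, so
  an element killed by C \<otimes> e has trivial class.\<close>

lemma tensor_right_exact:
  assumes C: "module R C" and X: "module R X" and P: "module R P" and Q: "module R Q"
    and d: "d \<in> mod_hom R X P" and e: "e \<in> mod_hom R P Q" and surj: "e ` carrier P = carrier Q"
    and ker: "\<And>p. p \<in> carrier P \<Longrightarrow> e p = \<zero>\<^bsub>Q\<^esub> \<Longrightarrow> p \<in> d ` carrier X"
    and u: "u \<in> carrier (tensor_mod R C P)" "tensor_map R C P Q e u = \<zero>\<^bsub>tensor_mod R C Q\<^esub>"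
  shows "u \<in> tensor_map R C X P d ` carrier (tensor_mod R C X)"
proof -
  interpret P: module R P by (rule P)
  interpret Q: module R Q by (rule Q)
  note T = module_tensor_mod[OF C P] and TX = module_tensor_mod[OF C X] and TQ = module_tensor_mod[OF C Q]
  interpret T: module R "tensor_mod R C P" by (rule T)
  let ?I = "tensor_map R C X P d ` carrier (tensor_mod R C X)"
  have I: "submodule ?I R (tensor_mod R C P)"
    by (rule submodule_image[OF TX T tensor_map_hom[OF C X P d]])
  let ?W = "quot_mod (tensor_mod R C P) ?I" and ?cos = "\<lambda>v. ?I +>\<^bsub>tensor_mod R C P\<^esub> v"
  note W = module_quot_mod[OF T I]
  note pc = pure_tensor_closed[OF C P] and bil = pure_tensor_bilinear[OF C P]
  note eD = mod_homD[OF e]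
  \<comment> \<open>The section s of e is a map of sets only. Linearity in y appears after passing
    to cosets, because by \<open>wd\<close> the class of c \<otimes> p depends on e p alone.\<close>
  have "\<forall>y\<in>carrier Q. \<exists>p\<in>carrier P. e p = y" using surj by (metis imageE)
  then obtain s where s: "\<And>y. y \<in> carrier Q \<Longrightarrow> s y \<in> carrier P" "\<And>y. y \<in> carrier Q \<Longrightarrow> e (s y) = y"
    by metis
  have wd: "?cos (pure_tensor R C P c p) = ?cos (pure_tensor R C P c p')"
    if c: "c \<in> carrier C" and p: "p \<in> carrier P" "p' \<in> carrier P" "e p = e p'" for c p p'
  proof -
    have "e (p \<ominus>\<^bsub>P\<^esub> p') = \<zero>\<^bsub>Q\<^esub>"
      using p eD(1) by (simp add: mod_hom_diff[OF P Q e] Q.minus_eq_zero_iff)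
    then obtain x where x: "x \<in> carrier X" "p \<ominus>\<^bsub>P\<^esub> p' = d x" using ker[of "p \<ominus>\<^bsub>P\<^esub> p'"] p by auto
    have "pure_tensor R C P c p \<ominus>\<^bsub>tensor_mod R C P\<^esub> pure_tensor R C P c p' = pure_tensor R C P c (d x)"
      using mod_hom_diff[OF P T pure_tensor_hom_right[OF C P c] p(1,2)] p x(2) mod_homD(1)[OF d x(1)]
      by simp
    also have "\<dots> = tensor_map R C X P d (pure_tensor R C X c x)"
      using tensor_map_pure[OF C X P d c x(1)] by simp
    finally show ?thesis
      using coset_eq_iff[OF T I pc[OF c p(1)] pc[OF c p(2)]] pure_tensor_closed[OF C X c x(1)] by auto
  qed
  have bl: "bilinear R C Q ?W (\<lambda>c y. ?cos (pure_tensor R C P c (s y)))"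
    unfolding bilinear_def
  proof (intro conjI ballI)
    fix c y assume "c \<in> carrier C" "y \<in> carrier Q"
    then show "?cos (pure_tensor R C P c (s y)) \<in> carrier ?W"
      by (intro quot_mod_closed[OF T I] pc s(1))
  next
    fix c c' y assume "c \<in> carrier C" "c' \<in> carrier C" "y \<in> carrier Q"
    then show "?cos (pure_tensor R C P (c \<oplus>\<^bsub>C\<^esub> c') (s y)) =
        ?cos (pure_tensor R C P c (s y)) \<oplus>\<^bsub>?W\<^esub> ?cos (pure_tensor R C P c' (s y))"
      by (simp add: quot_mod_add[OF T I] pc s(1) bil)
  next
    fix c y y' assume a: "c \<in> carrier C" "y \<in> carrier Q" "y' \<in> carrier Q"
    have "?cos (pure_tensor R C P c (s (y \<oplus>\<^bsub>Q\<^esub> y'))) = ?cos (pure_tensor R C P c (s y \<oplus>\<^bsub>P\<^esub> s y'))"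
      by (rule wd) (use a s eD in simp_all)
    then show "?cos (pure_tensor R C P c (s (y \<oplus>\<^bsub>Q\<^esub> y'))) =
        ?cos (pure_tensor R C P c (s y)) \<oplus>\<^bsub>?W\<^esub> ?cos (pure_tensor R C P c (s y'))"
      using a by (simp add: quot_mod_add[OF T I] pc s(1) bil)
  next
    fix a c y assume "a \<in> carrier R" "c \<in> carrier C" "y \<in> carrier Q"
    then show "?cos (pure_tensor R C P (a \<odot>\<^bsub>C\<^esub> c) (s y)) = a \<odot>\<^bsub>?W\<^esub> ?cos (pure_tensor R C P c (s y))"
      by (simp add: quot_mod_smult[OF T I] pc s(1) bil)
  next
    fix a c y assume a: "a \<in> carrier R" "c \<in> carrier C" "y \<in> carrier Q"
    have "?cos (pure_tensor R C P c (s (a \<odot>\<^bsub>Q\<^esub> y))) = ?cos (pure_tensor R C P c (a \<odot>\<^bsub>P\<^esub> s y))"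
      by (rule wd) (use a s eD in simp_all)
    then show "?cos (pure_tensor R C P c (s (a \<odot>\<^bsub>Q\<^esub> y))) = a \<odot>\<^bsub>?W\<^esub> ?cos (pure_tensor R C P c (s y))"
      using a by (simp add: quot_mod_smult[OF T I] pc s(1) bil)
  qed
  let ?l = "tensor_lift R C Q ?W (\<lambda>c y. ?cos (pure_tensor R C P c (s y)))"
  have l: "?l \<in> mod_hom R (tensor_mod R C Q) ?W"
    "\<And>c y. c \<in> carrier C \<Longrightarrow> y \<in> carrier Q \<Longrightarrow> ?l (pure_tensor R C Q c y) = ?cos (pure_tensor R C P c (s y))"
    using tensor_lift_hom_pure[OF C Q W bl] by auto
  have eq: "compose (carrier (tensor_mod R C P)) ?l (tensor_map R C P Q e) = (\<lambda>v\<in>carrier (tensor_mod R C P). ?cos v)"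
  proof (rule tensor_mod_hom_ext[OF C P W mod_hom_compose[OF T tensor_map_hom[OF C P Q e] l(1)] quot_proj_hom[OF T I]])
    fix c p assume cp: "c \<in> carrier C" "p \<in> carrier P"
    have "?cos (pure_tensor R C P c (s (e p))) = ?cos (pure_tensor R C P c p)"
      by (rule wd) (use cp s eD in simp_all)
    then show "compose (carrier (tensor_mod R C P)) ?l (tensor_map R C P Q e) (pure_tensor R C P c p) =
        (\<lambda>v\<in>carrier (tensor_mod R C P). ?cos v) (pure_tensor R C P c p)"
      using cp eD(1) by (simp add: compose_eq pc tensor_map_pure[OF C P Q e] l(2))
  qed
  have "?cos u = ?l (tensor_map R C P Q e u)" using fun_cong[OF eq, of u] u(1) by (simp add: compose_eq)
  also have "\<dots> = ?I"
    unfolding u(2) using mod_hom_zero[OF TQ W l(1)] by (simp add: quot_mod_simps)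
  finally show ?thesis using coset_zero_iff[OF T I u(1)] by blast
qed

section \<open>Comparing the Ext modules and using the Bass class\<close>

lemma homology_zero_exact:
  assumes X: "chain_complex R X d" and z: "zero_mod (homology X d (Suc i))"
    and x: "x \<in> carrier (X (Suc i))" "d i x = \<zero>\<^bsub>X i\<^esub>"
  shows "x \<in> d (Suc i) ` carrier (X (Suc (Suc i)))"
proof -
  note XD = chain_complexD[OF X]
  let ?Z = "{x \<in> carrier (X (Suc i)). d i x = \<zero>\<^bsub>X i\<^esub>}" and ?B = "d (Suc i) ` carrier (X (Suc (Suc i)))"
  have Z: "submodule ?Z R (X (Suc i))" by (rule submodule_kernel[OF XD(1,1,2)])
  have B: "submodule ?B R (X (Suc i))" by (rule submodule_image[OF XD(1,1,2)])
  have "?B \<subseteq> ?Z" using XD(3) mod_homD(1)[OF XD(2)] by auto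
  note sub = submodule_of_submodule[OF XD(1) Z B this]
  have "zero_mod (quot_mod ((X (Suc i))\<lparr>carrier := ?Z\<rparr>) ?B)"
    using z by (simp add: homology_def)
  then have "?Z \<subseteq> ?B"
    using quot_mod_zero_iff[OF submodule.submodule_is_module[OF Z XD(1)] sub] by simp
  then show ?thesis using x by blast
qed

lemma Tor_resolution:
  fixes R :: "('a, 'r) ring_scheme" and C :: "('a, 'c, 'k) module_scheme" and M :: "('a, 'b, 'm) module_scheme"
  assumes "module R M"
  obtains P :: "nat \<Rightarrow> ('a, ('a, 'b) res) module" and d e
  where "projective_resolution R M P d e"
    "\<And>i. Tor R C M i = homology (\<lambda>n. tensor_mod R C (P n)) (\<lambda>n. tensor_map R C (P (Suc n)) (P n) (d n)) i"
proof -
  let ?S = "SOME (P, d, e). projective_resolution R M (P :: nat \<Rightarrow> ('a, ('a, 'b) res) module) d e"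
  obtain P d e where P: "?S = (P, d, e)" by (cases ?S)
  have "\<exists>S. case S of (P :: nat \<Rightarrow> ('a, ('a, 'b) res) module, d, e) \<Rightarrow> projective_resolution R M P d e"
    using ex_projective_resolution[OF assms] by auto
  then have "case ?S of (P, d, e) \<Rightarrow> projective_resolution R M P d e" by (rule someI_ex)
  then have "projective_resolution R M P d e" by (simp add: P)
  then show thesis by (rule that) (simp add: Tor_def P)
qed

text \<open>The choice in \<open>Ext_PC\<close> really yields a proper resolution, because
  \<open>projective_to_proper\<close> provides one in the required type.
  \<open>proper_to_projective\<close> then describes whichever one was chosen.\<close>

lemma Ext_PC_iso:
  fixes R :: "('a, 'r) ring_scheme" and C :: "('a, 'c, 'k) module_scheme"
    and M :: "('a, 'm, 'l) module_scheme" and N :: "('a, 'n, 'o) module_scheme"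
  assumes sd: "semidualizing R C" and M: "module R M" and N: "module R N"
  shows "mod_isomorphic R (Ext_PC R C M N i) (Ext R (hom_mod R C M) (hom_mod R C N) i) \<and>
    module R (Ext_PC R C M N i)"
proof -
  have C: "module R C" using sd by (simp add: semidualizing_def)
  have HM: "module R (hom_mod R C M)" and HN: "module R (hom_mod R C N)"
    using module_hom_mod C M N by blast+
  let ?S = "SOME (P, d, e). proper_PC_resolution R C M (P :: nat \<Rightarrow> ('a, ('a, 'c \<Rightarrow> 'm) res) module) d e"
  obtain P D E where S: "?S = (P, D, E)" by (cases ?S)
  obtain P0 :: "nat \<Rightarrow> ('a, ('a, 'c \<Rightarrow> 'm) res) module" and d0 e0
    where "projective_resolution R (hom_mod R C M) P0 d0 e0"
    using ex_projective_resolution[OF HM] by blast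
  from projective_to_proper[OF sd M this]
  have "\<exists>S. case S of (P :: nat \<Rightarrow> ('a, ('a, 'c \<Rightarrow> 'm) res) module, d, e) \<Rightarrow> proper_PC_resolution R C M P d e"
    by (intro exI[of _ "(P0, _, _)"]) (simp only: prod.case)
  then have "case ?S of (P, d, e) \<Rightarrow> proper_PC_resolution R C M P d e" by (rule someI_ex)
  then have "proper_PC_resolution R C M P D E" by (simp add: S)
  from proper_to_projective[OF sd M this] obtain \<delta> \<epsilon> where
    P: "projective_resolution R (hom_mod R C M) P \<delta> \<epsilon>"
    and Dn: "\<forall>n. D n = tensor_map R C (P (Suc n)) (P n) (\<delta> n)" by blast
  have D: "D = (\<lambda>n. tensor_map R C (P (Suc n)) (P n) (\<delta> n))" using Dn by (intro ext) simp
  note Pc = resolutionD(1)[OF projective_resolutionD(1)[OF P HM]]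
  have Ex: "Ext_PC R C M N i = hom_cohomology R (\<lambda>n. tensor_mod R C (P n)) D N i"
    by (simp add: Ext_PC_def S)
  have m: "module R (Ext_PC R C M N i)"
    unfolding Ex D by (rule module_hom_cohomology[OF tensor_chain_complex[OF C Pc] N])
  show ?thesis
    by (intro conjI m mod_isomorphic_trans[OF m _ Ext_iso(1)[OF P HM HN]])
      (unfold Ex D, rule tensor_cohomology_iso[OF C Pc N])
qed

text \<open>Both sides are the cohomology of Hom(C \<otimes> P, N): the left by adjunction, the
  right because C \<otimes> P is a resolution of M by modules acyclic for N.\<close>

lemma Bass_class_Ext_iso:
  fixes R :: "('a, 'r) ring_scheme" and C :: "('a, 'c, 'k) module_scheme"
    and M :: "('a, 'm, 'l) module_scheme" and N :: "('a, 'n, 'o) module_scheme"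
  assumes C: "module R C" and M: "Bass_class R C M" and N: "Bass_class R C N"
  shows "mod_isomorphic R (Ext R (hom_mod R C M) (hom_mod R C N) i) (Ext R M N i)"
proof -
  have Mm: "module R M" and Nm: "module R N" using M N by (simp_all add: Bass_class_def)
  let ?H = "hom_mod R C M"
  have H: "module R ?H" and HN: "module R (hom_mod R C N)"
    using module_hom_mod C Mm Nm by blast+
  \<comment> \<open>The resolution chosen inside \<open>Tor\<close> is taken, since the Bass
    condition speaks of the homology of C \<otimes> P for this very P.\<close>
  obtain P :: "nat \<Rightarrow> ('a, ('a, 'c \<Rightarrow> 'm) res) module" and \<delta> \<epsilon> where P: "projective_resolution R ?H P \<delta> \<epsilon>"
    and Tor: "\<And>i. Tor R C ?H i = homology (\<lambda>n. tensor_mod R C (P n))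
      (\<lambda>n. tensor_map R C (P (Suc n)) (P n) (\<delta> n)) i"
    using Tor_resolution[OF H] by blast
  note PR = projective_resolutionD[OF P H]
  note PD = resolutionD[OF PR(1)]
  let ?X = "\<lambda>n. tensor_mod R C (P n)" and ?D = "\<lambda>n. tensor_map R C (P (Suc n)) (P n) (\<delta> n)"
  note TC = tensor_chain_complex[OF C PD(1)]
  note TD = chain_complexD[OF TC]
  have TH: "module R (tensor_mod R C ?H)" by (rule module_tensor_mod[OF C H])
  have ev: "evaluation R C M \<in> mod_hom R (tensor_mod R C ?H) M"
    "bij_betw (evaluation R C M) (carrier (tensor_mod R C ?H)) (carrier M)"
    using M by (simp_all add: Bass_class_def is_mod_iso_def)
  let ?e = "tensor_map R C (P 0) ?H \<epsilon>"
  have e: "?e \<in> mod_hom R (?X 0) (tensor_mod R C ?H)" by (rule tensor_map_hom[OF C PD(2) H PD(5)])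
  \<comment> \<open>The augmentation passes through C \<otimes> Hom(C, M). Right exactness controls
    the first map and evaluation is bijective, which gives surjectivity and exactness at
    \<open>?X 0\<close>.\<close>
  let ?E = "compose (carrier (?X 0)) (evaluation R C M) ?e"
  have E: "?E \<in> mod_hom R (?X 0) M" by (rule mod_hom_compose[OF TD(1) e ev(1)])
  interpret TH: module R "tensor_mod R C ?H" by (rule TH)
  have ev0: "evaluation R C M v = \<zero>\<^bsub>M\<^esub> \<longleftrightarrow> v = \<zero>\<^bsub>tensor_mod R C ?H\<^esub>" if "v \<in> carrier (tensor_mod R C ?H)" for v
    using inj_onD[OF bij_betw_imp_inj_on[OF ev(2)] _ that TH.zero_closed] mod_hom_zero[OF TH Mm ev(1)] by auto
  have eD: "?e (?D 0 x) = \<zero>\<^bsub>tensor_mod R C ?H\<^esub>" if x: "x \<in> carrier (?X (Suc 0))" for x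
  proof -
    have eq: "compose (carrier (?X (Suc 0))) ?e (?D 0) = (\<lambda>x\<in>carrier (?X (Suc 0)). \<zero>\<^bsub>tensor_mod R C ?H\<^esub>)"
      by (rule tensor_mod_hom_ext[OF C PD(2) TH mod_hom_compose[OF TD(1,2) e] mod_hom_const_zero[OF TD(1) TH]])
        (simp add: compose_eq pure_tensor_closed[OF C PD(2)] tensor_map_pure[OF C PD(2,2,4)]
          tensor_map_pure[OF C PD(2) H PD(5)] mod_homD(1)[OF PD(4)] PD(7) pure_tensor_zero_right[OF C H])
    show ?thesis using fun_cong[OF eq, of x] x by (simp add: compose_eq)
  qed
  have ED: "?E (?D 0 x) = \<zero>\<^bsub>M\<^esub>" if "x \<in> carrier (?X (Suc 0))" for x
    using mod_homD(1)[OF TD(2) that] eD[OF that] mod_hom_zero[OF TH Mm ev(1)] by (simp add: compose_eq)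
  have surj: "?E ` carrier (?X 0) = carrier M"
  proof -
    have "?E ` carrier (?X 0) = evaluation R C M ` ?e ` carrier (?X 0)"
      by (simp add: compose_def image_image)
    also have "\<dots> = carrier M"
      unfolding tensor_map_surj[OF C PD(2) H PD(5,8)] using ev(2) by (simp add: bij_betw_def)
    finally show ?thesis .
  qed
  have ker0: "x \<in> ?D 0 ` carrier (?X (Suc 0))" if x: "x \<in> carrier (?X 0)" "?E x = \<zero>\<^bsub>M\<^esub>" for x
  proof (rule tensor_right_exact[OF C PD(2) PD(2) H PD(4,5,8) PD(9) x(1)])
    show "?e x = \<zero>\<^bsub>tensor_mod R C ?H\<^esub>"
      using x ev0[OF mod_homD(1)[OF e x(1)]] by (simp add: compose_eq)
  qed
  have ker: "x \<in> ?D (Suc n) ` carrier (?X (Suc (Suc n)))"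
    if "x \<in> carrier (?X (Suc n))" "?D n x = \<zero>\<^bsub>?X n\<^esub>" for n x
  proof (rule homology_zero_exact[OF TC _ that])
    have "zero_mod (Tor R C ?H (Suc n))" using M by (simp add: Bass_class_def)
    then show "zero_mod (homology ?X ?D (Suc n))" unfolding Tor .
  qed
  have "resolution R ?X ?D M ?E"
    unfolding resolution_def
  proof (intro conjI allI)
    show "aug_complex R ?X ?D M ?E"
      unfolding aug_complex_def using TD E ED by blast
    show "aug_exact ?X ?D M ?E"
      unfolding aug_exact_def
    proof (intro conjI allI equalityI subsetI)
      fix x assume "x \<in> ?D 0 ` carrier (?X (Suc 0))"
      then show "x \<in> {x \<in> carrier (?X 0). ?E x = \<zero>\<^bsub>M\<^esub>}"
        using ED mod_homD(1)[OF TD(2)] by (elim imageE) simp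
    next
      fix n x assume "x \<in> ?D (Suc n) ` carrier (?X (Suc (Suc n)))"
      then show "x \<in> {x \<in> carrier (?X (Suc n)). ?D n x = \<zero>\<^bsub>?X n\<^esub>}"
        using TD(3) mod_homD(1)[OF TD(2)] by (elim imageE) simp
    next
      fix x assume "x \<in> {x \<in> carrier (?X 0). ?E x = \<zero>\<^bsub>M\<^esub>}"
      then show "x \<in> ?D 0 ` carrier (?X (Suc 0))" by (intro ker0) auto
    next
      fix n x assume "x \<in> {x \<in> carrier (?X (Suc n)). ?D n x = \<zero>\<^bsub>?X n\<^esub>}"
      then show "x \<in> ?D (Suc n) ` carrier (?X (Suc (Suc n)))" by (intro ker) auto
    qed (use surj in auto)
  qed (rule TD(1) Mm)+
  moreover have "hom_acyclic R C N" using N by (simp add: Bass_class_def hom_acyclic_def)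
  then have "hom_acyclic R (?X n) N" for n
    by (rule tensor_projective_acyclic[OF _ C Nm PR(2)])
  ultimately have ac: "mod_isomorphic R (hom_cohomology R ?X ?D N i) (Ext R M N i)"
    by (rule acyclic_resolution_Ext[OF _ Nm])
  have mX: "module R (hom_cohomology R ?X ?D N i)" by (rule module_hom_cohomology[OF TC Nm])
  have mP: "module R (hom_cohomology R P \<delta> (hom_mod R C N) i)" by (rule module_hom_cohomology[OF PD(1) HN])
  have "mod_isomorphic R (hom_cohomology R P \<delta> (hom_mod R C N) i) (hom_cohomology R ?X ?D N i)"
    by (rule mod_isomorphic_sym[OF mX mP tensor_cohomology_iso[OF C PD(1) Nm]])
  then show ?thesis
    using mod_isomorphic_trans[OF module_Ext[OF H HN] Ext_iso(2)[OF P H HN]]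
      mod_isomorphic_trans[OF mP _ ac] by blast
qed

theorem theorem3:
  fixes R :: "('a, 'r) ring_scheme"
    and C :: "('a, 'c, 'k) module_scheme"
    and M :: "('a, 'm, 'l) module_scheme"
    and N :: "('a, 'n, 'o) module_scheme"
  assumes "cring R" and "semidualizing R C" and "module R M" and "module R N"
  shows "(\<forall>i. mod_isomorphic R (Ext_PC R C M N i) (Ext R (hom_mod R C M) (hom_mod R C N) i)) \<and>
    (Bass_class R C M \<and> Bass_class R C N \<longrightarrow>
      (\<forall>i. mod_isomorphic R (Ext_PC R C M N i) (Ext R M N i)))"
proof (intro conjI impI allI)
  have C: "module R C" using assms(2) by (simp add: semidualizing_def)
  note iso = Ext_PC_iso[OF assms(2-4)]
  show "mod_isomorphic R (Ext_PC R C M N i) (Ext R (hom_mod R C M) (hom_mod R C N) i)" for i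
    using iso by blast
  show "mod_isomorphic R (Ext_PC R C M N i) (Ext R M N i)"
    if "Bass_class R C M \<and> Bass_class R C N" for i
    using mod_isomorphic_trans[OF iso[THEN conjunct2] iso[THEN conjunct1]]
      Bass_class_Ext_iso[OF C] that by blast
qed

end
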